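(* Let $\hbar>0$, $a>0$ and $0<\eta<1$, and let $R$ and $S$ be the density matrices on $L^2(\mathbf R)$ given by $$R=\tfrac{1+\eta}2|a\rangle\langle a|+\tfrac{1-\eta}2|-a\rangle\langle -a|,\qquad S=\tfrac12|a\rangle\langle a|+\tfrac12|-a\rangle\langle -a|.$$ Then $$MK_2(R,S)^2<W_2\big(\tfrac{1+\eta}2\delta_a+\tfrac{1-\eta}2\delta_{-a},\ \tfrac12\delta_a+\tfrac12\delta_{-a}\big)^2=2\eta a^2.$$
   Context: Let $\mathfrak H=L^2(\mathbf R)$ and $\hbar>0$. For $c\in\mathbf R$, $|c\rangle\in\mathfrak H$ is the (normalized) coherent state $x\mapsto(\pi\hbar)^{-1/4}e^{-(x-c)^2/2\hbar}$, and $|c\rangle\langle c|$ is the orthogonal projection onto its span. A density matrix on a Hilbert space is a self-adjoint nonnegative operator of trace $1$. A coupling of two density matrices $R,S$ on $\mathfrak H$ is a density matrix $Q$ on $\mathfrak H\otimes\mathfrak H\cong L^2(\mathbf R^2)$ such that $\operatorname{trace}((A\otimes I)Q)=\operatorname{trace}(AR)$ and $\operatorname{trace}((I\otimes B)Q)=\operatorname{trace}(BS)$ for all bounded operators $A,B$ on $\mathfrak H$. The quantum transport cost is the self-adjoint nonnegative operator on $L^2(\mathbf R^2,dx\,dy)$ $$C=(x-y)^2-\hbar^2(\partial_x-\partial_y)^2-2\hbar,$$ and $$MK_2(R,S)^2:=\inf_{Q\text{ coupling of }R\text{ and }S}\operatorname{trace}(CQ),\qquad MK_2\ge 0,$$ where,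 for $Q\ge0$, $\operatorname{trace}(CQ)\in[0,+\infty]$ is understood as $\operatorname{trace}(C^{1/2}QC^{1/2})$. For probability measures $\mu,\nu$ on $\mathbf R$, $W_2(\mu,\nu)^2=\inf_\Pi\int|x-y|^2\,\Pi(dx,dy)$, the infimum being over probability measures $\Pi$ on $\mathbf R\times\mathbf R$ with marginals $\mu$ and $\nu$. *)

theory Defs
  imports "HOL-Probability.Probability"
begin

section \<open>Complex inner product spaces\<close>

text \<open>
  The inner product \<open>cinner\<close> is conjugate-linear in its first argument (Dirac's convention).
  The real structure of \<open>real_inner\<close> supplies norm, topology and \<open>bounded_linear\<close>.
\<close>

class complex_inner = real_inner +
  fixes scaleC :: "complex \<Rightarrow> 'a \<Rightarrow> 'a"  (infixr "*\<^sub>C" 75)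
    and cinner :: "'a \<Rightarrow> 'a \<Rightarrow> complex"
  assumes scaleC_add_right: "c *\<^sub>C (x + y) = c *\<^sub>C x + c *\<^sub>C y"
    and scaleC_add_left: "(c + d) *\<^sub>C x = c *\<^sub>C x + d *\<^sub>C x"
    and scaleC_scaleC: "c *\<^sub>C d *\<^sub>C x = (c * d) *\<^sub>C x"
    and scaleR_scaleC: "r *\<^sub>R x = complex_of_real r *\<^sub>C x"
    and cinner_commute: "cinner x y = cnj (cinner y x)"
    and cinner_add_right: "cinner x (y + z) = cinner x y + cinner x z"
    and cinner_scaleC_right: "cinner x (c *\<^sub>C y) = c * cinner x y"
    and inner_cinner: "inner x y = Re (cinner x y)"


section \<open>The Hilbert spaces \<open>L\<^sup>2\<close>\<close>

definition square_integrable :: "('a::euclidean_space \<Rightarrow> complex) \<Rightarrow> bool" where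
  "square_integrable f \<longleftrightarrow>
     f \<in> borel_measurable lborel \<and> integrable lborel (\<lambda>x. (cmod (f x))\<^sup>2)"

definition L2_rel :: "('a::euclidean_space \<Rightarrow> complex) \<Rightarrow> ('a \<Rightarrow> complex) \<Rightarrow> bool" where
  "L2_rel f g \<longleftrightarrow> square_integrable f \<and> square_integrable g \<and> (AE x in lborel. f x = g x)"

lemma square_integrable_measurable [measurable_dest]:
  "square_integrable f \<Longrightarrow> f \<in> borel_measurable borel"
  by (simp add: square_integrable_def)

lemma borel_measurable_cnj [measurable]:
  "f \<in> borel_measurable M \<Longrightarrow> (\<lambda>x. cnj (f x)) \<in> borel_measurable M"
  by (rule measurable_compose[OF _ borel_measurable_continuous_onI])
    (auto intro: continuous_intros)

lemma square_integrable_zero [simp]: "square_integrable (\<lambda>_. 0)"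
  by (simp add: square_integrable_def)

lemma square_integrable_add:
  assumes f: "square_integrable f" and g: "square_integrable g"
  shows "square_integrable (\<lambda>x. f x + g x)"
proof -
  note [measurable] = square_integrable_measurable[OF f] square_integrable_measurable[OF g]
  have "integrable lborel (\<lambda>x. 2 * (cmod (f x))\<^sup>2 + 2 * (cmod (g x))\<^sup>2)"
    using f g by (auto simp: square_integrable_def)
  moreover have "(cmod (f x + g x))\<^sup>2 \<le> 2 * (cmod (f x))\<^sup>2 + 2 * (cmod (g x))\<^sup>2" for x
  proof -
    have "(cmod (f x + g x))\<^sup>2 \<le> (cmod (f x) + cmod (g x))\<^sup>2"
      by (intro power_mono norm_triangle_ineq norm_ge_zero)
    also have "\<dots> \<le> 2 * (cmod (f x))\<^sup>2 + 2 * (cmod (g x))\<^sup>2"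
      using sum_squares_bound[of "cmod (f x)" "cmod (g x)"] by (simp add: power2_sum)
    finally show ?thesis .
  qed
  ultimately have "integrable lborel (\<lambda>x. (cmod (f x + g x))\<^sup>2)"
    by (intro Bochner_Integration.integrable_bound[where g = "\<lambda>x. (cmod (f x + g x))\<^sup>2"]) auto
  then show ?thesis by (auto simp: square_integrable_def)
qed

lemma square_integrable_scale:
  assumes f: "square_integrable f"
  shows "square_integrable (\<lambda>x. c * f x)"
  using f by (auto simp: square_integrable_def norm_mult power_mult_distrib)

lemma square_integrable_minus:
  assumes f: "square_integrable f"
  shows "square_integrable (\<lambda>x. - f x)"
  using square_integrable_scale[OF f, of "-1"] by simp

lemma integrable_cnj_mult:
  assumes f: "square_integrable f" and g: "square_integrable g"
  shows "integrable lborel (\<lambda>x. cnj (f x) * g x)"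
proof -
  note [measurable] = square_integrable_measurable[OF f] square_integrable_measurable[OF g]
  have "integrable lborel (\<lambda>x. (cmod (f x))\<^sup>2 + (cmod (g x))\<^sup>2)"
    using f g by (auto simp: square_integrable_def)
  moreover have "cmod (cnj (f x) * g x) \<le> (cmod (f x))\<^sup>2 + (cmod (g x))\<^sup>2" for x
  proof -
    have "0 \<le> cmod (f x) * cmod (g x)" by simp
    then have "cmod (f x) * cmod (g x) \<le> (cmod (f x))\<^sup>2 + (cmod (g x))\<^sup>2"
      using sum_squares_bound[of "cmod (f x)" "cmod (g x)"] by linarith
    then show ?thesis by (simp add: norm_mult)
  qed
  ultimately show ?thesis
    by (intro Bochner_Integration.integrable_bound[where g = "\<lambda>x. cnj (f x) * g x"])
      (auto simp: power2_eq_square)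
qed

quotient_type (overloaded) 'a L2 = "'a::euclidean_space \<Rightarrow> complex" / partial: L2_rel
  morphisms rep_L2 abs_L2
proof (rule part_equivpI)
  show "\<exists>x. L2_rel x (x :: 'a \<Rightarrow> complex)"
    by (rule exI[of _ "\<lambda>_. 0"]) (simp add: L2_rel_def)
  show "symp (L2_rel :: ('a \<Rightarrow> complex) \<Rightarrow> _)"
    by (auto simp: symp_def L2_rel_def elim: AE_mp)
  show "transp (L2_rel :: ('a \<Rightarrow> complex) \<Rightarrow> _)"
    by (auto simp: transp_def L2_rel_def)
qed

instantiation L2 :: (euclidean_space) complex_inner
begin

lift_definition zero_L2 :: "'a L2" is "\<lambda>_. 0"
  by (simp add: L2_rel_def)

lift_definition plus_L2 :: "'a L2 \<Rightarrow> 'a L2 \<Rightarrow> 'a L2" is "\<lambda>f g x. f x + g x"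
  by (auto simp: L2_rel_def square_integrable_add)

lift_definition uminus_L2 :: "'a L2 \<Rightarrow> 'a L2" is "\<lambda>f x. - f x"
  by (auto simp: L2_rel_def square_integrable_minus)

lift_definition scaleC_L2 :: "complex \<Rightarrow> 'a L2 \<Rightarrow> 'a L2" is "\<lambda>c f x. c * f x"
  by (auto simp: L2_rel_def square_integrable_scale)

lift_definition cinner_L2 :: "'a L2 \<Rightarrow> 'a L2 \<Rightarrow> complex"
  is "\<lambda>f g. LINT x|lborel. cnj (f x) * g x"
proof -
  fix f1 f2 g1 g2 :: "'a \<Rightarrow> complex"
  assume rel: "L2_rel f1 f2" "L2_rel g1 g2"
  then have [measurable]: "f1 \<in> borel_measurable borel" "f2 \<in> borel_measurable borel"
    "g1 \<in> borel_measurable borel" "g2 \<in> borel_measurable borel"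
    by (auto simp: L2_rel_def square_integrable_def)
  from rel have ae: "AE x in lborel. f1 x = f2 x" "AE x in lborel. g1 x = g2 x"
    by (auto simp: L2_rel_def)
  show "(LINT x|lborel. cnj (f1 x) * g1 x) = (LINT x|lborel. cnj (f2 x) * g2 x)"
  proof (rule integral_cong_AE)
    show "AE x in lborel. cnj (f1 x) * g1 x = cnj (f2 x) * g2 x"
      using ae by eventually_elim simp
  qed simp_all
qed

definition minus_L2 :: "'a L2 \<Rightarrow> 'a L2 \<Rightarrow> 'a L2" where
  "minus_L2 f g = f + - g"

definition scaleR_L2 :: "real \<Rightarrow> 'a L2 \<Rightarrow> 'a L2" where
  "scaleR_L2 r f = complex_of_real r *\<^sub>C f"

definition inner_L2 :: "'a L2 \<Rightarrow> 'a L2 \<Rightarrow> real" where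
  "inner_L2 f g = Re (cinner f g)"

definition norm_L2 :: "'a L2 \<Rightarrow> real" where
  "norm_L2 f = sqrt (inner f f)"

definition sgn_L2 :: "'a L2 \<Rightarrow> 'a L2" where
  "sgn_L2 f = inverse (norm f) *\<^sub>R f"

definition dist_L2 :: "'a L2 \<Rightarrow> 'a L2 \<Rightarrow> real" where
  "dist_L2 f g = norm (f - g)"

definition uniformity_L2 :: "('a L2 \<times> 'a L2) filter" where
  "uniformity_L2 = (INF e\<in>{0 <..}. principal {(f, g). dist f g < e})"

definition open_L2 :: "'a L2 set \<Rightarrow> bool" where
  "open_L2 U \<longleftrightarrow> (\<forall>f\<in>U. eventually (\<lambda>(f', g). f' = f \<longrightarrow> g \<in> U) uniformity)"

instance
proof
  fix f g h :: "'a L2" and c d :: complex and r s :: real and U :: "'a L2 set"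
  show "f + g + h = f + (g + h)"
    by transfer (auto simp: L2_rel_def add.assoc intro!: square_integrable_add)
  show "f + g = g + f"
    by transfer (auto simp: L2_rel_def add.commute intro!: square_integrable_add)
  show "0 + f = f"
    by transfer (auto simp: L2_rel_def)
  show "- f + f = 0"
    by transfer (auto simp: L2_rel_def)
  show "f - g = f + - g" by (rule minus_L2_def)
  show addr: "c *\<^sub>C (f + g) = c *\<^sub>C f + c *\<^sub>C g" for c and f g :: "'a L2"
    by transfer (auto simp: L2_rel_def ring_distribs
        intro!: square_integrable_add square_integrable_scale
          square_integrable_scale[OF square_integrable_add, unfolded ring_distribs])
  show addl: "(c + d) *\<^sub>C f = c *\<^sub>C f + d *\<^sub>C f" for c d and f :: "'a L2"
    by transfer (auto simp: L2_rel_def ring_distribs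
        intro!: square_integrable_add square_integrable_scale)
  show sc: "c *\<^sub>C d *\<^sub>C f = (c * d) *\<^sub>C f" for c d and f :: "'a L2"
  proof transfer
    fix c d and f :: "'a \<Rightarrow> complex" assume "L2_rel f f"
    then have "square_integrable f" by (simp add: L2_rel_def)
    then have "square_integrable (\<lambda>x. c * (d * f x))" "square_integrable (\<lambda>x. c * d * f x)"
      by (intro square_integrable_scale; assumption)+
    then show "L2_rel (\<lambda>x. c * (d * f x)) (\<lambda>x. c * d * f x)"
      by (simp add: L2_rel_def mult.assoc)
  qed
  have one: "1 *\<^sub>C f = f"
    by transfer (auto simp: L2_rel_def)
  show "r *\<^sub>R f = complex_of_real r *\<^sub>C f" by (rule scaleR_L2_def)
  show "r *\<^sub>R (f + g) = r *\<^sub>R f + r *\<^sub>R g" by (simp add: scaleR_L2_def addr)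
  show "(r + s) *\<^sub>R f = r *\<^sub>R f + s *\<^sub>R f" by (simp add: scaleR_L2_def addl)
  show "r *\<^sub>R s *\<^sub>R f = (r * s) *\<^sub>R f" by (simp add: scaleR_L2_def sc)
  show "1 *\<^sub>R f = f" by (simp add: scaleR_L2_def one)
  show "sgn f = inverse (norm f) *\<^sub>R f" by (rule sgn_L2_def)
  show "dist f g = norm (f - g)" by (rule dist_L2_def)
  show "(uniformity :: ('a L2 \<times> 'a L2) filter) =
      (INF e\<in>{0 <..}. principal {(f, g). dist f g < e})"
    by (rule uniformity_L2_def)
  show "open U \<longleftrightarrow> (\<forall>f\<in>U. eventually (\<lambda>(f', g). f' = f \<longrightarrow> g \<in> U) uniformity)"
    by (rule open_L2_def)
  show com: "cinner f g = cnj (cinner g f)" for f g :: "'a L2"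
  proof transfer
    fix f g :: "'a \<Rightarrow> complex"
    have "(LINT x|lborel. cnj (f x) * g x) = (LINT x|lborel. cnj (cnj (g x) * f x))"
      by (rule Bochner_Integration.integral_cong) simp_all
    then show "(LINT x|lborel. cnj (f x) * g x) = cnj (LINT x|lborel. cnj (g x) * f x)"
      by (simp only: Bochner_Integration.integral_cnj)
  qed
  show caddr: "cinner f (g + h) = cinner f g + cinner f h" for f g h :: "'a L2"
    by transfer (simp add: L2_rel_def integrable_cnj_mult ring_distribs)
  show cscr: "cinner f (c *\<^sub>C g) = c * cinner f g" for c and f g :: "'a L2"
  proof transfer
    fix c and f g :: "'a \<Rightarrow> complex" assume "L2_rel f f" "L2_rel g g"
    have "(LINT x|lborel. cnj (f x) * (c * g x)) = (LINT x|lborel. c * (cnj (f x) * g x))"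
      by (simp add: mult.left_commute)
    then show "(LINT x|lborel. cnj (f x) * (c * g x)) = c * (LINT x|lborel. cnj (f x) * g x)"
      by simp
  qed
  show "inner f g = Re (cinner f g)" by (rule inner_L2_def)
  show "inner f g = inner g f" unfolding inner_L2_def by (subst com) simp
  show "inner (f + g) h = inner f h + inner g h"
    unfolding inner_L2_def by (subst (1 2 3) com) (simp add: caddr)
  show "inner (r *\<^sub>R f) g = r * inner f g"
    unfolding inner_L2_def scaleR_L2_def by (subst (1 2) com) (simp add: cscr)
  have sq: "cnj z * z = complex_of_real ((cmod z)\<^sup>2)" for z
    by (metis complex_norm_square mult.commute)
  have self: "0 \<le> Re (cinner f f) \<and> (Re (cinner f f) = 0 \<longleftrightarrow> f = 0)"
  proof transfer
    fix f :: "'a \<Rightarrow> complex" assume "L2_rel f f"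
    then have f: "square_integrable f" by (simp add: L2_rel_def)
    then have int: "integrable lborel (\<lambda>x. (cmod (f x))\<^sup>2)" by (simp add: square_integrable_def)
    have "(LINT x|lborel. cnj (f x) * f x) = complex_of_real (LINT x|lborel. (cmod (f x))\<^sup>2)"
      unfolding sq by (rule integral_complex_of_real)
    moreover have "(LINT x|lborel. (cmod (f x))\<^sup>2) = 0 \<longleftrightarrow> (AE x in lborel. f x = 0)"
      using integral_nonneg_eq_0_iff_AE[OF int] by simp
    ultimately show "0 \<le> Re (LINT x|lborel. cnj (f x) * f x) \<and>
        (Re (LINT x|lborel. cnj (f x) * f x) = 0 \<longleftrightarrow> L2_rel f (\<lambda>_. 0))"
      using f by (simp add: L2_rel_def)
  qed
  show "0 \<le> inner f f" "inner f f = 0 \<longleftrightarrow> f = 0"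
    using self by (auto simp: inner_L2_def)
  show "norm f = sqrt (inner f f)" by (rule norm_L2_def)
qed

end

lemma square_integrable_tensor:
  fixes f g :: "real \<Rightarrow> complex"
  assumes f: "square_integrable f" and g: "square_integrable g"
  shows "square_integrable (\<lambda>(x, y). f x * g y)"
proof -
  note [measurable] = square_integrable_measurable[OF f] square_integrable_measurable[OF g]
  have "integrable (lborel \<Otimes>\<^sub>M lborel) (\<lambda>z. (cmod (f (fst z)))\<^sup>2 * (cmod (g (snd z)))\<^sup>2)"
    using f g by (intro lborel_pair.Fubini_integrable) (auto simp: square_integrable_def)
  moreover have "(\<lambda>z. f (fst z) * g (snd z)) \<in> borel_measurable (lborel \<Otimes>\<^sub>M lborel)"
    by measurable
  ultimately show ?thesis
    by (simp add: square_integrable_def lborel_prod case_prod_beta norm_mult power_mult_distrib)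
qed

lift_definition tensor :: "real L2 \<Rightarrow> real L2 \<Rightarrow> (real \<times> real) L2"  (infixr "\<otimes>\<^sub>v" 70)
  is "\<lambda>f g (x, y). f x * g y"
proof -
  fix f1 f2 g1 g2 :: "real \<Rightarrow> complex"
  assume rel: "L2_rel f1 f2" "L2_rel g1 g2"
  then have [measurable]: "f1 \<in> borel_measurable borel" "f2 \<in> borel_measurable borel"
    "g1 \<in> borel_measurable borel" "g2 \<in> borel_measurable borel"
    by (auto simp: L2_rel_def square_integrable_def)
  from rel have ae: "AE x in lborel. f1 x = f2 x" "AE y in lborel. g1 y = g2 y"
    by (auto simp: L2_rel_def)
  have "AE x in lborel. AE y in lborel. f1 x * g1 y = f2 x * g2 y"
    using ae(1)
  proof eventually_elim
    case (elim x)
    show ?case using ae(2) by eventually_elim (simp add: elim)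
  qed
  moreover have "Measurable.pred (lborel \<Otimes>\<^sub>M lborel)
      (\<lambda>z. f1 (fst z) * g1 (snd z) = f2 (fst z) * g2 (snd z))"
    by measurable
  ultimately have "AE z in lborel \<Otimes>\<^sub>M lborel. f1 (fst z) * g1 (snd z) = f2 (fst z) * g2 (snd z)"
    by (intro lborel_pair.AE_pair_measure) (simp_all add: pred_def)
  then have "AE z in lborel. f1 (fst z) * g1 (snd z) = f2 (fst z) * g2 (snd z)"
    by (simp only: lborel_prod)
  then show "L2_rel (\<lambda>(x, y). f1 x * g1 y) (\<lambda>(x, y). f2 x * g2 y)"
    using rel by (auto simp: L2_rel_def square_integrable_tensor lborel_prod case_prod_beta)
qed


section \<open>Bounded operators and traces\<close>

definition bounded_op :: "('a::complex_inner \<Rightarrow> 'b::complex_inner) \<Rightarrow> bool" where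
  "bounded_op T \<longleftrightarrow> bounded_linear T \<and> (\<forall>c x. T (c *\<^sub>C x) = c *\<^sub>C T x)"

definition positive_op :: "('a::complex_inner \<Rightarrow> 'a) \<Rightarrow> bool" where
  "positive_op T \<longleftrightarrow> bounded_op T \<and>
     (\<forall>x y. cinner (T x) y = cinner x (T y)) \<and> (\<forall>x. 0 \<le> Re (cinner x (T x)))"

text \<open>The real span of all complex multiples of elements of \<open>B\<close> is the complex span of \<open>B\<close>.\<close>

definition is_onb :: "'a::complex_inner set \<Rightarrow> bool" where
  "is_onb B \<longleftrightarrow> (\<forall>x\<in>B. \<forall>y\<in>B. cinner x y = (if x = y then 1 else 0)) \<and>
     closure (span {c *\<^sub>C x | c x. x \<in> B}) = UNIV"

text \<open>
  For trace-class operators, and in \<open>[0, \<infinity>]\<close> for positive operators, the trace does not depend on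
  the orthonormal basis; an arbitrary one is fixed. If the family of diagonal entries is not
  summable, \<open>op_trace\<close> is \<open>0\<close>, so a positive operator with \<open>op_trace\<close> equal to \<open>1\<close> is trace-class.
\<close>

definition some_onb :: "'a::complex_inner set" where
  "some_onb = (SOME B. is_onb B)"

definition op_trace :: "('a::complex_inner \<Rightarrow> 'a) \<Rightarrow> complex" where
  "op_trace T = (\<Sum>\<^sub>\<infinity>e\<in>some_onb. cinner e (T e))"

definition positive_trace :: "('a::complex_inner \<Rightarrow> 'a) \<Rightarrow> ennreal" where
  "positive_trace T = (\<Sum>\<^sub>\<infinity>e\<in>some_onb. ennreal (Re (cinner e (T e))))"

definition density_matrix :: "('a::complex_inner \<Rightarrow> 'a) \<Rightarrow> bool" where
  "density_matrix T \<longleftrightarrow> positive_op T \<and> op_trace T = 1"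

text \<open>\<open>dyad \<psi>\<close> is \<open>|\<psi>\<rangle>\<langle>\<psi>|\<close>.\<close>

definition dyad :: "'a::complex_inner \<Rightarrow> 'a \<Rightarrow> 'a" where
  "dyad \<psi> = (\<lambda>\<phi>. cinner \<psi> \<phi> *\<^sub>C \<psi>)"

definition op_tensor ::
    "(real L2 \<Rightarrow> real L2) \<Rightarrow> (real L2 \<Rightarrow> real L2) \<Rightarrow> (real \<times> real) L2 \<Rightarrow> (real \<times> real) L2"
    (infixr "\<otimes>\<^sub>o" 70) where
  "A \<otimes>\<^sub>o B = (THE T. bounded_op T \<and> (\<forall>f g. T (f \<otimes>\<^sub>v g) = A f \<otimes>\<^sub>v B g))"

definition is_coupling ::
    "(real L2 \<Rightarrow> real L2) \<Rightarrow> (real L2 \<Rightarrow> real L2) \<Rightarrow> ((real \<times> real) L2 \<Rightarrow> (real \<times> real) L2) \<Rightarrow> bool"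
  where
  "is_coupling R S Q \<longleftrightarrow> density_matrix Q \<and>
     (\<forall>A. bounded_op A \<longrightarrow> op_trace ((A \<otimes>\<^sub>o id) \<circ> Q) = op_trace (A \<circ> R)) \<and>
     (\<forall>B. bounded_op B \<longrightarrow> op_trace ((id \<otimes>\<^sub>o B) \<circ> Q) = op_trace (B \<circ> S))"


section \<open>Unbounded operators\<close>

text \<open>
  An unbounded operator \<open>G\<close> is given by its graph: \<open>(\<phi>, \<omega>) \<in> G\<close> means that \<open>\<phi>\<close> is in the domain
  and \<open>\<omega> = G \<phi>\<close>. The graph of \<open>D\<^sup>2\<close>, with its natural domain, is then \<open>D O D\<close>.
\<close>

definition adjoint_graph :: "('a::complex_inner \<times> 'a) set \<Rightarrow> ('a \<times> 'a) set" where
  "adjoint_graph G = {(\<psi>, \<xi>). \<forall>(\<phi>, \<omega>)\<in>G. cinner \<omega> \<psi> = cinner \<phi> \<xi>}"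

definition self_adjoint :: "('a::complex_inner \<times> 'a) set \<Rightarrow> bool" where
  "self_adjoint G \<longleftrightarrow> closure (Domain G) = UNIV \<and> adjoint_graph G = G"

definition nonneg_graph :: "('a::complex_inner \<times> 'a) set \<Rightarrow> bool" where
  "nonneg_graph G \<longleftrightarrow> (\<forall>(\<phi>, \<omega>)\<in>G. 0 \<le> Re (cinner \<phi> \<omega>))"

definition sqrt_graph :: "('a::complex_inner \<times> 'a) set \<Rightarrow> ('a \<times> 'a) set" where
  "sqrt_graph G = (THE D. self_adjoint D \<and> nonneg_graph D \<and> D O D = G)"

text \<open>
  \<open>trace (D Q D)\<close> in \<open>[0, \<infinity>]\<close>, for \<open>D\<close> nonnegative self-adjoint and \<open>Q\<close> positive: if \<open>D Q D\<close> is
  defined on all of the domain of \<open>D\<close> and bounded there, it is the trace of the continuous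
  extension of \<open>D Q D\<close> to the whole space; otherwise it is \<open>\<infinity>\<close>.
\<close>

definition extends_sandwich ::
    "('a::complex_inner \<times> 'a) set \<Rightarrow> ('a \<Rightarrow> 'a) \<Rightarrow> ('a \<Rightarrow> 'a) \<Rightarrow> bool" where
  "extends_sandwich D Q T \<longleftrightarrow> bounded_op T \<and> (\<forall>(\<phi>, \<omega>)\<in>D. (Q \<omega>, T \<phi>) \<in> D)"

definition sandwich_trace :: "('a::complex_inner \<times> 'a) set \<Rightarrow> ('a \<Rightarrow> 'a) \<Rightarrow> ennreal" where
  "sandwich_trace D Q =
     (if \<exists>T. extends_sandwich D Q T then positive_trace (THE T. extends_sandwich D Q T) else \<infinity>)"


section \<open>The quantum transport cost\<close>

text \<open>
  Schwartz functions on the plane: smooth, with all partial derivatives rapidly decreasing. The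
  coinductive reading provides partial derivatives of every order.
\<close>

coinductive schwartz :: "(real \<times> real \<Rightarrow> complex) \<Rightarrow> bool" where
  "schwartz f"
  if "\<And>n::nat. bounded (range (\<lambda>z. (1 + norm z) ^ n *\<^sub>R f z))"
    and "\<And>z. (f has_derivative (\<lambda>(h, k). h *\<^sub>R f\<^sub>x z + k *\<^sub>R f\<^sub>y z)) (at z)"
    and "schwartz f\<^sub>x" and "schwartz f\<^sub>y"

definition diff_op :: "(real \<times> real \<Rightarrow> complex) \<Rightarrow> real \<times> real \<Rightarrow> complex" where
  "diff_op f = (\<lambda>(x, y). vector_derivative (\<lambda>s. f (s, y)) (at x)
                        - vector_derivative (\<lambda>s. f (x, s)) (at y))"

definition cost_expr :: "real \<Rightarrow> (real \<times> real \<Rightarrow> complex) \<Rightarrow> real \<times> real \<Rightarrow> complex" where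
  "cost_expr hbar f = (\<lambda>(x, y). complex_of_real ((x - y)\<^sup>2) * f (x, y)
      - complex_of_real (hbar\<^sup>2) * diff_op (diff_op f) (x, y) - complex_of_real (2 * hbar) * f (x, y))"

text \<open>
  The self-adjoint realization of the formally symmetric expression \<open>cost_expr\<close> is the maximal one:
  its domain consists of all \<open>\<psi>\<close> in \<open>L\<^sup>2\<close> for which the expression, applied in the sense of tempered
  distributions, is again in \<open>L\<^sup>2\<close>. This is the adjoint of the expression on Schwartz functions,
  and it equals the closure of the latter (which is essentially self-adjoint: in the variable
  \<open>x - y\<close> the expression is a harmonic oscillator).
\<close>

definition cost_graph :: "real \<Rightarrow> ((real \<times> real) L2 \<times> (real \<times> real) L2) set" where
  "cost_graph hbar = adjoint_graph {(abs_L2 f, abs_L2 (cost_expr hbar f)) | f. schwartz f}"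

definition MK2 :: "real \<Rightarrow> (real L2 \<Rightarrow> real L2) \<Rightarrow> (real L2 \<Rightarrow> real L2) \<Rightarrow> ennreal" where
  "MK2 hbar R S =
     (THE m. m\<^sup>2 = (INF Q\<in>{Q. is_coupling R S Q}. sandwich_trace (sqrt_graph (cost_graph hbar)) Q))"

definition coherent :: "real \<Rightarrow> real \<Rightarrow> real L2" where
  "coherent hbar c =
     abs_L2 (\<lambda>x. complex_of_real ((pi * hbar) powr (- 1 / 4) * exp (- (x - c)\<^sup>2 / (2 * hbar))))"


section \<open>The Wasserstein distance\<close>

definition W2 :: "real measure \<Rightarrow> real measure \<Rightarrow> ennreal" where
  "W2 \<mu> \<nu> = (THE w. w\<^sup>2 =
     (INF P\<in>{P :: (real \<times> real) measure. prob_space P \<and> sets P = sets borel \<and>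
               distr P borel fst = \<mu> \<and> distr P borel snd = \<nu>}.
        \<integral>\<^sup>+ (x, y). ennreal (\<bar>x - y\<bar>\<^sup>2) \<partial>P))"

definition dirac :: "real \<Rightarrow> real measure" where
  "dirac c = return borel c"

definition mixture :: "real \<Rightarrow> real measure \<Rightarrow> real \<Rightarrow> real measure \<Rightarrow> real measure" where
  "mixture p \<mu> q \<nu> = measure_of UNIV (sets borel)
     (\<lambda>A. ennreal p * emeasure \<mu> A + ennreal q * emeasure \<nu> A)"

lemma emeasure_mixture:
  assumes "sets \<mu> = sets borel" "sets \<nu> = sets borel" "A \<in> sets borel"
  shows "emeasure (mixture p \<mu> q \<nu>) A = ennreal p * emeasure \<mu> A + ennreal q * emeasure \<nu> A"
proof (rule emeasure_measure_of[OF mixture_def])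
  show "countably_additive (sets (mixture p \<mu> q \<nu>))
      (\<lambda>A. ennreal p * emeasure \<mu> A + ennreal q * emeasure \<nu> A)"
  proof (rule countably_additiveI)
    fix F :: "nat \<Rightarrow> real set"
    assume F: "range F \<subseteq> sets (mixture p \<mu> q \<nu>)" "disjoint_family F"
    have s: "sets (mixture p \<mu> q \<nu>) = sets borel"
      by (simp add: mixture_def) (metis sets.sigma_sets_eq space_borel)
    have "(\<Sum>i. emeasure \<mu> (F i)) = emeasure \<mu> (\<Union> (range F))"
      "(\<Sum>i. emeasure \<nu> (F i)) = emeasure \<nu> (\<Union> (range F))"
      using F assms s by (auto intro!: suminf_emeasure)
    then show "(\<Sum>i. ennreal p * emeasure \<mu> (F i) + ennreal q * emeasure \<nu> (F i)) =
        ennreal p * emeasure \<mu> (\<Union> (range F)) + ennreal q * emeasure \<nu> (\<Union> (range F))"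
      by (simp add: suminf_add[symmetric])
  qed
qed (use assms in \<open>auto simp: positive_def mixture_def intro: sigma_sets.Basic\<close>)

end

(*
  The classical optimal coupling moves mass eta/2 from a to -a and costs 2 eta a^2. In the quantum setting
  the products |++>, |-->, |+-> of the non-orthogonal states |a>, |-a> are coupled by off-diagonal terms:
  a perturbation of the classical coupling in these terms can be chosen with vanishing partial traces,
  while lowering the weight of |+->, the only one of the three states with nonzero cost.

  To evaluate the cost, C is diagonalized: in the variables x - y and (x + y)/2 it is 4 hbar times the number
  operator of an oscillator, with Hermite functions as eigenvectors. A nonnegative self-adjoint square root
  of a diagonal operator is determined by its action on the eigenvectors, so C^(1/2) is explicit and
  trace (C^(1/2) Q C^(1/2)) is the sum of the weighted expectations of C for a finite-rank Q.
*)

theory Submission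
  imports Defs
begin

section \<open>Complex Hilbert spaces\<close>

subsection \<open>The complex inner product\<close>

text \<open>A single coupling that beats the classical one settles the strict inequality. Its
  perturbation is forced. Write p, m for the two states and s for their overlap. A real symmetric
  operator on the span of |pp>, |mm>, |pm> with both partial traces zero must vanish at the diagonal
  entries pp and mm; an entry -t between pp and mm then forces s t between pm and each of pp, mm,
  and -2 s^2 t at pm. The choice t > 0 lowers the weight of |pm>. Since C kills |pp> and |mm>, the
  off-diagonal entries cost nothing, and the shift by 2 hbar makes the expectation of C in |pm>
  exactly (2a)^2, so the cost is the classical one with a smaller weight.

  The length comes from the definitions: \<open>op_tensor\<close>, \<open>sqrt_graph\<close> and the
  operator inside \<open>sandwich_trace\<close> are definite descriptions and
  \<open>some_onb\<close> is a choice, so existence, and for the descriptions uniqueness, must be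
  established before a trace can be evaluated. Completeness of \<open>L2\<close> and explicit
  Hermite bases supply this.\<close>

lemma cinner_add_left: "cinner (x + y) z = cinner x z + cinner (y :: 'a::complex_inner) z"
  by (subst (1 2 3) cinner_commute) (simp add: cinner_add_right)

lemma cinner_scaleC_left: "cinner (c *\<^sub>C x) y = cnj c * cinner (x :: 'a::complex_inner) y"
  by (subst (1 2) cinner_commute) (simp add: cinner_scaleC_right)

lemma cinner_scaleR_right: "cinner x (r *\<^sub>R y) = of_real r * cinner (x :: 'a::complex_inner) y"
  by (simp add: scaleR_scaleC cinner_scaleC_right)

lemma cinner_scaleR_left: "cinner (r *\<^sub>R x) y = of_real r * cinner (x :: 'a::complex_inner) y"
  by (simp add: scaleR_scaleC cinner_scaleC_left)

lemma cinner_zero_right [simp]: "cinner x (0 :: 'a::complex_inner) = 0"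
  using cinner_scaleR_right[of x 0 x] by simp

lemma cinner_zero_left [simp]: "cinner (0 :: 'a::complex_inner) x = 0"
  using cinner_scaleR_left[of 0 x x] by simp

lemma cinner_minus_right: "cinner x (- y) = - cinner x (y :: 'a::complex_inner)"
  using cinner_scaleR_right[of x "-1" y] by simp

lemma cinner_diff_right: "cinner x (y - z) = cinner x y - cinner x (z :: 'a::complex_inner)"
  using cinner_add_right[of x y "- z"] by (simp add: cinner_minus_right)

lemma cinner_diff_left: "cinner (x - y) z = cinner x z - cinner (y :: 'a::complex_inner) z"
  by (subst (1 2 3) cinner_commute) (simp add: cinner_diff_right)

lemma cinner_sum_right: "cinner x (\<Sum>i\<in>F. f i) = (\<Sum>i\<in>F. cinner x (f i :: 'a::complex_inner))"
  by (induction F rule: infinite_finite_induct) (auto simp: cinner_add_right)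

lemma cinner_sum_left: "cinner (\<Sum>i\<in>F. f i) x = (\<Sum>i\<in>F. cinner (f i :: 'a::complex_inner) x)"
  by (induction F rule: infinite_finite_induct) (auto simp: cinner_add_left)

lemma cinner_self: "cinner x x = of_real ((norm (x :: 'a::complex_inner))\<^sup>2)"
proof (rule complex_eqI)
  show "Re (cinner x x) = Re (of_real ((norm x)\<^sup>2))"
    by (simp add: inner_cinner[symmetric] power2_norm_eq_inner)
  have "Im (cinner x x) = - Im (cinner x x)"
    by (subst cinner_commute) simp
  then show "Im (cinner x x) = Im (of_real ((norm x)\<^sup>2))" by simp
qed

lemma scaleC_one [simp]: "1 *\<^sub>C x = (x :: 'a::complex_inner)"
  using scaleR_scaleC[of 1 x] by simp

lemma scaleC_zero_left [simp]: "0 *\<^sub>C x = (0 :: 'a::complex_inner)"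
  using scaleR_scaleC[of 0 x] by simp

lemma scaleC_zero_right [simp]: "c *\<^sub>C (0 :: 'a::complex_inner) = 0"
  using scaleC_scaleC[of c 0 "0::'a"] by simp

lemma scaleC_sum_right: "c *\<^sub>C (\<Sum>i\<in>F. f i) = (\<Sum>i\<in>F. c *\<^sub>C (f i :: 'a::complex_inner))"
  by (induction F rule: infinite_finite_induct) (auto simp: scaleC_add_right)

lemma norm_scaleC: "norm (c *\<^sub>C x) = cmod c * norm (x :: 'a::complex_inner)"
proof -
  have "of_real ((norm (c *\<^sub>C x))\<^sup>2) = cnj c * c * cinner x x"
    unfolding cinner_self[symmetric] by (simp add: cinner_scaleC_right cinner_scaleC_left)
  also have "cnj c * c = of_real ((cmod c)\<^sup>2)"
    by (simp add: complex_norm_square mult.commute del: of_real_power)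
  also have "\<dots> * cinner x x = of_real ((cmod c * norm x)\<^sup>2)"
    by (simp add: cinner_self power_mult_distrib)
  finally have "(norm (c *\<^sub>C x))\<^sup>2 = (cmod c * norm x)\<^sup>2" by (simp only: of_real_eq_iff)
  then show ?thesis by (simp add: power2_eq_iff_nonneg)
qed

text \<open>The real Cauchy-Schwarz inequality controls only the real part; multiplying
  \<open>y\<close> by the unimodular phase \<open>c\<close> turns the inner product into its own
  modulus.\<close>

lemma cmod_cinner_le: "cmod (cinner x y) \<le> norm x * norm (y :: 'a::complex_inner)"
proof (cases "cinner x y = 0")
  case False
  define c where "c = cnj (cinner x y) / of_real (cmod (cinner x y))"
  have "c * cinner x y = of_real (cmod (cinner x y))"
    using False complex_norm_square[of "cinner x y"]
    by (simp add: c_def field_simps power2_eq_square)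
  then have "cmod (cinner x y) = inner x (c *\<^sub>C y)"
    by (simp add: inner_cinner cinner_scaleC_right)
  also have "\<dots> \<le> norm x * norm (c *\<^sub>C y)" by (rule norm_cauchy_schwarz)
  also have "norm (c *\<^sub>C y) = norm y"
    using False by (simp add: norm_scaleC c_def norm_divide)
  finally show ?thesis .
qed simp

lemma bounded_linear_cinner_right: "bounded_linear (cinner (x :: 'a::complex_inner))"
  by (rule bounded_linear_intro[of _ "norm x"])
    (use cmod_cinner_le[of x] in \<open>auto simp: cinner_add_right cinner_scaleR_right scaleR_conv_of_real mult.commute\<close>)

lemma bounded_linear_scaleC: "bounded_linear (\<lambda>x :: 'a::complex_inner. c *\<^sub>C x)"
  by (rule bounded_linear_intro[of _ "cmod c"])
    (auto simp: scaleC_add_right scaleR_scaleC scaleC_scaleC norm_scaleC mult.commute)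

lemma bounded_op_scaleC: "bounded_op T \<Longrightarrow> T (c *\<^sub>C x) = c *\<^sub>C T x"
  by (simp add: bounded_op_def)

lemma bounded_op_add: "bounded_op T \<Longrightarrow> T (x + y) = T x + T y"
  by (simp add: bounded_op_def linear_simps)

lemma bounded_op_scaleR: "bounded_op T \<Longrightarrow> T (r *\<^sub>R x) = r *\<^sub>R T x"
  by (simp add: scaleR_scaleC bounded_op_scaleC)

lemma bounded_op_sum: "bounded_op T \<Longrightarrow> T (\<Sum>i\<in>F. f i) = (\<Sum>i\<in>F. T (f i))"
  by (simp add: bounded_op_def linear_sum bounded_linear.linear)

lemma bounded_op_id: "bounded_op id"
  using bounded_linear_ident by (simp add: bounded_op_def id_def)


subsection \<open>Orthonormal bases\<close>

text \<open>Families are indexed, unlike the sets in \<open>is_onb\<close>, so that Hermite bases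
  can carry their quantum numbers as indices.\<close>

definition orthonormal_on :: "'i set \<Rightarrow> ('i \<Rightarrow> 'a::complex_inner) \<Rightarrow> bool" where
  "orthonormal_on I E \<longleftrightarrow> (\<forall>i\<in>I. \<forall>j\<in>I. cinner (E i) (E j) = (if i = j then 1 else 0))"

definition onb_on :: "'i set \<Rightarrow> ('i \<Rightarrow> 'a::complex_inner) \<Rightarrow> bool" where
  "onb_on I E \<longleftrightarrow> orthonormal_on I E \<and> closure (span {c *\<^sub>C E i | c i. i \<in> I}) = UNIV"

lemma is_onb_iff: "is_onb B \<longleftrightarrow> onb_on B (\<lambda>x. x)"
  by (simp add: is_onb_def onb_on_def orthonormal_on_def)

lemma orthonormal_onD:
  "orthonormal_on I E \<Longrightarrow> i \<in> I \<Longrightarrow> j \<in> I \<Longrightarrow> cinner (E i) (E j) = (if i = j then 1 else 0)"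
  by (simp add: orthonormal_on_def)

lemma pythagoras_sum:
  fixes v :: "'i \<Rightarrow> 'a::complex_inner"
  assumes "finite F" "\<And>i j. i \<in> F \<Longrightarrow> j \<in> F \<Longrightarrow> i \<noteq> j \<Longrightarrow> cinner (v i) (v j) = 0"
  shows "(norm (\<Sum>i\<in>F. v i))\<^sup>2 = (\<Sum>i\<in>F. (norm (v i))\<^sup>2)"
proof -
  have "of_real ((norm (\<Sum>i\<in>F. v i))\<^sup>2) = (\<Sum>i\<in>F. \<Sum>j\<in>F. cinner (v i) (v j))"
    unfolding cinner_self[symmetric] cinner_sum_right cinner_sum_left by (rule sum.swap)
  also have "\<dots> = (\<Sum>i\<in>F. \<Sum>j\<in>F. if j = i then of_real ((norm (v i))\<^sup>2) else 0)"
    using assms by (intro sum.cong refl) (auto simp: cinner_self)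
  also have "\<dots> = of_real (\<Sum>i\<in>F. (norm (v i))\<^sup>2)"
    using \<open>finite F\<close> by simp
  finally show ?thesis by (simp only: of_real_eq_iff)
qed

text \<open>By Pythagoras the squared distance of two nested partial sums is a difference of partial
  sums of the squared norms. The latter converge, so the net of partial sums is Cauchy and
  completeness gives the limit.\<close>

lemma summable_on_orthogonal:
  fixes v :: "'i \<Rightarrow> 'a::{complex_inner,banach}"
  assumes orth: "\<And>i j. i \<in> A \<Longrightarrow> j \<in> A \<Longrightarrow> i \<noteq> j \<Longrightarrow> cinner (v i) (v j) = 0"
    and L: "((\<lambda>i. (norm (v i))\<^sup>2) has_sum L) A"
  shows "v summable_on A" and "(norm (infsum v A))\<^sup>2 = L"
proof -
  have "\<exists>P. eventually P (finite_subsets_at_top A) \<and>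
              (\<forall>F F'. P F \<and> P F' \<longrightarrow> dist (sum v F) (sum v F') < e)" if e: "e > 0" for e
  proof -
    have "eventually (\<lambda>F. dist (sum (\<lambda>i. (norm (v i))\<^sup>2) F) L < (e/2)\<^sup>2) (finite_subsets_at_top A)"
      using L e unfolding has_sum_def tendsto_iff by simp
    then obtain F0 where "finite F0 \<and> F0 \<subseteq> A \<and> (\<forall>F. finite F \<and> F0 \<subseteq> F \<and> F \<subseteq> A \<longrightarrow>
        dist (sum (\<lambda>i. (norm (v i))\<^sup>2) F) L < (e/2)\<^sup>2)"
      unfolding eventually_finite_subsets_at_top by (elim exE)
    then have F0: "finite F0" "F0 \<subseteq> A"
        "\<And>F. finite F \<Longrightarrow> F0 \<subseteq> F \<Longrightarrow> F \<subseteq> A \<Longrightarrow> dist (sum (\<lambda>i. (norm (v i))\<^sup>2) F) L < (e/2)\<^sup>2"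
      by simp_all
    define P where "P F \<longleftrightarrow> finite F \<and> F0 \<subseteq> F \<and> F \<subseteq> A" for F
    have "eventually P (finite_subsets_at_top A)"
      unfolding eventually_finite_subsets_at_top P_def using F0 by blast
    moreover have *: "dist (sum v F) (sum v F0) < e / 2" if "P F" for F
    proof -
      have "(dist (sum v F) (sum v F0))\<^sup>2 = (norm (sum v (F - F0)))\<^sup>2"
        using that F0 by (simp add: dist_norm sum_diff P_def)
      also have "\<dots> = (\<Sum>i\<in>F - F0. (norm (v i))\<^sup>2)"
        using that by (intro pythagoras_sum orth) (auto simp: P_def)
      also have "\<dots> = (\<Sum>i\<in>F. (norm (v i))\<^sup>2) - (\<Sum>i\<in>F0. (norm (v i))\<^sup>2)"
        using that F0 by (simp add: sum_diff P_def)
      also have "\<dots> < (e / 2)\<^sup>2"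
        using finite_sum_le_has_sum[OF L, of F] F0(3)[of F0] F0(1,2) that
        unfolding P_def dist_real_def by (auto simp del: power_divide)
      finally have "(dist (sum v F) (sum v F0))\<^sup>2 < (e / 2)\<^sup>2" .
      then show ?thesis by (rule power2_less_imp_less) (use e in simp)
    qed
    moreover have "dist (sum v F) (sum v F') < e" if "P F" "P F'" for F F'
      using *[OF that(1)] *[OF that(2)] dist_triangle2[of "sum v F" "sum v F'" "sum v F0"] by simp
    ultimately show ?thesis by blast
  qed
  then have "cauchy_filter (filtermap (sum v) (finite_subsets_at_top A))"
    by (simp add: cauchy_filter_metric_filtermap)
  then obtain l where l: "(sum v \<longlongrightarrow> l) (finite_subsets_at_top A)"
    using convergent_filter_iff_cauchy by (auto simp: convergent_filter_iff filterlim_def)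
  then show "v summable_on A" using summable_on_def has_sum_def by blast
  from l have "infsum v A = l" by (simp add: has_sum_def infsumI)
  moreover have "((\<lambda>F. (norm (sum v F))\<^sup>2) \<longlongrightarrow> (norm l)\<^sup>2) (finite_subsets_at_top A)"
    using l by (intro tendsto_intros)
  moreover have "((\<lambda>F. (norm (sum v F))\<^sup>2) \<longlongrightarrow> L) (finite_subsets_at_top A)"
  proof (rule Lim_transform_eventually)
    show "(sum (\<lambda>i. (norm (v i))\<^sup>2) \<longlongrightarrow> L) (finite_subsets_at_top A)"
      using L by (simp add: has_sum_def)
    show "\<forall>\<^sub>F F in finite_subsets_at_top A. (\<Sum>i\<in>F. (norm (v i))\<^sup>2) = (norm (sum v F))\<^sup>2"
      by (intro eventually_finite_subsets_at_top_weakI pythagoras_sum[symmetric] orth) auto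
  qed
  ultimately show "(norm (infsum v A))\<^sup>2 = L"
    using tendsto_unique finite_subsets_at_top_neq_bot by metis
qed

lemma orthonormal_coeff_sum:
  assumes E: "orthonormal_on I E" and F: "finite F" "F \<subseteq> I" and i: "i \<in> I"
  shows "cinner (E i) (\<Sum>j\<in>F. d j *\<^sub>C E j) = (if i \<in> F then d i else 0)"
proof -
  have "cinner (E i) (\<Sum>j\<in>F. d j *\<^sub>C E j) = (\<Sum>j\<in>F. if j = i then d i else 0)"
    unfolding cinner_sum_right cinner_scaleC_right
    using F i by (intro sum.cong refl) (auto simp: orthonormal_onD[OF E] subset_iff)
  then show ?thesis using F(1) by simp
qed

text \<open>The residual \<open>x - p\<close> is orthogonal to every \<open>E i\<close> with
  \<open>i\<close> in \<open>F\<close>, while \<open>q\<close> lies in their span. Taking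
  \<open>d = 0\<close> gives Bessel's inequality; general \<open>d\<close> says that the Fourier
  coefficients give the best approximation.\<close>

lemma orthonormal_sum_sub_norm:
  fixes x :: "'a::complex_inner"
  assumes E: "orthonormal_on I E" and F: "finite F" "F \<subseteq> I"
  shows "(norm (x - (\<Sum>i\<in>F. d i *\<^sub>C E i)))\<^sup>2 =
      (norm (x - (\<Sum>i\<in>F. cinner (E i) x *\<^sub>C E i)))\<^sup>2 + (\<Sum>i\<in>F. (cmod (cinner (E i) x - d i))\<^sup>2)"
proof -
  define p where "p = (\<Sum>i\<in>F. cinner (E i) x *\<^sub>C E i)"
  define q where "q = (\<Sum>i\<in>F. (cinner (E i) x - d i) *\<^sub>C E i)"
  have "cinner (E i) (x - p) = 0" if "i \<in> F" for i
    using that F by (simp add: p_def cinner_diff_right orthonormal_coeff_sum[OF E F] subset_iff)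
  then have "cinner q (x - p) = 0"
    by (simp add: q_def cinner_sum_left cinner_scaleC_left)
  then have "cinner q (x - p) = 0" "cinner (x - p) q = 0"
    by (simp, subst cinner_commute, simp)
  then have "cinner ((x - p) + q) ((x - p) + q) = cinner (x - p) (x - p) + cinner q q"
    unfolding cinner_add_left cinner_add_right by simp
  then have *: "(norm ((x - p) + q))\<^sup>2 = (norm (x - p))\<^sup>2 + (norm q)\<^sup>2"
    unfolding cinner_self of_real_add[symmetric] of_real_eq_iff .
  have "(norm q)\<^sup>2 = (\<Sum>i\<in>F. (norm ((cinner (E i) x - d i) *\<^sub>C E i))\<^sup>2)"
    unfolding q_def using F
    by (intro pythagoras_sum) (auto simp: cinner_scaleC_left cinner_scaleC_right orthonormal_onD[OF E] subset_iff)
  also have "\<dots> = (\<Sum>i\<in>F. (cmod (cinner (E i) x - d i))\<^sup>2)"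
  proof (intro sum.cong refl)
    fix i assume "i \<in> F"
    then have "cinner (E i) (E i) = 1" using F by (auto simp: orthonormal_onD[OF E])
    then have "norm (E i) = 1" by (simp add: norm_eq_1 inner_cinner)
    then show "(norm ((cinner (E i) x - d i) *\<^sub>C E i))\<^sup>2 = (cmod (cinner (E i) x - d i))\<^sup>2"
      by (simp add: norm_scaleC)
  qed
  finally have "(norm q)\<^sup>2 = (\<Sum>i\<in>F. (cmod (cinner (E i) x - d i))\<^sup>2)" .
  moreover have "x - p + q = x - (\<Sum>i\<in>F. d i *\<^sub>C E i)"
  proof -
    have "c *\<^sub>C y = (c - d) *\<^sub>C y + d *\<^sub>C y" for c d and y :: 'a
      by (simp add: scaleC_add_left[symmetric])
    then have "p = q + (\<Sum>i\<in>F. d i *\<^sub>C E i)"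
      unfolding p_def q_def sum.distrib[symmetric] by (intro sum.cong refl)
    then show ?thesis by simp
  qed
  ultimately show ?thesis using * unfolding p_def by metis
qed

lemma bessel:
  assumes "orthonormal_on I E" "finite F" "F \<subseteq> I"
  shows "(\<Sum>i\<in>F. (cmod (cinner (E i) x))\<^sup>2) \<le> (norm (x :: 'a::complex_inner))\<^sup>2"
  using orthonormal_sum_sub_norm[OF assms, of x "\<lambda>_. 0"] by simp

text \<open>Density supplies one finite combination within \<open>e\<close> of \<open>x\<close>. By
  best approximation, the Fourier sum over any larger finite index set is at least as close, which
  is convergence along the net of finite sets.\<close>

lemma onb_on_expansion:
  fixes x :: "'a::complex_inner"
  assumes onb: "onb_on I E"
  shows "((\<lambda>i. cinner (E i) x *\<^sub>C E i) has_sum x) I"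
proof -
  have E: "orthonormal_on I E" using onb by (simp add: onb_on_def)
  define S where "S = {y. \<exists>F d. finite F \<and> F \<subseteq> I \<and> y = (\<Sum>i\<in>F. d i *\<^sub>C E i)}"
  have "span {c *\<^sub>C E i | c i. i \<in> I} \<subseteq> S"
  proof (rule span_minimal)
    show "{c *\<^sub>C E i | c i. i \<in> I} \<subseteq> S"
    proof safe
      fix c i assume "i \<in> I"
      then show "c *\<^sub>C E i \<in> S" unfolding S_def
        by (auto intro!: exI[of _ "{i}"] exI[of _ "\<lambda>_. c"])
    qed
    show "subspace S"
    proof (rule subspaceI)
      show "0 \<in> S" unfolding S_def by (auto intro!: exI[of _ "{}"])
    next
      fix y z assume "y \<in> S" "z \<in> S"
      then obtain F d G c where *: "finite F" "F \<subseteq> I" "y = (\<Sum>i\<in>F. d i *\<^sub>C E i)"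
        "finite G" "G \<subseteq> I" "z = (\<Sum>i\<in>G. c i *\<^sub>C E i)" unfolding S_def by blast
      have "y = (\<Sum>i\<in>F \<union> G. (if i \<in> F then d i else 0) *\<^sub>C E i)"
        unfolding *(3) using * by (intro sum.mono_neutral_cong_left) auto
      moreover have "z = (\<Sum>i\<in>F \<union> G. (if i \<in> G then c i else 0) *\<^sub>C E i)"
        unfolding *(6) using * by (intro sum.mono_neutral_cong_left) auto
      ultimately have "y + z = (\<Sum>i\<in>F \<union> G. ((if i \<in> F then d i else 0) + (if i \<in> G then c i else 0)) *\<^sub>C E i)"
        by (simp add: sum.distrib scaleC_add_left)
      then show "y + z \<in> S" unfolding S_def using * by (auto intro!: exI[of _ "F \<union> G"])
    next
      fix r :: real and y assume "y \<in> S"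
      then obtain F d where *: "finite F" "F \<subseteq> I" "y = (\<Sum>i\<in>F. d i *\<^sub>C E i)"
        unfolding S_def by blast
      then have "r *\<^sub>R y = (\<Sum>i\<in>F. (of_real r * d i) *\<^sub>C E i)"
        by (simp add: scaleR_scaleC scaleC_sum_right scaleC_scaleC)
      then show "r *\<^sub>R y \<in> S" unfolding S_def using *
        by (auto intro!: exI[of _ F] exI[of _ "\<lambda>i. of_real r * d i"])
    qed
  qed
  then have cl: "closure S = UNIV" using onb closure_mono unfolding onb_on_def by blast
  show ?thesis
    unfolding has_sum_def tendsto_iff eventually_finite_subsets_at_top
  proof (intro allI impI)
    fix e :: real assume "e > 0"
    then obtain y where "y \<in> S" "dist y x < e"
      using cl closure_approachable[of x S] by auto
    then obtain F d where F: "finite F" "F \<subseteq> I" and d: "norm (x - (\<Sum>i\<in>F. d i *\<^sub>C E i)) < e"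
      unfolding S_def by (auto simp: dist_norm norm_minus_commute)
    have "dist (\<Sum>i\<in>G. cinner (E i) x *\<^sub>C E i) x < e" if G: "finite G" "F \<subseteq> G" "G \<subseteq> I" for G
    proof -
      have "(\<Sum>i\<in>F. d i *\<^sub>C E i) = (\<Sum>i\<in>G. (if i \<in> F then d i else 0) *\<^sub>C E i)"
        using G by (intro sum.mono_neutral_cong_left) auto
      then have "(norm (x - (\<Sum>i\<in>G. cinner (E i) x *\<^sub>C E i)))\<^sup>2 \<le> (norm (x - (\<Sum>i\<in>F. d i *\<^sub>C E i)))\<^sup>2"
        using orthonormal_sum_sub_norm[OF E G(1) G(3), of x "\<lambda>i. if i \<in> F then d i else 0"]
        by (simp only: sum_nonneg zero_le_power2 le_add_same_cancel1)
      then have "norm (x - (\<Sum>i\<in>G. cinner (E i) x *\<^sub>C E i)) \<le> norm (x - (\<Sum>i\<in>F. d i *\<^sub>C E i))"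
        by (rule power2_le_imp_le) simp
      then show ?thesis using d by (simp add: dist_norm norm_minus_commute)
    qed
    then show "\<exists>X. finite X \<and> X \<subseteq> I \<and> (\<forall>Y. finite Y \<and> X \<subseteq> Y \<and> Y \<subseteq> I \<longrightarrow>
        dist (\<Sum>i\<in>Y. cinner (E i) x *\<^sub>C E i) x < e)"
      using F by blast
  qed
qed

lemma parseval:
  assumes onb: "onb_on I E"
  shows "((\<lambda>i. cinner x (E i) * cinner (E i) y) has_sum cinner x y) I"
  using has_sum_bounded_linear[OF bounded_linear_cinner_right[of x] onb_on_expansion[OF onb, of y]]
  by (simp add: cinner_scaleC_right mult.commute)

lemma parseval_norm:
  assumes onb: "onb_on I E"
  shows "((\<lambda>i. (cmod (cinner (E i) x))\<^sup>2) has_sum (norm x)\<^sup>2) I"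
proof -
  have "((\<lambda>i. Re (cinner x (E i) * cinner (E i) x)) has_sum Re (cinner x x)) I"
    by (rule has_sum_Re[OF parseval[OF onb]])
  moreover have "Re (cinner x (E i) * cinner (E i) x) = (cmod (cinner (E i) x))\<^sup>2" for i
    by (subst cinner_commute) (simp add: cmod_power2 flip: power2_eq_square)
  ultimately show ?thesis by (simp add: cinner_self)
qed

lemma onb_on_eqI:
  assumes onb: "onb_on I E" and eq: "\<And>i. i \<in> I \<Longrightarrow> cinner (E i) x = cinner (E i) y"
  shows "x = y"
proof (rule has_sum_unique)
  show "((\<lambda>i. cinner (E i) x *\<^sub>C E i) has_sum x) I" by (rule onb_on_expansion[OF onb])
  show "((\<lambda>i. cinner (E i) x *\<^sub>C E i) has_sum y) I"
    using onb_on_expansion[OF onb, of y] by (rule has_sum_cong[THEN iffD1, rotated]) (simp add: eq)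
qed

text \<open>This produces vectors with prescribed coefficients; completeness enters through
  \<open>summable_on_orthogonal\<close>.\<close>

lemma riesz_fischer:
  fixes E :: "'i \<Rightarrow> 'a::{complex_inner,banach}"
  assumes E: "orthonormal_on I E" and c: "(\<lambda>i. (cmod (c i))\<^sup>2) summable_on I"
  shows "(\<lambda>i. c i *\<^sub>C E i) summable_on I"
    and "i \<in> I \<Longrightarrow> cinner (E i) (\<Sum>\<^sub>\<infinity>i\<in>I. c i *\<^sub>C E i) = c i"
proof -
  have n: "norm (E i) = 1" if "i \<in> I" for i
  proof -
    have "cinner (E i) (E i) = 1" using that by (auto simp: orthonormal_onD[OF E])
    then show ?thesis by (simp add: norm_eq_1 inner_cinner)
  qed
  have "(\<lambda>i. (norm (c i *\<^sub>C E i))\<^sup>2) summable_on I"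
    using c by (rule summable_on_cong[THEN iffD1, rotated]) (simp add: n norm_scaleC)
  then show s: "(\<lambda>i. c i *\<^sub>C E i) summable_on I"
    by (intro summable_on_orthogonal(1)[OF _ has_sum_infsum])
      (auto simp: cinner_scaleC_left cinner_scaleC_right orthonormal_onD[OF E])
  assume i: "i \<in> I"
  have "((\<lambda>j. cinner (E i) (c j *\<^sub>C E j)) has_sum cinner (E i) (\<Sum>\<^sub>\<infinity>i\<in>I. c i *\<^sub>C E i)) I"
    by (intro has_sum_bounded_linear[OF bounded_linear_cinner_right] has_sum_infsum s)
  moreover have "((\<lambda>j. cinner (E i) (c j *\<^sub>C E j)) has_sum c i) I"
    using i by (intro has_sum_finite_neutralI[where B = "{i}"])
      (auto simp: cinner_scaleC_right orthonormal_onD[OF E])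
  ultimately show "cinner (E i) (\<Sum>\<^sub>\<infinity>i\<in>I. c i *\<^sub>C E i) = c i" by (rule has_sum_unique)
qed

lemma orthonormal_on_summable_coeffs:
  assumes "orthonormal_on I E"
  shows "(\<lambda>i. (cmod (cinner (E i) x))\<^sup>2) summable_on I"
  by (rule nonneg_bdd_above_summable_on)
    (auto intro!: bdd_aboveI[of _ "(norm x)\<^sup>2"] bessel[OF assms])

text \<open>The Fourier sum of \<open>x\<close> exists by Riesz-Fischer, and \<open>x\<close> minus
  that sum is orthogonal to the whole family. Proving that a family is a basis thus reduces to
  showing that only 0 is orthogonal to it.\<close>

lemma onb_onI:
  fixes E :: "'i \<Rightarrow> 'a::{complex_inner,banach}"
  assumes E: "orthonormal_on I E"
    and total: "\<And>x. (\<And>i. i \<in> I \<Longrightarrow> cinner (E i) x = 0) \<Longrightarrow> x = 0"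
  shows "onb_on I E"
  unfolding onb_on_def
proof (intro conjI E)
  have "x \<in> closure (span {c *\<^sub>C E i | c i. i \<in> I})" for x
  proof -
    note c = orthonormal_on_summable_coeffs[OF E, of x]
    define y where "y = (\<Sum>\<^sub>\<infinity>i\<in>I. cinner (E i) x *\<^sub>C E i)"
    have "x - y = 0"
      by (rule total) (simp add: cinner_diff_right y_def riesz_fischer(2)[OF E c])
    then have "(sum (\<lambda>i. cinner (E i) x *\<^sub>C E i) \<longlongrightarrow> x) (finite_subsets_at_top I)"
      using has_sum_infsum[OF riesz_fischer(1)[OF E c]] by (simp add: y_def has_sum_def)
    moreover have "\<forall>\<^sub>F F in finite_subsets_at_top I.
        (\<Sum>i\<in>F. cinner (E i) x *\<^sub>C E i) \<in> closure (span {c *\<^sub>C E i | c i. i \<in> I})"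
      by (intro eventually_finite_subsets_at_top_weakI closure_subset[THEN subsetD] span_sum span_base)
        blast
    ultimately show ?thesis
      by (intro Lim_in_closed_set[OF closed_closure _ finite_subsets_at_top_neq_bot])
  qed
  then show "closure (span {c *\<^sub>C E i | c i. i \<in> I}) = UNIV" by blast
qed

lemma bounded_op_eqI:
  assumes onb: "onb_on I E" and T: "bounded_op T" "bounded_op T'"
    and eq: "\<And>i. i \<in> I \<Longrightarrow> T (E i) = T' (E i)"
  shows "T = T'"
proof
  fix x
  have "((\<lambda>i. T (cinner (E i) x *\<^sub>C E i)) has_sum T x) I"
    using T(1) by (intro has_sum_bounded_linear[OF _ onb_on_expansion[OF onb]]) (simp add: bounded_op_def)
  moreover have "((\<lambda>i. T' (cinner (E i) x *\<^sub>C E i)) has_sum T' x) I"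
    using T(2) by (intro has_sum_bounded_linear[OF _ onb_on_expansion[OF onb]]) (simp add: bounded_op_def)
  moreover have "((\<lambda>i. T (cinner (E i) x *\<^sub>C E i)) has_sum T' x) I \<longleftrightarrow>
      ((\<lambda>i. T' (cinner (E i) x *\<^sub>C E i)) has_sum T' x) I"
    by (intro has_sum_cong) (simp add: bounded_op_scaleC[OF T(1)] bounded_op_scaleC[OF T(2)] eq)
  ultimately show "T x = T' x" using has_sum_unique by blast
qed


subsection \<open>Traces of finite-rank operators\<close>

lemma has_sum_finite_sum:
  fixes f :: "'k \<Rightarrow> 'i \<Rightarrow> 'a::topological_comm_monoid_add"
  shows "(\<And>k. k \<in> K \<Longrightarrow> (f k has_sum s k) A) \<Longrightarrow> ((\<lambda>x. \<Sum>k\<in>K. f k x) has_sum (\<Sum>k\<in>K. s k)) A"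
  by (induction K rule: infinite_finite_induct) (auto intro: has_sum_add)

text \<open>Each rank-one term contributes a Parseval sum over the chosen basis, so the value does
  not depend on which basis the choice operator picked.\<close>

lemma op_trace_finite_rank:
  assumes onb: "is_onb (some_onb :: 'a::complex_inner set)"
  shows "op_trace (\<lambda>\<phi>. \<Sum>k\<in>K. cinner (\<psi> k) \<phi> *\<^sub>C \<zeta> k) = (\<Sum>k\<in>K. cinner (\<psi> k) (\<zeta> k :: 'a))"
proof -
  have "((\<lambda>e. \<Sum>k\<in>K. cinner (\<psi> k) e * cinner e (\<zeta> k)) has_sum (\<Sum>k\<in>K. cinner (\<psi> k) (\<zeta> k))) some_onb"
    using parseval[OF onb[unfolded is_onb_iff]] by (intro has_sum_finite_sum) auto
  then show ?thesis
    unfolding op_trace_def cinner_sum_right cinner_scaleC_right by (rule infsumI)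
qed

lemma positive_trace_dyads:
  assumes onb: "is_onb (some_onb :: 'a::complex_inner set)"
    and c: "\<And>k. k \<in> K \<Longrightarrow> 0 \<le> c k"
  shows "positive_trace (\<lambda>\<phi>. \<Sum>k\<in>K. c k *\<^sub>R dyad (\<zeta> k :: 'a) \<phi>) = ennreal (\<Sum>k\<in>K. c k * (norm (\<zeta> k))\<^sup>2)"
proof -
  have eq: "Re (cinner e (\<Sum>k\<in>K. c k *\<^sub>R dyad (\<zeta> k) \<phi>)) = (\<Sum>k\<in>K. c k * Re (cinner e (dyad (\<zeta> k) \<phi>)))" for e \<phi> :: 'a
    by (simp add: cinner_sum_right cinner_scaleR_right)
  have eq2: "Re (cinner e (dyad x e)) = (cmod (cinner e x))\<^sup>2" for e x :: 'a
    unfolding dyad_def cinner_scaleC_right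
    by (subst cinner_commute) (simp add: cmod_power2 flip: power2_eq_square)
  have "((\<lambda>e. \<Sum>k\<in>K. c k * (cmod (cinner e (\<zeta> k)))\<^sup>2) has_sum (\<Sum>k\<in>K. c k * (norm (\<zeta> k))\<^sup>2)) some_onb"
    by (intro has_sum_finite_sum has_sum_cmult_right parseval_norm[OF onb[unfolded is_onb_iff]])
  then have s: "((\<lambda>e. Re (cinner e (\<Sum>k\<in>K. c k *\<^sub>R dyad (\<zeta> k) e))) has_sum (\<Sum>k\<in>K. c k * (norm (\<zeta> k))\<^sup>2)) some_onb"
    unfolding eq eq2 .
  have nn: "0 \<le> Re (cinner e (\<Sum>k\<in>K. c k *\<^sub>R dyad (\<zeta> k) e))" for e
    unfolding eq eq2 using c by (intro sum_nonneg mult_nonneg_nonneg) auto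
  \<comment> \<open>For nonnegative terms both the real sum and the \<open>ennreal\<close> sum are
    suprema of the same finite partial sums.\<close>
  have "ennreal (infsum (\<lambda>e. Re (cinner e (\<Sum>k\<in>K. c k *\<^sub>R dyad (\<zeta> k) e))) some_onb) =
      positive_trace (\<lambda>\<phi>. \<Sum>k\<in>K. c k *\<^sub>R dyad (\<zeta> k) \<phi>)"
    unfolding positive_trace_def nonneg_infsum_complete[OF zero_le]
    by (subst infsum_nonneg_is_SUPREMUM_ennreal) (use s nn in \<open>auto simp: summable_on_def intro!: SUP_cong\<close>)
  then show ?thesis using infsumI[OF s] by simp
qed


subsection \<open>Diagonal operators and uniqueness of the square root\<close>

text \<open>Multiplication of the coefficients by \<open>l\<close> on its maximal domain. For an
  orthonormal basis, the existence of \<open>\<xi>\<close> in the space encodes the square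
  summability of the weighted coefficients.\<close>

definition diag_graph :: "'i set \<Rightarrow> ('i \<Rightarrow> 'a::complex_inner) \<Rightarrow> ('i \<Rightarrow> real) \<Rightarrow> ('a \<times> 'a) set" where
  "diag_graph I E l = {(\<psi>, \<xi>). \<forall>i\<in>I. cinner (E i) \<xi> = of_real (l i) * cinner (E i) \<psi>}"

lemma adjoint_graph_mono: "G \<subseteq> H \<Longrightarrow> adjoint_graph H \<subseteq> adjoint_graph G"
  by (auto simp: adjoint_graph_def)

lemma diag_graph_basis:
  assumes "orthonormal_on I E" "i \<in> I"
  shows "(E i, of_real (l i) *\<^sub>C E i) \<in> diag_graph I E l"
  using assms by (auto simp: diag_graph_def cinner_scaleC_right orthonormal_onD)

lemma diag_graph_scaleC: "(\<psi>, \<xi>) \<in> diag_graph I E l \<Longrightarrow> (c *\<^sub>C \<psi>, c *\<^sub>C \<xi>) \<in> diag_graph I E l"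
  by (auto simp: diag_graph_def cinner_scaleC_right)

lemma diag_graph_add:
  "(\<psi>, \<xi>) \<in> diag_graph I E l \<Longrightarrow> (\<psi>', \<xi>') \<in> diag_graph I E l \<Longrightarrow> (\<psi> + \<psi>', \<xi> + \<xi>') \<in> diag_graph I E l"
  by (auto simp: diag_graph_def cinner_add_right ring_distribs)

lemma diag_graph_scaleR: "(\<psi>, \<xi>) \<in> diag_graph I E l \<Longrightarrow> (r *\<^sub>R \<psi>, r *\<^sub>R \<xi>) \<in> diag_graph I E l"
  by (simp add: scaleR_scaleC diag_graph_scaleC)

lemma diag_graph_zero: "(0, 0) \<in> diag_graph I E l"
  by (simp add: diag_graph_def)

lemma diag_graph_sum:
  "(\<And>k. k \<in> K \<Longrightarrow> (f k, g k) \<in> diag_graph I E l) \<Longrightarrow> (sum f K, sum g K) \<in> diag_graph I E l"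
  by (induction K rule: infinite_finite_induct) (auto intro: diag_graph_add diag_graph_zero)

lemma diag_graph_symmetric:
  assumes onb: "onb_on I E" and "(\<phi>, \<omega>) \<in> diag_graph I E l" "(\<psi>, \<xi>) \<in> diag_graph I E l"
  shows "cinner \<omega> \<psi> = cinner \<phi> \<xi>"
proof (rule has_sum_unique[OF parseval[OF onb]])
  have "cinner \<phi> (E i) * cinner (E i) \<xi> = cinner \<omega> (E i) * cinner (E i) \<psi>" if "i \<in> I" for i
  proof -
    have "cinner \<omega> (E i) = of_real (l i) * cinner \<phi> (E i)"
      using assms(2) that by (subst (1 2) cinner_commute) (auto simp: diag_graph_def)
    then show ?thesis using assms(3) that by (auto simp: diag_graph_def)
  qed
  then show "((\<lambda>i. cinner \<omega> (E i) * cinner (E i) \<psi>) has_sum cinner \<phi> \<xi>) I"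
    using parseval[OF onb, of \<phi> \<xi>] by (subst (asm) has_sum_cong) auto
qed

text \<open>Testing an element of the adjoint against the eigenvectors \<open>E i\<close> alone
  already yields the defining coefficient equations; the other inclusion is symmetry by
  Parseval.\<close>

lemma adjoint_diag_graph:
  assumes onb: "onb_on I E"
  shows "adjoint_graph (diag_graph I E l) = diag_graph I E l"
proof
  have E: "orthonormal_on I E" using onb by (simp add: onb_on_def)
  show "diag_graph I E l \<subseteq> adjoint_graph (diag_graph I E l)"
    using diag_graph_symmetric[OF onb] by (auto simp: adjoint_graph_def)
  show "adjoint_graph (diag_graph I E l) \<subseteq> diag_graph I E l"
  proof safe
    fix \<psi> \<xi> assume *: "(\<psi>, \<xi>) \<in> adjoint_graph (diag_graph I E l)"
    show "(\<psi>, \<xi>) \<in> diag_graph I E l" unfolding diag_graph_def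
    proof safe
      fix i assume "i \<in> I"
      then show "cinner (E i) \<xi> = of_real (l i) * cinner (E i) \<psi>"
        using * diag_graph_basis[OF E, of i l] by (auto simp: adjoint_graph_def cinner_scaleC_left)
    qed
  qed
qed

lemma closure_Domain_diag_graph:
  assumes onb: "onb_on I E"
  shows "closure (Domain (diag_graph I E l)) = UNIV"
proof -
  have E: "orthonormal_on I E" using onb by (simp add: onb_on_def)
  have "span {c *\<^sub>C E i | c i. i \<in> I} \<subseteq> Domain (diag_graph I E l)"
  proof (rule span_minimal)
    show "{c *\<^sub>C E i | c i. i \<in> I} \<subseteq> Domain (diag_graph I E l)"
      using diag_graph_scaleC[OF diag_graph_basis[OF E]] by blast
    show "subspace (Domain (diag_graph I E l))"
      by (rule subspaceI) (use diag_graph_zero diag_graph_add diag_graph_scaleR in \<open>blast+\<close>)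
  qed
  then show ?thesis using onb closure_mono unfolding onb_on_def by blast
qed

lemma self_adjoint_diag_graph: "onb_on I E \<Longrightarrow> self_adjoint (diag_graph I E l)"
  by (simp add: self_adjoint_def adjoint_diag_graph closure_Domain_diag_graph)

lemma nonneg_diag_graph:
  assumes onb: "onb_on I E" and l: "\<And>i. i \<in> I \<Longrightarrow> 0 \<le> l i"
  shows "nonneg_graph (diag_graph I E l)"
  unfolding nonneg_graph_def
proof safe
  fix \<phi> \<omega> assume *: "(\<phi>, \<omega>) \<in> diag_graph I E l"
  show "0 \<le> Re (cinner \<phi> \<omega>)"
  proof (rule has_sum_nonneg[OF has_sum_Re[OF parseval[OF onb, of \<phi> \<omega>]]])
    fix i assume i: "i \<in> I"
    have "cinner \<phi> (E i) * cinner (E i) \<omega> = of_real (l i * (cmod (cinner (E i) \<phi>))\<^sup>2)"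
      using * i by (subst cinner_commute) (auto simp: diag_graph_def complex_norm_square simp del: of_real_power)
    then show "0 \<le> Re (cinner \<phi> (E i) * cinner (E i) \<omega>)" using l[OF i] by simp
  qed
qed

text \<open>The point is the existence of the intermediate vector. Since \<open>l i\<close> is at
  most \<open>1 + (l i)^2\<close>, the coefficients scaled by the square root of \<open>l i\<close>
  are square summable as soon as those of \<open>\<psi>\<close> and \<open>\<xi>\<close>
  are.\<close>

lemma diag_graph_sqrt_relcomp:
  fixes E :: "'i \<Rightarrow> 'a::{complex_inner,banach}"
  assumes onb: "onb_on I E" and l: "\<And>i. i \<in> I \<Longrightarrow> 0 \<le> l i"
  shows "diag_graph I E (\<lambda>i. sqrt (l i)) O diag_graph I E (\<lambda>i. sqrt (l i)) = diag_graph I E l"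
proof
  have E: "orthonormal_on I E" using onb by (simp add: onb_on_def)
  have sq: "of_real (sqrt (l i)) * (of_real (sqrt (l i)) * z) = of_real (l i) * (z :: complex)" if "i \<in> I" for i z
    using l[OF that] by (simp flip: of_real_mult mult.assoc)
  show "diag_graph I E (\<lambda>i. sqrt (l i)) O diag_graph I E (\<lambda>i. sqrt (l i)) \<subseteq> diag_graph I E l"
    by (auto simp: diag_graph_def sq)
  show "diag_graph I E l \<subseteq> diag_graph I E (\<lambda>i. sqrt (l i)) O diag_graph I E (\<lambda>i. sqrt (l i))"
  proof safe
    fix \<psi> \<xi> assume *: "(\<psi>, \<xi>) \<in> diag_graph I E l"
    define c where "c i = of_real (sqrt (l i)) * cinner (E i) \<psi>" for i
    have "(\<lambda>i. (cmod (c i))\<^sup>2) summable_on I"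
    proof (rule summable_on_comparison_test)
      show "(\<lambda>i. (cmod (cinner (E i) \<psi>))\<^sup>2 + (cmod (cinner (E i) \<xi>))\<^sup>2) summable_on I"
        by (intro summable_on_add orthonormal_on_summable_coeffs E)
      fix i assume i: "i \<in> I"
      have "(cmod (c i))\<^sup>2 = l i * (cmod (cinner (E i) \<psi>))\<^sup>2"
        using l[OF i] by (simp add: c_def norm_mult power_mult_distrib)
      also have "\<dots> \<le> (1 + (l i)\<^sup>2) * (cmod (cinner (E i) \<psi>))\<^sup>2"
      proof (intro mult_right_mono)
        have "0 \<le> (l i - 1)\<^sup>2" by simp
        then have "2 * l i \<le> 1 + (l i)\<^sup>2" by (simp add: power2_diff)
        then show "l i \<le> 1 + (l i)\<^sup>2" using l[OF i] by simp
      qed simp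
      also have "\<dots> = (cmod (cinner (E i) \<psi>))\<^sup>2 + (cmod (cinner (E i) \<xi>))\<^sup>2"
        using * i by (auto simp: diag_graph_def norm_mult power_mult_distrib ring_distribs)
      finally show "(cmod (c i))\<^sup>2 \<le> (cmod (cinner (E i) \<psi>))\<^sup>2 + (cmod (cinner (E i) \<xi>))\<^sup>2" .
    qed simp
    from riesz_fischer(2)[OF E this] obtain \<zeta> where \<zeta>: "\<And>i. i \<in> I \<Longrightarrow> cinner (E i) \<zeta> = c i"
      by blast
    then have "(\<psi>, \<zeta>) \<in> diag_graph I E (\<lambda>i. sqrt (l i))" by (simp add: diag_graph_def c_def)
    moreover have "(\<zeta>, \<xi>) \<in> diag_graph I E (\<lambda>i. sqrt (l i))"
      using * by (auto simp: diag_graph_def \<zeta> c_def sq)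
    ultimately show "(\<psi>, \<xi>) \<in> diag_graph I E (\<lambda>i. sqrt (l i)) O diag_graph I E (\<lambda>i. sqrt (l i))" by blast
  qed
qed

lemma self_adjointD:
  assumes "self_adjoint D" "(\<phi>, \<omega>) \<in> D" "(\<psi>, \<xi>) \<in> D"
  shows "cinner \<omega> \<psi> = cinner \<phi> \<xi>"
  using assms unfolding self_adjoint_def adjoint_graph_def by blast

lemma self_adjoint_lincomb:
  assumes D: "self_adjoint D" and "(\<psi>, \<xi>) \<in> D" "(\<psi>', \<xi>') \<in> D"
  shows "(\<psi> + r *\<^sub>R \<psi>', \<xi> + r *\<^sub>R \<xi>') \<in> D"
proof -
  have "(\<psi> + r *\<^sub>R \<psi>', \<xi> + r *\<^sub>R \<xi>') \<in> adjoint_graph D"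
    unfolding adjoint_graph_def
    by (clarify, simp only: cinner_add_right cinner_scaleR_right self_adjointD[OF D _ assms(2)]
        self_adjointD[OF D _ assms(3)])
  then show ?thesis using D by (simp add: self_adjoint_def)
qed

text \<open>
  An eigenvector of \<open>D\<^sup>2\<close> for the eigenvalue \<open>\<mu> \<ge> 0\<close> is an eigenvector of \<open>D\<close> for \<open>\<surd>\<mu>\<close>: if \<open>\<mu> > 0\<close>,
  then \<open>D e - \<surd>\<mu> e\<close> would otherwise be an eigenvector for the negative eigenvalue \<open>- \<surd>\<mu>\<close>.
\<close>

lemma nonneg_sqrt_eigenvector:
  assumes D: "self_adjoint D" "nonneg_graph D"
    and e: "(e, of_real m *\<^sub>C e) \<in> D O D" and m: "0 \<le> m"
  shows "(e, sqrt m *\<^sub>R e) \<in> D"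
proof -
  from e obtain f where f: "(e, f) \<in> D" "(f, m *\<^sub>R e) \<in> D" by (auto simp: scaleR_scaleC)
  have "f = sqrt m *\<^sub>R e"
  proof (cases "m = 0")
    case True
    \<comment> \<open>Symmetry moves \<open>D\<close> across: <f, f> = <e, D f> = 0.\<close>
    then have "cinner f f = 0" using self_adjointD[OF D(1) f] by simp
    then show ?thesis using True by (simp add: cinner_self)
  next
    case False
    then have m: "0 < m" using m by simp
    define s where "s = sqrt m"
    have s: "0 < s" "s * s = m" using m by (auto simp: s_def)
    define g where "g = f - s *\<^sub>R e"
    have "(f + (- s) *\<^sub>R e, m *\<^sub>R e + (- s) *\<^sub>R f) \<in> D"
      by (rule self_adjoint_lincomb[OF D(1) f(2) f(1)])
    moreover have "m *\<^sub>R e + (- s) *\<^sub>R f = (- s) *\<^sub>R g"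
      by (simp add: g_def algebra_simps s(2)[symmetric])
    ultimately have "(g, (- s) *\<^sub>R g) \<in> D" by (simp add: g_def)
    then have "0 \<le> Re (cinner g ((- s) *\<^sub>R g))" using D(2) by (auto simp: nonneg_graph_def)
    then have "s * (norm g)\<^sup>2 \<le> 0" by (simp only: cinner_scaleR_right cinner_self) simp
    then have "g = 0" using s(1) by (simp add: mult_le_0_iff)
    then show ?thesis by (simp add: g_def s_def)
  qed
  then show ?thesis using f(1) by simp
qed

text \<open>Any nonnegative root \<open>D\<close> has the same eigenvectors \<open>E i\<close>;
  symmetry against them places \<open>D\<close> inside the diagonal root. Taking adjoints reverses
  this inclusion, and both graphs are their own adjoints, so they coincide.\<close>

lemma sqrt_diag_graph:
  fixes E :: "'i \<Rightarrow> 'a::{complex_inner,banach}"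
  assumes onb: "onb_on I E" and l: "\<And>i. i \<in> I \<Longrightarrow> 0 \<le> l i"
  shows "sqrt_graph (diag_graph I E l) = diag_graph I E (\<lambda>i. sqrt (l i))"
  unfolding sqrt_graph_def
proof (rule the_equality)
  show "self_adjoint (diag_graph I E (\<lambda>i. sqrt (l i))) \<and> nonneg_graph (diag_graph I E (\<lambda>i. sqrt (l i))) \<and>
      diag_graph I E (\<lambda>i. sqrt (l i)) O diag_graph I E (\<lambda>i. sqrt (l i)) = diag_graph I E l"
    using self_adjoint_diag_graph[OF onb] nonneg_diag_graph[OF onb, of "\<lambda>i. sqrt (l i)"]
      diag_graph_sqrt_relcomp[OF onb l] l by simp
next
  have E: "orthonormal_on I E" using onb by (simp add: onb_on_def)
  fix D assume D: "self_adjoint D \<and> nonneg_graph D \<and> D O D = diag_graph I E l"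
  have eig: "(E i, sqrt (l i) *\<^sub>R E i) \<in> D" if "i \<in> I" for i
    using D diag_graph_basis[OF E that, of l] l[OF that] by (intro nonneg_sqrt_eigenvector) auto
  have adj: "adjoint_graph D = D" using D by (simp add: self_adjoint_def)
  have le: "D \<subseteq> diag_graph I E (\<lambda>i. sqrt (l i))"
  proof (intro subrelI)
    fix \<psi> \<xi> assume "(\<psi>, \<xi>) \<in> D"
    then have "cinner \<omega> \<psi> = cinner \<phi> \<xi>" if "(\<phi>, \<omega>) \<in> D" for \<phi> \<omega>
      using that adj unfolding adjoint_graph_def by blast
    then show "(\<psi>, \<xi>) \<in> diag_graph I E (\<lambda>i. sqrt (l i))"
      using eig by (fastforce simp: diag_graph_def cinner_scaleR_left)
  qed
  then have "diag_graph I E (\<lambda>i. sqrt (l i)) \<subseteq> D"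
    using adjoint_graph_mono[OF le] adj adjoint_diag_graph[OF onb] by simp
  with le show "D = diag_graph I E (\<lambda>i. sqrt (l i))" by blast
qed

section \<open>Finite real combinations of dyads and their sandwich traces\<close>

lemma bounded_op_dyads: "bounded_op (\<lambda>\<phi>. \<Sum>k\<in>K. c k *\<^sub>R dyad (\<zeta> k :: 'a::complex_inner) \<phi>)"
  unfolding bounded_op_def
proof safe
  have "bounded_linear (\<lambda>\<phi>. dyad u \<phi>)" for u :: 'a
  proof (rule bounded_linear_intro[of _ "norm u * norm u"])
    show "norm (dyad u x) \<le> norm x * (norm u * norm u)" for x
      using mult_right_mono[OF cmod_cinner_le[of u x] norm_ge_zero[of u]]
      by (simp add: dyad_def norm_scaleC mult_ac)
  qed (simp_all add: dyad_def cinner_add_right scaleC_add_left cinner_scaleR_right scaleR_scaleC[of _ "_ *\<^sub>C _"] scaleC_scaleC)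
  then show "bounded_linear (\<lambda>\<phi>. \<Sum>k\<in>K. c k *\<^sub>R dyad (\<zeta> k) \<phi>)"
    by (intro bounded_linear_sum bounded_linear_compose[OF bounded_linear_scaleR_right])
  show "(\<Sum>k\<in>K. c k *\<^sub>R dyad (\<zeta> k) (d *\<^sub>C x)) = d *\<^sub>C (\<Sum>k\<in>K. c k *\<^sub>R dyad (\<zeta> k) x)" for d x
    by (simp add: scaleC_sum_right dyad_def scaleR_scaleC scaleC_scaleC cinner_scaleC_right mult_ac)
qed

lemma positive_op_dyads:
  assumes "\<And>k. k \<in> K \<Longrightarrow> 0 \<le> c k"
  shows "positive_op (\<lambda>\<phi>. \<Sum>k\<in>K. c k *\<^sub>R dyad (\<zeta> k :: 'a::complex_inner) \<phi>)"
  unfolding positive_op_def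
proof (intro conjI allI bounded_op_dyads)
  fix x y :: 'a
  have "cinner (dyad u x) y = cinner x (dyad u y)" for u :: 'a
    unfolding dyad_def cinner_scaleC_right cinner_scaleC_left cinner_commute[of x u] by simp
  then show "cinner (\<Sum>k\<in>K. c k *\<^sub>R dyad (\<zeta> k) x) y = cinner x (\<Sum>k\<in>K. c k *\<^sub>R dyad (\<zeta> k) y)"
    by (simp add: cinner_sum_left cinner_sum_right cinner_scaleR_left cinner_scaleR_right)
  have "Re (cinner x (dyad u x)) = (cmod (cinner u x))\<^sup>2" for u :: 'a
    unfolding dyad_def cinner_scaleC_right cinner_commute[of x u]
    by (simp add: cmod_power2 flip: power2_eq_square)
  then show "0 \<le> Re (cinner x (\<Sum>k\<in>K. c k *\<^sub>R dyad (\<zeta> k) x))"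
    using assms by (auto simp: cinner_sum_right cinner_scaleR_right intro!: sum_nonneg)
qed

text \<open>Sandwiching the dyad of a vector in the domain of D gives the dyad of its image under D,
  so the bounded extension is explicit and its trace is a weighted sum of squared norms.\<close>

lemma sandwich_trace_dyads:
  fixes E :: "'i \<Rightarrow> 'a::complex_inner"
  assumes onb: "onb_on I E" and some: "is_onb (some_onb :: 'a set)"
    and \<psi>: "\<And>k. k \<in> K \<Longrightarrow> (\<psi> k, \<zeta> k) \<in> diag_graph I E l" and c: "\<And>k. k \<in> K \<Longrightarrow> 0 \<le> c k"
  shows "sandwich_trace (diag_graph I E l) (\<lambda>\<phi>. \<Sum>k\<in>K. c k *\<^sub>R dyad (\<psi> k) \<phi>) =
      ennreal (\<Sum>k\<in>K. c k * (norm (\<zeta> k))\<^sup>2)"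
proof -
  define D where "D = diag_graph I E l"
  define Q where "Q = (\<lambda>\<phi>. \<Sum>k\<in>K. c k *\<^sub>R dyad (\<psi> k) \<phi>)"
  define T where "T = (\<lambda>\<phi>. \<Sum>k\<in>K. c k *\<^sub>R dyad (\<zeta> k) \<phi>)"
  have ext: "extends_sandwich D Q T"
    unfolding extends_sandwich_def
  proof safe
    show "bounded_op T" unfolding T_def by (rule bounded_op_dyads)
    fix \<phi> \<omega> assume D: "(\<phi>, \<omega>) \<in> D"
    have "(\<Sum>k\<in>K. c k *\<^sub>R cinner (\<psi> k) \<omega> *\<^sub>C \<psi> k, \<Sum>k\<in>K. c k *\<^sub>R cinner (\<psi> k) \<omega> *\<^sub>C \<zeta> k) \<in> D"
      unfolding D_def by (intro diag_graph_sum diag_graph_scaleR diag_graph_scaleC \<psi>)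
    \<comment> \<open>Here D moves from the argument of \<open>Q\<close> to the vector of the
      dyad.\<close>
    moreover have "cinner (\<psi> k) \<omega> = cinner (\<zeta> k) \<phi>" if "k \<in> K" for k
      using diag_graph_symmetric[OF onb \<psi>[OF that] D[unfolded D_def]] by simp
    ultimately show "(Q \<omega>, T \<phi>) \<in> D" by (simp add: Q_def T_def dyad_def)
  qed
  moreover have "T' = T" if T': "extends_sandwich D Q T'" for T'
  proof (rule bounded_op_eqI[OF onb])
    show "bounded_op T'" "bounded_op T" using T' ext by (auto simp: extends_sandwich_def)
    fix i assume i: "i \<in> I"
    have "(E i, of_real (l i) *\<^sub>C E i) \<in> D"
      unfolding D_def using onb i by (intro diag_graph_basis) (auto simp: onb_on_def)
    then have "(Q (of_real (l i) *\<^sub>C E i), T' (E i)) \<in> D" "(Q (of_real (l i) *\<^sub>C E i), T (E i)) \<in> D"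
      using T' ext by (auto simp: extends_sandwich_def)
    \<comment> \<open>Both vectors are images under D of the same vector, and the basis makes the
      graph of D single-valued.\<close>
    then show "T' (E i) = T (E i)"
      by (intro onb_on_eqI[OF onb]) (auto simp: D_def diag_graph_def)
  qed
  ultimately have "(THE T. extends_sandwich D Q T) = T" by (intro the_equality)
  then have "sandwich_trace D Q = positive_trace T"
    using ext unfolding sandwich_trace_def by auto
  then show ?thesis
    unfolding D_def Q_def T_def using positive_trace_dyads[OF some c] by simp
qed


subsection \<open>Extending an operator to a tensor product\<close>

text \<open>The product map \<open>t\<close> is abstract so that one proof covers both tensor
  factors: instantiating \<open>t\<close> with the factors swapped turns A acting on the left into A
  acting on the right. Uniqueness holds because the values on the product basis are
  prescribed.\<close>

lemma tensor_operator_ex1: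
  fixes t :: "'a::{complex_inner,banach} \<Rightarrow> 'b::complex_inner \<Rightarrow> 'c::{complex_inner,banach}"
  assumes add_left: "\<And>x y z. t (x + y) z = t x z + t y z"
    and add_right: "\<And>x y z. t x (y + z) = t x y + t x z"
    and scale_left: "\<And>c x y. t (c *\<^sub>C x) y = c *\<^sub>C t x y"
    and scale_right: "\<And>c x y. t x (c *\<^sub>C y) = c *\<^sub>C t x y"
    and cinner_t: "\<And>x y x' y'. cinner (t x y) (t x' y') = cinner x x' * cinner y y'"
    and e: "onb_on I e" and h: "onb_on J h"
    and th: "onb_on (I \<times> J) (\<lambda>(i, j). t (e i) (h j))"
    and A: "bounded_op A"
  shows "\<exists>!T. bounded_op T \<and> (\<forall>f g. T (t f g) = t (A f) g)"
proof (rule ex_ex1I)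
  show "T = T'" if "bounded_op T \<and> (\<forall>f g. T (t f g) = t (A f) g)"
    "bounded_op T' \<and> (\<forall>f g. T' (t f g) = t (A f) g)" for T T'
    using that by (intro bounded_op_eqI[OF th]) auto
  have norm_t: "norm (t x y) = norm x * norm y" for x y
  proof -
    have "of_real ((norm (t x y))\<^sup>2) = complex_of_real ((norm x * norm y)\<^sup>2)"
      unfolding cinner_self[symmetric] cinner_t by (simp add: cinner_self power_mult_distrib)
    then show ?thesis by (simp only: of_real_eq_iff power2_eq_iff_nonneg norm_ge_zero mult_nonneg_nonneg)
  qed
  have bl_t: "bounded_linear (t x)" for x
    by (rule bounded_linear_intro[of _ "norm x"])
      (auto simp: add_right scale_right scaleR_scaleC norm_t mult.commute)
  have E: "orthonormal_on I e" "orthonormal_on J h" using e h by (auto simp: onb_on_def)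
  text \<open>\<open>P j\<close> is the adjoint of \<open>f \<mapsto> t f (h j)\<close>, and \<open>T x\<close> is \<open>\<Sum>j. t (A (P j x)) (h j)\<close>.\<close>
  define P where "P j x = (\<Sum>\<^sub>\<infinity>i\<in>I. cinner (t (e i) (h j)) x *\<^sub>C e i)" for j x
  \<comment> \<open>With the index of the untouched factor outermost, the coefficients of
    \<open>x\<close> are grouped into the slices \<open>P j x\<close>.\<close>
  have sum2: "((\<lambda>(j, i). (cmod (cinner (t (e i) (h j)) x))\<^sup>2) has_sum (norm x)\<^sup>2) (J \<times> I)" for x
    using parseval_norm[OF th, of x] by (subst has_sum_swap) (simp add: case_prod_unfold)
  have sum1: "(\<lambda>i. (cmod (cinner (t (e i) (h j)) x))\<^sup>2) summable_on I" if "j \<in> J" for j x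
    by (rule summable_on_SigmaD1[of _ J "\<lambda>_. I"]) (use sum2 that in \<open>auto simp: summable_on_def\<close>)
  have coeff: "cinner (e i) (P j x) = cinner (t (e i) (h j)) x" if "i \<in> I" "j \<in> J" for i j x
    unfolding P_def by (rule riesz_fischer(2)[OF E(1) sum1[OF that(2)] that(1)])
  have normP: "((\<lambda>j. (norm (P j x))\<^sup>2) has_sum (norm x)\<^sup>2) J" for x
  proof (rule has_sum_SigmaD[OF sum2])
    fix j assume j: "j \<in> J"
    have "((\<lambda>i. (cmod (cinner (e i) (P j x)))\<^sup>2) has_sum (norm (P j x))\<^sup>2) I"
      by (rule parseval_norm[OF e])
    then show "((\<lambda>i. case (j, i) of (j, i) \<Rightarrow> (cmod (cinner (t (e i) (h j)) x))\<^sup>2) has_sum (norm (P j x))\<^sup>2) I"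
      by (rule has_sum_cong[THEN iffD1, rotated]) (simp add: coeff j)
  qed
  have P_add: "P j (x + y) = P j x + P j y" if "j \<in> J" for j x y
    by (rule onb_on_eqI[OF e]) (simp add: coeff that cinner_add_right)
  have P_scale: "P j (c *\<^sub>C x) = c *\<^sub>C P j x" if "j \<in> J" for j c x
    by (rule onb_on_eqI[OF e]) (simp add: coeff that cinner_scaleC_right)
  have P_t: "P j (t f g) = cinner (h j) g *\<^sub>C f" if "j \<in> J" for j f g
    by (rule onb_on_eqI[OF e]) (simp add: coeff that cinner_scaleC_right cinner_t mult.commute)
  obtain K where K: "\<And>x. norm (A x) \<le> norm x * K" "0 \<le> K"
    using A bounded_linear.nonneg_bounded unfolding bounded_op_def by blast
  define T where "T x = (\<Sum>\<^sub>\<infinity>j\<in>J. t (A (P j x)) (h j))" for x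
  have nh: "norm (h j) = 1" if "j \<in> J" for j
  proof -
    have "cinner (h j) (h j) = 1" using that by (auto simp: orthonormal_onD[OF E(2)])
    then show ?thesis by (simp add: norm_eq_1 inner_cinner)
  qed
  \<comment> \<open>Boundedness of \<open>T\<close> comes from here: pieces with different
    \<open>j\<close> are mutually orthogonal, so a bound by \<open>K\<close> on each slice sums to
    the same bound on \<open>x\<close>.\<close>
  have le: "(norm (t (A (P j x)) (h j)))\<^sup>2 \<le> K\<^sup>2 * (norm (P j x))\<^sup>2" if "j \<in> J" for j x
    using power_mono[OF K(1)[of "P j x"], of 2] by (simp add: norm_t nh that power_mult_distrib mult.commute)
  have KP: "((\<lambda>j. K\<^sup>2 * (norm (P j x))\<^sup>2) has_sum K\<^sup>2 * (norm x)\<^sup>2) J" for x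
    by (rule has_sum_cmult_right[OF normP])
  have s2: "(\<lambda>j. (norm (t (A (P j x)) (h j)))\<^sup>2) summable_on J" for x
    by (rule summable_on_comparison_test[OF has_sum_imp_summable[OF KP]]) (use le in auto)
  have orth: "cinner (t (A (P i x)) (h i)) (t (A (P j x)) (h j)) = 0" if "i \<in> J" "j \<in> J" "i \<noteq> j" for i j x
    using that by (simp add: cinner_t orthonormal_onD[OF E(2)])
  note s1 = summable_on_orthogonal[OF orth has_sum_infsum[OF s2]]
  have "bounded_op T" unfolding bounded_op_def
  proof safe
    show scale: "T (c *\<^sub>C x) = c *\<^sub>C T x" for c x
    proof -
      have "((\<lambda>j. c *\<^sub>C t (A (P j x)) (h j)) has_sum c *\<^sub>C T x) J"
        unfolding T_def by (intro has_sum_bounded_linear[OF bounded_linear_scaleC] has_sum_infsum s1(1))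
      then have "((\<lambda>j. t (A (P j (c *\<^sub>C x))) (h j)) has_sum c *\<^sub>C T x) J"
        by (rule has_sum_cong[THEN iffD1, rotated]) (simp add: P_scale scale_left bounded_op_scaleC[OF A])
      then show ?thesis unfolding T_def by (rule infsumI)
    qed
    show "bounded_linear T"
    proof (rule bounded_linear_intro[of _ K])
      show "T (r *\<^sub>R x) = r *\<^sub>R T x" for r x by (simp add: scaleR_scaleC scale)
      show "T (x + y) = T x + T y" for x y
      proof -
        have "((\<lambda>j. t (A (P j x)) (h j) + t (A (P j y)) (h j)) has_sum T x + T y) J"
          unfolding T_def by (intro has_sum_add has_sum_infsum s1(1))
        then have "((\<lambda>j. t (A (P j (x + y))) (h j)) has_sum T x + T y) J"
          by (rule has_sum_cong[THEN iffD1, rotated]) (simp add: P_add add_left bounded_op_add[OF A])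
        then show ?thesis unfolding T_def by (rule infsumI)
      qed
      show "norm (T x) \<le> norm x * K" for x
      proof (rule power2_le_imp_le)
        have "(norm (T x))\<^sup>2 = (\<Sum>\<^sub>\<infinity>j\<in>J. (norm (t (A (P j x)) (h j)))\<^sup>2)"
          unfolding T_def by (rule s1(2))
        also have "\<dots> \<le> K\<^sup>2 * (norm x)\<^sup>2"
          by (rule has_sum_mono[OF has_sum_infsum[OF s2] KP le])
        finally show "(norm (T x))\<^sup>2 \<le> (norm x * K)\<^sup>2" by (simp add: power_mult_distrib mult.commute)
      qed (use K in simp)
    qed
  qed
  moreover have "T (t f g) = t (A f) g" for f g
  proof -
    \<comment> \<open>For a product vector the slices are multiples of \<open>f\<close>, and the
      series defining \<open>T\<close> becomes the expansion of \<open>g\<close> in the basis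
      \<open>h\<close>.\<close>
    have "((\<lambda>j. t (A f) (cinner (h j) g *\<^sub>C h j)) has_sum t (A f) g) J"
      by (rule has_sum_bounded_linear[OF bl_t onb_on_expansion[OF h]])
    then have "((\<lambda>j. t (A (P j (t f g))) (h j)) has_sum t (A f) g) J"
      by (rule has_sum_cong[THEN iffD1, rotated]) (simp add: P_t scale_left scale_right bounded_op_scaleC[OF A])
    then show ?thesis unfolding T_def by (rule infsumI)
  qed
  ultimately show "\<exists>T. bounded_op T \<and> (\<forall>f g. T (t f g) = t (A f) g)" by blast
qed


section \<open>The space \<open>L\<^sup>2\<close>\<close>

lemma rep_L2:
  obtains f where "square_integrable f" "x = abs_L2 f"
proof -
  have "L2_rel (rep_L2 x) (rep_L2 x)" "abs_L2 (rep_L2 x) = x"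
    using Quotient3_L2 by (auto simp: Quotient3_def)
  then show ?thesis using that[of "rep_L2 x"] by (simp add: L2_rel_def)
qed

lemma abs_L2_eq_iff:
  assumes "square_integrable f" "square_integrable g"
  shows "abs_L2 f = abs_L2 g \<longleftrightarrow> (AE x in lborel. f x = g x)"
proof -
  have "L2_rel f f" "L2_rel g g" using assms by (auto simp: L2_rel_def)
  then have "abs_L2 f = abs_L2 g \<longleftrightarrow> L2_rel f g"
    using Quotient3_rel[OF Quotient3_L2] by metis
  then show ?thesis using assms by (simp add: L2_rel_def)
qed

lemma cinner_abs_L2:
  "square_integrable f \<Longrightarrow> square_integrable g \<Longrightarrow>
    cinner (abs_L2 f) (abs_L2 g) = (LINT x|lborel. cnj (f x) * g x)"
  by (rule cinner_L2.abs_eq) (auto simp: L2_rel_def)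

lemma abs_L2_add:
  "square_integrable f \<Longrightarrow> square_integrable g \<Longrightarrow> abs_L2 f + abs_L2 g = abs_L2 (\<lambda>x. f x + g x)"
  by (rule plus_L2.abs_eq) (auto simp: L2_rel_def)

lemma abs_L2_scaleC: "square_integrable f \<Longrightarrow> c *\<^sub>C abs_L2 f = abs_L2 (\<lambda>x. c * f x)"
  by (rule scaleC_L2.abs_eq) (auto simp: L2_rel_def)

lemma abs_L2_zero: "0 = abs_L2 (\<lambda>_. 0)"
  by (simp add: zero_L2_def)

lemma abs_L2_diff:
  assumes "square_integrable f" "square_integrable g"
  shows "abs_L2 f - abs_L2 g = abs_L2 (\<lambda>x. f x - g x)"
proof -
  have "- abs_L2 g = (-1 :: real) *\<^sub>R abs_L2 g" by simp
  also have "\<dots> = abs_L2 (\<lambda>x. - g x)" using assms by (simp only: scaleR_scaleC abs_L2_scaleC) simp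
  finally have "abs_L2 f - abs_L2 g = abs_L2 f + abs_L2 (\<lambda>x. - g x)" by simp
  then show ?thesis using assms by (simp add: abs_L2_add square_integrable_minus)
qed

lemma square_integrable_diff:
  "square_integrable f \<Longrightarrow> square_integrable g \<Longrightarrow> square_integrable (\<lambda>x. f x - g x)"
  using square_integrable_add[OF _ square_integrable_minus, of f g] by simp

lemma square_integrable_iff_nn:
  "square_integrable f \<longleftrightarrow> f \<in> borel_measurable borel \<and> (\<integral>\<^sup>+ x. ennreal ((cmod (f x))\<^sup>2) \<partial>lborel) < \<infinity>"
  unfolding square_integrable_def by (auto simp: integrable_iff_bounded)

lemma norm_abs_L2:
  assumes f: "square_integrable f"
  shows "ennreal ((norm (abs_L2 f))\<^sup>2) = (\<integral>\<^sup>+ x. ennreal ((cmod (f x))\<^sup>2) \<partial>lborel)"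
proof -
  have "of_real ((norm (abs_L2 f))\<^sup>2) = (LINT x|lborel. cnj (f x) * f x)"
    unfolding cinner_self[symmetric] by (rule cinner_abs_L2[OF f f])
  also have "\<dots> = (LINT x|lborel. complex_of_real ((cmod (f x))\<^sup>2))"
    by (rule Bochner_Integration.integral_cong) (auto simp: complex_norm_square mult.commute simp del: of_real_power)
  also have "\<dots> = of_real (LINT x|lborel. (cmod (f x))\<^sup>2)" by (rule integral_complex_of_real)
  finally have "(norm (abs_L2 f))\<^sup>2 = (LINT x|lborel. (cmod (f x))\<^sup>2)" by (simp only: of_real_eq_iff)
  then show ?thesis using f by (simp add: nn_integral_eq_integral square_integrable_def)
qed


subsection \<open>Completeness\<close>

text \<open>The increments have summable norms, so their moduli sum to a function that is finite
  almost everywhere. Hence the sequence converges pointwise almost everywhere, and Fatou's lemma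
  bounds the distance to the limit.\<close>

lemma L2_rapid_convergence:
  fixes F :: "nat \<Rightarrow> 'a::euclidean_space \<Rightarrow> complex"
  assumes F: "\<And>k. square_integrable (F k)"
    and le: "\<And>k. norm (abs_L2 (F (Suc k)) - abs_L2 (F k)) \<le> (1/2) ^ k"
  obtains g where "square_integrable g" "\<And>k. norm (abs_L2 g - abs_L2 (F k)) \<le> 2 * (1/2) ^ k"
proof -
  note [measurable] = square_integrable_measurable[OF F]
  define d where "d k x = cmod (F (Suc k) x - F k x)" for k x
  have [measurable]: "d k \<in> borel_measurable borel" for k unfolding d_def by measurable
  \<comment> \<open>The moduli are regarded as complex functions so that the triangle inequality of
    \<open>L2\<close> applies to their sums.\<close>
  have sd: "square_integrable (\<lambda>x. complex_of_real (d k x))" for k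
    using square_integrable_diff[OF F F, of "Suc k" k] unfolding square_integrable_def d_def by simp
  have nd: "norm (abs_L2 (\<lambda>x. complex_of_real (d k x))) \<le> (1/2) ^ k" for k
  proof -
    have "ennreal ((norm (abs_L2 (\<lambda>x. complex_of_real (d k x))))\<^sup>2) =
        ennreal ((norm (abs_L2 (F (Suc k)) - abs_L2 (F k)))\<^sup>2)"
      using F by (simp add: abs_L2_diff norm_abs_L2 sd square_integrable_diff) (simp add: d_def)
    then show ?thesis using le[of k] by (simp add: power2_eq_iff_nonneg)
  qed
  have part: "square_integrable (\<lambda>x. complex_of_real (\<Sum>k<n. d k x)) \<and>
      norm (abs_L2 (\<lambda>x. complex_of_real (\<Sum>k<n. d k x))) \<le> (\<Sum>k<n. (1/2) ^ k)" for n
  proof (induction n)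
    case (Suc n)
    then show ?case
      using sd[of n] nd[of n] norm_triangle_ineq[of "abs_L2 (\<lambda>x. complex_of_real (\<Sum>k<n. d k x))" "abs_L2 (\<lambda>x. complex_of_real (d n x))"]
      by (auto simp: abs_L2_add square_integrable_add simp del: of_real_sum)
  qed (simp add: abs_L2_zero[symmetric])
  have geo: "(\<Sum>k<n. (1/2::real) ^ k) \<le> 2" for n
    by (simp add: geometric_sum)
  \<comment> \<open>Monotone convergence: all partial sums have norm at most 2, the value of the
    geometric series, hence squared norm at most 4.\<close>
  have sup: "(\<integral>\<^sup>+ x. (SUP n. ennreal ((\<Sum>k<n. d k x)\<^sup>2)) \<partial>lborel) \<le> 4"
  proof (subst nn_integral_monotone_convergence_SUP)
    show "incseq (\<lambda>n x. ennreal ((\<Sum>k<n. d k x)\<^sup>2))"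
      by (intro incseq_SucI le_funI ennreal_leI power_mono) (auto simp: d_def intro!: sum_nonneg)
    show "(SUP n. \<integral>\<^sup>+ x. ennreal ((\<Sum>k<n. d k x)\<^sup>2) \<partial>lborel) \<le> 4"
    proof (rule SUP_least)
      fix n
      have "(\<integral>\<^sup>+ x. ennreal ((\<Sum>k<n. d k x)\<^sup>2) \<partial>lborel) =
          ennreal ((norm (abs_L2 (\<lambda>x. complex_of_real (\<Sum>k<n. d k x))))\<^sup>2)"
        using part[of n] by (subst norm_abs_L2) (auto simp del: of_real_sum)
      also have "\<dots> \<le> ennreal (2\<^sup>2)"
        using part[of n] geo[of n] by (intro ennreal_leI power_mono) auto
      finally show "(\<integral>\<^sup>+ x. ennreal ((\<Sum>k<n. d k x)\<^sup>2) \<partial>lborel) \<le> 4" by simp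
    qed
  qed auto
  have "AE x in lborel. (SUP n. ennreal ((\<Sum>k<n. d k x)\<^sup>2)) \<noteq> \<infinity>"
    by (rule nn_integral_noteq_infinite) (use sup in \<open>auto simp: top_unique\<close>)
  then have conv: "AE x in lborel. convergent (\<lambda>n. F n x)"
  proof eventually_elim
    case (elim x)
    then obtain B where B: "(SUP n. ennreal ((\<Sum>k<n. d k x)\<^sup>2)) = ennreal B" "0 \<le> B"
      by (cases "SUP n. ennreal ((\<Sum>k<n. d k x)\<^sup>2)") auto
    have "(\<Sum>k<n. d k x)\<^sup>2 \<le> B" for n
    proof -
      have "ennreal ((\<Sum>k<n. d k x)\<^sup>2) \<le> ennreal B" unfolding B(1)[symmetric] by (rule SUP_upper) simp
      then show ?thesis using B(2) by simp
    qed
    then have "(\<Sum>k<n. d k x) \<le> sqrt B" for n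
      by (rule real_le_rsqrt)
    then have "summable (\<lambda>k. d k x)"
      by (intro summableI_nonneg_bounded[of _ "sqrt B"]) (auto simp: d_def)
    then have "summable (\<lambda>k. F (Suc k) x - F k x)" unfolding d_def by (rule summable_norm_cancel)
    then have "convergent (\<lambda>n. \<Sum>k<n. F (Suc k) x - F k x)" by (simp add: summable_iff_convergent)
    then have "convergent (\<lambda>n. F n x - F 0 x)" by (simp only: sum_lessThan_telescope[of "\<lambda>k. F k x"])
    then have "convergent (\<lambda>n. (F n x - F 0 x) + F 0 x)" by (intro convergent_add convergent_const)
    then show ?case by simp
  qed
  define g where "g x = lim (\<lambda>n. F n x)" for x
  have [measurable]: "g \<in> borel_measurable borel" unfolding g_def by (rule borel_measurable_lim_metric) measurable
  have dist: "norm (abs_L2 (F (k + m)) - abs_L2 (F k)) \<le> 2 * (1/2) ^ k" for k m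
  proof -
    have "norm (abs_L2 (F (k + m)) - abs_L2 (F k)) \<le> (\<Sum>i<m. (1/2) ^ (k + i))"
    proof (induction m)
      case (Suc m)
      have "norm (abs_L2 (F (k + Suc m)) - abs_L2 (F k)) \<le>
          norm (abs_L2 (F (k + Suc m)) - abs_L2 (F (k + m))) + norm (abs_L2 (F (k + m)) - abs_L2 (F k))"
        using norm_triangle_ineq[of "abs_L2 (F (k + Suc m)) - abs_L2 (F (k + m))" "abs_L2 (F (k + m)) - abs_L2 (F k)"]
        by simp
      also have "\<dots> \<le> (1/2) ^ (k + m) + (\<Sum>i<m. (1/2) ^ (k + i))"
        using Suc le[of "k + m"] by (intro add_mono) auto
      finally show ?case by (simp only: sum.lessThan_Suc add.commute)
    qed simp
    also have "\<dots> = (1/2) ^ k * (\<Sum>i<m. (1/2) ^ i)" by (simp add: power_add sum_distrib_left)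
    also have "\<dots> \<le> (1/2) ^ k * 2" by (intro mult_left_mono geo) simp
    finally show ?thesis by simp
  qed
  \<comment> \<open>Almost everywhere the integrand is the limit of the corresponding differences
    with \<open>F (k + m)\<close>, whose norms are bounded uniformly in \<open>m\<close>.\<close>
  have fatou: "(\<integral>\<^sup>+ x. ennreal ((cmod (g x - F k x))\<^sup>2) \<partial>lborel) \<le> ennreal ((2 * (1/2) ^ k)\<^sup>2)" for k
  proof -
    have "(\<integral>\<^sup>+ x. ennreal ((cmod (g x - F k x))\<^sup>2) \<partial>lborel) =
        (\<integral>\<^sup>+ x. liminf (\<lambda>m. ennreal ((cmod (F (k + m) x - F k x))\<^sup>2)) \<partial>lborel)"
    proof (rule nn_integral_cong_AE, use conv in eventually_elim)
      fix x assume "convergent (\<lambda>n. F n x)"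
      then have "(\<lambda>n. F n x) \<longlonglongrightarrow> g x" by (simp add: g_def convergent_LIMSEQ_iff)
      then have "(\<lambda>m. F (k + m) x) \<longlonglongrightarrow> g x"
        using LIMSEQ_ignore_initial_segment[of _ _ k] by (simp add: add.commute)
      then have "(\<lambda>m. ennreal ((cmod (F (k + m) x - F k x))\<^sup>2)) \<longlonglongrightarrow> ennreal ((cmod (g x - F k x))\<^sup>2)"
        by (intro tendsto_intros tendsto_ennrealI)
      then show "ennreal ((cmod (g x - F k x))\<^sup>2) = liminf (\<lambda>m. ennreal ((cmod (F (k + m) x - F k x))\<^sup>2))"
        by (rule lim_imp_Liminf[OF trivial_limit_sequentially, symmetric])
    qed
    also have "\<dots> \<le> liminf (\<lambda>m. \<integral>\<^sup>+ x. ennreal ((cmod (F (k + m) x - F k x))\<^sup>2) \<partial>lborel)"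
      by (rule nn_integral_liminf) simp
    also have "\<dots> \<le> liminf (\<lambda>m. ennreal ((2 * (1/2) ^ k)\<^sup>2))"
    proof (rule Liminf_mono, rule always_eventually, rule allI)
      fix m
      have "(\<integral>\<^sup>+ x. ennreal ((cmod (F (k + m) x - F k x))\<^sup>2) \<partial>lborel) =
          ennreal ((norm (abs_L2 (F (k + m)) - abs_L2 (F k)))\<^sup>2)"
        using F by (simp add: abs_L2_diff norm_abs_L2 square_integrable_diff)
      also have "\<dots> \<le> ennreal ((2 * (1/2) ^ k)\<^sup>2)"
        by (intro ennreal_leI power_mono dist) simp
      finally show "(\<integral>\<^sup>+ x. ennreal ((cmod (F (k + m) x - F k x))\<^sup>2) \<partial>lborel) \<le> ennreal ((2 * (1/2) ^ k)\<^sup>2)" .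
    qed
    finally show ?thesis by (simp add: Liminf_const)
  qed
  have sg: "square_integrable (\<lambda>x. g x - F k x)" for k
    unfolding square_integrable_iff_nn using fatou[of k] by (auto simp: less_top[symmetric] top_unique)
  then have g: "square_integrable g"
    using square_integrable_add[OF sg F, of 0 0] by simp
  moreover have "norm (abs_L2 g - abs_L2 (F k)) \<le> 2 * (1/2) ^ k" for k
  proof (rule power2_le_imp_le)
    have "ennreal ((norm (abs_L2 g - abs_L2 (F k)))\<^sup>2) \<le> ennreal ((2 * (1/2) ^ k)\<^sup>2)"
      using fatou[of k] F g sg by (simp add: abs_L2_diff norm_abs_L2)
    then show "(norm (abs_L2 g - abs_L2 (F k)))\<^sup>2 \<le> (2 * (1/2) ^ k)\<^sup>2" by (subst (asm) ennreal_le_iff) auto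
  qed simp
  ultimately show thesis by (rule that)
qed

instance L2 :: (euclidean_space) banach
proof
  fix X :: "nat \<Rightarrow> 'a L2" assume "Cauchy X"
  then have "\<exists>N. \<forall>m\<ge>N. \<forall>n\<ge>N. dist (X m) (X n) < (1/2) ^ k" for k
    unfolding Cauchy_def by simp
  then obtain N where N: "\<And>k m n. N k \<le> m \<Longrightarrow> N k \<le> n \<Longrightarrow> dist (X m) (X n) < (1/2) ^ k" by metis
  \<comment> \<open>Partial sums of \<open>N\<close> make both \<open>r k\<close> and
    \<open>r (Suc k)\<close> at least \<open>N k\<close>, so consecutive terms of the subsequence
    lie within \<open>(1/2) ^ k\<close>.\<close>
  define r where "r k = (\<Sum>j\<le>k. N j)" for k
  have r: "N k \<le> r k" "N k \<le> r (Suc k)" for k by (auto simp: r_def member_le_sum intro!: trans_le_add1)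
  obtain F where F: "\<And>k. square_integrable (F k)" "\<And>k. X (r k) = abs_L2 (F k)"
  proof -
    have "\<forall>k. \<exists>f. square_integrable f \<and> X (r k) = abs_L2 f"
      by (intro allI, rule rep_L2) blast
    then show ?thesis using that by metis
  qed
  have "norm (abs_L2 (F (Suc k)) - abs_L2 (F k)) \<le> (1/2) ^ k" for k
    using N[OF r(2) r(1), of k] by (simp add: F(2)[symmetric] dist_norm less_imp_le)
  then obtain g where g: "\<And>k. norm (abs_L2 g - abs_L2 (F k)) \<le> 2 * (1/2) ^ k"
    using L2_rapid_convergence[where F = F, OF F(1)] by blast
  have "X \<longlonglongrightarrow> abs_L2 g"
  proof (rule metric_LIMSEQ_I)
    fix e :: real assume "0 < e"
    then obtain k where k: "(1/2) ^ k < e / 3"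
      using real_arch_pow_inv[of "e / 3" "1/2"] by auto
    have "dist (X n) (abs_L2 g) < e" if "N k \<le> n" for n
    proof -
      have "dist (X n) (abs_L2 g) \<le> dist (X n) (X (r k)) + dist (abs_L2 g) (abs_L2 (F k))"
        using dist_triangle2[of "X n" "abs_L2 g" "X (r k)"] by (simp add: F(2))
      also have "\<dots> < (1/2) ^ k + 2 * (1/2) ^ k"
        using N[OF that r(1)] g[of k] by (simp add: dist_norm)
      finally show ?thesis using k by simp
    qed
    then show "\<exists>no. \<forall>n\<ge>no. dist (X n) (abs_L2 g) < e" by blast
  qed
  then show "convergent X" by (auto simp: convergent_def)
qed


section \<open>The Hermite basis of \<open>L\<^sup>2(\<real>)\<close>\<close>

subsection \<open>Injectivity of the Fourier transform\<close>

text \<open>The positive and negative parts of \<open>k\<close> have equal Fourier transforms.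
  Normalized, they are densities of probability measures with the same characteristic function, and
  Levy's uniqueness theorem identifies them.\<close>

lemma fourier_injective_real:
  fixes k :: "real \<Rightarrow> real"
  assumes k: "integrable lborel k" and F: "\<And>t. (LINT x|lborel. iexp (t * x) * of_real (k x)) = 0"
  shows "AE x in lborel. k x = 0"
proof -
  note [measurable] = borel_measurable_integrable[OF k]
  define p q where "p x = max (k x) 0" and "q x = max (- k x) 0" for x
  have int: "integrable lborel p" "integrable lborel q" unfolding p_def q_def using k by auto
  note [measurable] = borel_measurable_integrable[OF int(1)] borel_measurable_integrable[OF int(2)]
  have kpq: "k x = p x - q x" "0 \<le> p x" "0 \<le> q x" for x by (auto simp: p_def q_def)
  have ie: "integrable lborel (\<lambda>x. iexp (t * x) * of_real (f x))" if "integrable lborel f" for f t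
    by (rule Bochner_Integration.integrable_bound[OF that]) (use that in \<open>auto simp: norm_mult\<close>)
  have eq: "(LINT x|lborel. iexp (t * x) * of_real (p x)) = (LINT x|lborel. iexp (t * x) * of_real (q x))" for t
    using F[of t] Bochner_Integration.integral_diff[OF ie[OF int(1)] ie[OF int(2)], of t t]
    by (simp add: kpq(1) right_diff_distrib)
  define m where "m = (LINT x|lborel. p x)"
  \<comment> \<open>The value of the transform at 0 is the total mass, so one constant normalizes
    both parts.\<close>
  have mq: "m = (LINT x|lborel. q x)" using eq[of 0] by (simp add: m_def)
  have "0 \<le> m" unfolding m_def using kpq by simp
  show ?thesis
  proof (cases "m = 0")
    case True
    have "AE x in lborel. p x = 0" "AE x in lborel. q x = 0"
      using True mq int kpq integral_nonneg_eq_0_iff_AE[of lborel p] integral_nonneg_eq_0_iff_AE[of lborel q]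
      by (auto simp: m_def)
    then show ?thesis by eventually_elim (simp add: kpq)
  next
    case False
    with \<open>0 \<le> m\<close> have m: "0 < m" by simp
    have rd: "real_distribution (density lborel (\<lambda>x. ennreal (f x / m)))"
      if f: "integrable lborel f" "\<And>x. 0 \<le> f x" "(LINT x|lborel. f x) = m" for f
    proof -
      have [measurable]: "f \<in> borel_measurable borel" using f(1) by auto
      have "(\<integral>\<^sup>+ x. ennreal (f x / m) \<partial>lborel) = ennreal (LINT x|lborel. f x / m)"
        using f m by (intro nn_integral_eq_integral) auto
      then have "prob_space (density lborel (\<lambda>x. ennreal (f x / m)))"
        using f m by (intro prob_spaceI) (simp add: emeasure_density)
      then show ?thesis by (intro real_distribution.intro real_distribution_axioms.intro) auto
    qed
    have ch: "char (density lborel (\<lambda>x. ennreal (f x / m))) t = (LINT x|lborel. iexp (t * x) * of_real (f x)) / m"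
      if f: "integrable lborel f" "\<And>x. 0 \<le> f x" for f t
    proof -
      have [measurable]: "f \<in> borel_measurable borel" using f(1) by auto
      have "char (density lborel (\<lambda>x. ennreal (f x / m))) t = (LINT x|lborel. (f x / m) *\<^sub>R iexp (t * x))"
        unfolding char_def using f m by (subst integral_density) auto
      also have "\<dots> = (LINT x|lborel. iexp (t * x) * of_real (f x) / m)"
        by (rule Bochner_Integration.integral_cong) (auto simp: scaleR_conv_of_real)
      finally show ?thesis by simp
    qed
    have "char (density lborel (\<lambda>x. ennreal (p x / m))) = char (density lborel (\<lambda>x. ennreal (q x / m)))"
      by (rule ext) (simp only: ch[OF int(1) kpq(2)] ch[OF int(2) kpq(3)] eq)
    then have "density lborel (\<lambda>x. ennreal (p x / m)) = density lborel (\<lambda>x. ennreal (q x / m))"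
      using kpq int mq by (intro Levy_uniqueness rd) (auto simp: m_def)
    then have "AE x in lborel. ennreal (p x / m) = ennreal (q x / m)"
      by (rule sigma_finite_measure.density_unique_iff[OF sigma_finite_lborel, THEN iffD1, rotated 2]) auto
    then show ?thesis
      by eventually_elim (use m kpq in auto)
  qed
qed

text \<open>Conjugating the transform replaces \<open>t\<close> by \<open>- t\<close>, so the
  conjugate of \<open>h\<close> has zero transform as well, and therefore so do the real and
  imaginary parts.\<close>

lemma fourier_injective:
  fixes h :: "real \<Rightarrow> complex"
  assumes h: "integrable lborel h" and F: "\<And>t. (LINT x|lborel. iexp (t * x) * h x) = 0"
  shows "AE x in lborel. h x = 0"
proof -
  note [measurable] = borel_measurable_integrable[OF h]
  have ie: "integrable lborel (\<lambda>x. iexp (t * x) * f x)" if "integrable lborel f" for f :: "real \<Rightarrow> complex" and t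
    by (rule Bochner_Integration.integrable_bound[OF that]) (use that in \<open>auto simp: norm_mult\<close>)
  have F': "(LINT x|lborel. iexp (t * x) * cnj (h x)) = 0" for t
  proof -
    have "(LINT x|lborel. iexp (t * x) * cnj (h x)) = (LINT x|lborel. cnj (iexp ((- t) * x) * h x))"
      by (rule Bochner_Integration.integral_cong) (auto simp: exp_cnj)
    then show ?thesis using F[of "- t"] by (simp only: Bochner_Integration.integral_cnj) simp
  qed
  have "AE x in lborel. Re (h x) = 0"
  proof (rule fourier_injective_real)
    show "(LINT x|lborel. iexp (t * x) * of_real (Re (h x))) = 0" for t
    proof -
      have "complex_of_real (Re z) = (1/2) * (z + cnj z)" for z by (simp add: complex_add_cnj)
      then have "(LINT x|lborel. iexp (t * x) * of_real (Re (h x))) =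
          (LINT x|lborel. (1/2) * (iexp (t * x) * h x + iexp (t * x) * cnj (h x)))"
        by (simp only: distrib_left mult.left_commute)
      also have "\<dots> = (1/2) * ((LINT x|lborel. iexp (t * x) * h x) + (LINT x|lborel. iexp (t * x) * cnj (h x)))"
        using ie[OF h, of t] ie[of "\<lambda>x. cnj (h x)" t] h by simp
      finally show ?thesis by (simp only: F F') simp
    qed
  qed (use h in auto)
  moreover have "AE x in lborel. Im (h x) = 0"
  proof (rule fourier_injective_real)
    show "(LINT x|lborel. iexp (t * x) * of_real (Im (h x))) = 0" for t
    proof -
      have "complex_of_real (Im z) = (- \<i>/2) * (z - cnj z)" for z by (auto simp: complex_eq_iff)
      then have "(LINT x|lborel. iexp (t * x) * of_real (Im (h x))) =
          (LINT x|lborel. (- \<i>/2) * (iexp (t * x) * h x - iexp (t * x) * cnj (h x)))"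
        by (simp only: right_diff_distrib mult.left_commute)
      also have "\<dots> = (- \<i>/2) * ((LINT x|lborel. iexp (t * x) * h x) - (LINT x|lborel. iexp (t * x) * cnj (h x)))"
        using ie[OF h, of t] ie[of "\<lambda>x. cnj (h x)" t] h by simp
      finally show ?thesis by (simp only: F F') simp
    qed
  qed (use h in auto)
  ultimately show ?thesis by eventually_elim (simp add: complex_eq_iff)
qed


subsection \<open>Hermite functions\<close>

text \<open>Integrability takes the place of boundary values at infinity: the fundamental theorem on
  the intervals [x, x+1] is integrated over all \<open>x\<close>. By Fubini the side with
  \<open>f\<close> gives the full integral, and by translation invariance the side with
  \<open>F\<close> gives 0.\<close>

lemma integral_derivative_eq_0:
  fixes F f :: "real \<Rightarrow> complex"
  assumes deriv: "\<And>x. (F has_vector_derivative f x) (at x)" and cont: "continuous_on UNIV f"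
    and F: "integrable lborel F" and f: "integrable lborel f"
  shows "(LINT x|lborel. f x) = 0"
proof -
  define c where "c = (LINT x|lborel. f x)"
  have [measurable]: "f \<in> borel_measurable borel" using f by auto
  have ftc: "(LINT s|lborel. indicator {0..1} s *\<^sub>R f (s + x)) = F (1 + x) - F x" for x
  proof -
    have "(LINT s|lborel. indicator {0..1} s *\<^sub>R f (s + x)) = F (1 + x) - F (0 + x)"
    proof (rule integral_FTC_atLeastAtMost)
      show "((\<lambda>s. F (s + x)) has_vector_derivative f (s + x)) (at s within {0..1})" for s
      proof -
        have "((\<lambda>s. s + x) has_real_derivative 1) (at s)" by (auto intro!: derivative_eq_intros)
        then have "((\<lambda>s. s + x) has_vector_derivative 1) (at s)"
          by (simp only: has_real_derivative_iff_has_vector_derivative)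
        from vector_diff_chain_at[OF this deriv[of "s + x"]]
        have "((\<lambda>s. F (s + x)) has_vector_derivative f (s + x)) (at s)" by (simp add: o_def)
        then show ?thesis by (rule has_vector_derivative_at_within)
      qed
      show "continuous_on {0..1} (\<lambda>s. f (s + x))"
        by (rule continuous_on_compose2[OF cont]) (auto intro!: continuous_intros)
    qed simp
    then show ?thesis by simp
  qed
  have shift: "integrable lborel (\<lambda>x. g (s + x))" "(LINT x|lborel. g (s + x)) = (LINT x|lborel. g x)"
    if "integrable lborel g" for g :: "real \<Rightarrow> 'b::{banach,second_countable_topology}" and s
    using lborel_integrable_real_affine[OF that, of 1 s] lborel_integral_real_affine[of 1 g s] by simp_all
  have "integrable (lborel \<Otimes>\<^sub>M lborel) (case_prod (\<lambda>s x. indicator {0..1} s *\<^sub>R f (s + x)))"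
  proof (rule lborel_pair.Fubini_integrable)
    have "integrable lborel (\<lambda>s. indicator {0..1::real} s *\<^sub>R (LINT x|lborel. norm (f x)))"
      by (rule integrable_indicator) auto
    moreover have "(LINT x|lborel. norm (f (s + x))) = (LINT x|lborel. norm (f x))" for s
      using shift(2)[of "\<lambda>x. norm (f x)" s] f by simp
    ultimately show "integrable lborel (\<lambda>s. LINT x|lborel. norm (case (s, x) of (s, x) \<Rightarrow> indicator {0..1} s *\<^sub>R f (s + x)))"
      by simp
    show "AE s in lborel. integrable lborel (\<lambda>x. case (s, x) of (s, x) \<Rightarrow> indicator {0..1} s *\<^sub>R f (s + x))"
      using shift(1)[OF f] by simp
  qed simp
  then have "(LINT x|lborel. LINT s|lborel. indicator {0..1} s *\<^sub>R f (s + x)) =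
      (LINT s|lborel. LINT x|lborel. indicator {0..1} s *\<^sub>R f (s + x))"
    by (rule lborel_pair.Fubini_integral)
  also have "\<dots> = (LINT s|lborel. indicator {0..1::real} s *\<^sub>R c)"
    by (simp add: shift(2)[OF f] c_def)
  also have "\<dots> = c" by simp
  finally have "(LINT x|lborel. F (1 + x) - F x) = c" by (simp add: ftc)
  then show ?thesis using shift[OF F, of 1] F by (simp add: c_def)
qed

section \<open>Polynomials against a Gaussian weight and scaled Hermite polynomials\<close>

lemma integrable_poly_gaussian:
  fixes c :: real
  assumes c: "0 < c"
  shows "integrable lborel (\<lambda>x. poly p x * exp (- c * x\<^sup>2))"
proof -
  \<comment> \<open>The standard deviation for which the centred normal density is proportional to
    \<open>exp (- c * x^2)\<close>, so that monomials become normal moments.\<close>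
  define \<sigma> where "\<sigma> = 1 / sqrt (2 * c)"
  have \<sigma>: "0 < \<sigma>" "\<sigma>\<^sup>2 = 1 / (2 * c)" using c by (auto simp: \<sigma>_def power_divide)
  have mono: "integrable lborel (\<lambda>x. x ^ k * exp (- c * x\<^sup>2))" for k
  proof -
    have "integrable lborel (\<lambda>x. sqrt (2 * pi * \<sigma>\<^sup>2) * (normal_density 0 \<sigma> x * (x - 0) ^ k))"
      using integrable_normal_moment[OF \<sigma>(1), of 0 k] by (rule integrable_mult_right)
    moreover have "sqrt (2 * pi * \<sigma>\<^sup>2) * (normal_density 0 \<sigma> x * (x - 0) ^ k) = x ^ k * exp (- c * x\<^sup>2)" for x
      using \<sigma> c by (simp add: normal_density_def)
    ultimately show ?thesis by (simp only:)
  qed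
  have "integrable lborel (\<lambda>x. \<Sum>i\<le>degree p. coeff p i * (x ^ i * exp (- c * x\<^sup>2)))"
    by (intro Bochner_Integration.integrable_sum integrable_mult_right mono)
  then show ?thesis by (simp add: poly_altdef sum_distrib_right mult.assoc)
qed

text \<open>The weight is the square of the Gaussian factor in \<open>hermite_fun\<close>, so the
  value on a product of two polynomials is the inner product of the corresponding functions in
  \<open>L2\<close>.\<close>

definition gauss_int :: "real \<Rightarrow> real poly \<Rightarrow> real" where
  "gauss_int \<kappa> p = (LINT x|lborel. poly p x * exp (- x\<^sup>2 / \<kappa>))"

text \<open>Rodrigues-type recursion by the raising operator 2x - \<kappa> d/dx; \<kappa> = 1 gives
  the physicists' Hermite polynomials.\<close>

fun hermite :: "real \<Rightarrow> nat \<Rightarrow> real poly" where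
  "hermite \<kappa> 0 = 1"
| "hermite \<kappa> (Suc n) = [:0, 2:] * hermite \<kappa> n - smult \<kappa> (pderiv (hermite \<kappa> n))"

declare hermite.simps(2) [simp del]

context
  fixes \<kappa> :: real assumes \<kappa>: "0 < \<kappa>"
begin

lemma integrable_gauss_int: "integrable lborel (\<lambda>x. poly p x * exp (- x\<^sup>2 / \<kappa>))"
  using integrable_poly_gaussian[of "1 / \<kappa>" p] \<kappa> by simp

lemma gauss_int_add: "gauss_int \<kappa> (p + q) = gauss_int \<kappa> p + gauss_int \<kappa> q"
  using Bochner_Integration.integral_add[OF integrable_gauss_int[of p] integrable_gauss_int[of q]]
  by (simp add: gauss_int_def distrib_right)

lemma gauss_int_smult: "gauss_int \<kappa> (smult c p) = c * gauss_int \<kappa> p"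
  by (simp add: gauss_int_def mult.assoc)

lemma gauss_int_diff: "gauss_int \<kappa> (p - q) = gauss_int \<kappa> p - gauss_int \<kappa> q"
  using gauss_int_add[of p "smult (-1) q"] gauss_int_smult[of "-1" q] by simp

text \<open>Integration by parts against the Gaussian: \<open>q\<close> is the polynomial factor of
  the derivative of \<open>p\<close> times the weight, and such a derivative has integral
  zero.\<close>

lemma gauss_int_pderiv: "\<kappa> * gauss_int \<kappa> (pderiv p) = gauss_int \<kappa> ([:0, 2:] * p)"
proof -
  define q where "q = pderiv p - smult (1 / \<kappa>) ([:0, 2:] * p)"
  have "(LINT x|lborel. complex_of_real (poly q x * exp (- x\<^sup>2 / \<kappa>))) = 0"
  proof (rule integral_derivative_eq_0)
    show "integrable lborel (\<lambda>x. complex_of_real (poly q x * exp (- x\<^sup>2 / \<kappa>)))"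
      "integrable lborel (\<lambda>x. complex_of_real (poly p x * exp (- x\<^sup>2 / \<kappa>)))"
      using integrable_gauss_int[of q] integrable_gauss_int[of p] by (simp_all only: integrable_of_real)
    show "continuous_on UNIV (\<lambda>x. complex_of_real (poly q x * exp (- x\<^sup>2 / \<kappa>)))"
      by (intro continuous_intros) (use \<kappa> in auto)
    have "((\<lambda>x. poly p x * exp (- x\<^sup>2 / \<kappa>)) has_real_derivative (poly q x * exp (- x\<^sup>2 / \<kappa>))) (at x)" for x
      using \<kappa> by (auto intro!: derivative_eq_intros poly_DERIV simp: q_def field_simps)
    then show "((\<lambda>x. complex_of_real (poly p x * exp (- x\<^sup>2 / \<kappa>))) has_vector_derivative
        complex_of_real (poly q x * exp (- x\<^sup>2 / \<kappa>))) (at x)" for x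
      by (intro has_vector_derivative_of_real) (simp add: has_real_derivative_iff_has_vector_derivative)
  qed
  then have "gauss_int \<kappa> q = 0" unfolding gauss_int_def by (simp only: integral_complex_of_real of_real_eq_0_iff)
  then show ?thesis unfolding q_def gauss_int_diff gauss_int_smult using \<kappa> by (simp add: field_simps)
qed

text \<open>The two facts feed each other. The differential equation at \<open>n\<close> yields the
  derivative rule at \<open>Suc n\<close>, and that rule inserted in the recursion yields the
  equation at \<open>Suc n\<close>.\<close>

lemma hermite_ode: "[:0, 2:] * pderiv (hermite \<kappa> n) - smult \<kappa> (pderiv (pderiv (hermite \<kappa> n))) = smult (2 * real n) (hermite \<kappa> n)"
  and pderiv_hermite_Suc: "pderiv (hermite \<kappa> (Suc n)) = smult (2 * real (Suc n)) (hermite \<kappa> n)"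
proof -
  have step: "pderiv (hermite \<kappa> (Suc n)) = smult (2 * real (Suc n)) (hermite \<kappa> n)"
    if "[:0, 2:] * pderiv (hermite \<kappa> n) - smult \<kappa> (pderiv (pderiv (hermite \<kappa> n))) = smult (2 * real n) (hermite \<kappa> n)" for n
  proof -
    have "pderiv (hermite \<kappa> (Suc n)) = smult 2 (hermite \<kappa> n) +
        ([:0, 2:] * pderiv (hermite \<kappa> n) - smult \<kappa> (pderiv (pderiv (hermite \<kappa> n))))"
      by (simp add: hermite.simps pderiv_diff pderiv_mult pderiv_smult pderiv_pCons)
    also have "\<dots> = smult (2 * real (Suc n)) (hermite \<kappa> n)"
      unfolding that by (simp add: smult_add_left[symmetric] algebra_simps)
    finally show ?thesis .
  qed
  show *: "[:0, 2:] * pderiv (hermite \<kappa> n) - smult \<kappa> (pderiv (pderiv (hermite \<kappa> n))) = smult (2 * real n) (hermite \<kappa> n)" for n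
  proof (induction n)
    case (Suc n)
    show ?case unfolding step[OF Suc]
      by (simp add: hermite.simps pderiv_smult smult_diff_right mult.commute)
  qed (simp add: pderiv_1)
  show "pderiv (hermite \<kappa> (Suc n)) = smult (2 * real (Suc n)) (hermite \<kappa> n)" by (rule step[OF *])
qed

text \<open>With respect to the Gaussian weight, the raising operator is the adjoint of \<kappa>
  d/dx.\<close>

lemma gauss_int_hermite_Suc: "gauss_int \<kappa> (q * hermite \<kappa> (Suc m)) = \<kappa> * gauss_int \<kappa> (pderiv q * hermite \<kappa> m)"
proof -
  have "gauss_int \<kappa> (q * hermite \<kappa> (Suc m)) =
      gauss_int \<kappa> ([:0, 2:] * (q * hermite \<kappa> m)) - \<kappa> * gauss_int \<kappa> (q * pderiv (hermite \<kappa> m))"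
    by (simp add: hermite.simps right_diff_distrib gauss_int_diff gauss_int_smult mult.left_commute)
  then show ?thesis
    unfolding gauss_int_pderiv[symmetric] pderiv_mult gauss_int_add by (simp add: algebra_simps)
qed

text \<open>Adjointness lowers both indices together. When one of them reaches 0 the other is still
  positive, and the derivative of the constant 1 vanishes.\<close>

lemma gauss_int_hermite_orthogonal: "n \<noteq> m \<Longrightarrow> gauss_int \<kappa> (hermite \<kappa> n * hermite \<kappa> m) = 0"
proof (induction n arbitrary: m)
  case 0
  then obtain k where "m = Suc k" by (cases m) auto
  then show ?case using gauss_int_hermite_Suc[of 1 k] by (simp add: pderiv_1 gauss_int_def)
next
  case (Suc n)
  show ?case
  proof (cases m)
    case 0
    then show ?thesis using gauss_int_hermite_Suc[of 1 n] by (simp add: pderiv_1 gauss_int_def)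
  next
    case (Suc k)
    then have "gauss_int \<kappa> (hermite \<kappa> n * hermite \<kappa> k) = 0" using Suc.IH Suc.prems by simp
    then show ?thesis
      unfolding Suc gauss_int_hermite_Suc pderiv_hermite_Suc mult_smult_left gauss_int_smult by simp
  qed
qed

text \<open>Lowering both indices multiplies the norm by a positive factor at each step, which
  reduces the claim to positivity of the Gaussian integral itself.\<close>

lemma gauss_int_hermite_pos: "0 < gauss_int \<kappa> (hermite \<kappa> n * hermite \<kappa> n)"
proof (induction n)
  case 0
  have "(LINT x|lborel. exp (- x\<^sup>2 / \<kappa>)) \<noteq> 0"
  proof
    assume "(LINT x|lborel. exp (- x\<^sup>2 / \<kappa>)) = 0"
    then have "AE x in lborel. exp (- x\<^sup>2 / \<kappa>) = 0"
      using integral_nonneg_eq_0_iff_AE[of lborel "\<lambda>x. exp (- x\<^sup>2 / \<kappa>)"] integrable_gauss_int[of 1] by simp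
    then have "AE x::real in lborel. False" by simp
    then have "ae_filter (lborel :: real measure) = bot" by (simp only: eventually_False)
    then show False by (simp add: ae_filter_eq_bot_iff)
  qed
  moreover have "0 \<le> (LINT x|lborel. exp (- x\<^sup>2 / \<kappa>))" by simp
  ultimately have "0 < (LINT x|lborel. exp (- x\<^sup>2 / \<kappa>))" by linarith
  then show ?case by (simp add: gauss_int_def)
next
  case (Suc n)
  then show ?case
    unfolding gauss_int_hermite_Suc pderiv_hermite_Suc mult_smult_left gauss_int_smult using \<kappa> by simp
qed

definition hermite_const :: "nat \<Rightarrow> real" where
  "hermite_const n = 1 / sqrt (gauss_int \<kappa> (hermite \<kappa> n * hermite \<kappa> n))"

definition hermite_fun :: "nat \<Rightarrow> real \<Rightarrow> complex" where
  "hermite_fun n x = complex_of_real (hermite_const n * poly (hermite \<kappa> n) x * exp (- x\<^sup>2 / (2 * \<kappa>)))"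

definition hermite_vec :: "nat \<Rightarrow> real L2" where
  "hermite_vec n = abs_L2 (hermite_fun n)"

lemma hermite_const_pos: "0 < hermite_const n"
  using gauss_int_hermite_pos by (simp add: hermite_const_def)

lemma exp_half_sq: "exp (- x\<^sup>2 / (2 * \<kappa>)) * exp (- x\<^sup>2 / (2 * \<kappa>)) = exp (- x\<^sup>2 / \<kappa>)"
  using \<kappa> by (simp add: exp_add[symmetric] field_simps)

lemma square_integrable_poly_gauss:
  "square_integrable (\<lambda>x. complex_of_real (poly p x * exp (- x\<^sup>2 / (2 * \<kappa>))))"
proof -
  have "(cmod (complex_of_real (poly p x * exp (- x\<^sup>2 / (2 * \<kappa>)))))\<^sup>2 = poly (p * p) x * exp (- x\<^sup>2 / \<kappa>)" for x
    unfolding exp_half_sq[symmetric] norm_of_real abs_mult power_mult_distrib poly_mult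
    by (simp add: power2_eq_square)
  then show ?thesis using integrable_gauss_int[of "p * p"] \<kappa>
    by (simp add: square_integrable_def borel_measurable_continuous_onI continuous_intros)
qed

lemma square_integrable_hermite_fun: "square_integrable (hermite_fun n)"
  using square_integrable_poly_gauss[of "smult (hermite_const n) (hermite \<kappa> n)"]
  by (simp add: hermite_fun_def[abs_def])

lemma orthonormal_hermite: "orthonormal_on UNIV hermite_vec"
  unfolding orthonormal_on_def
proof (intro ballI)
  fix n m
  have "cinner (hermite_vec n) (hermite_vec m) =
      (LINT x|lborel. complex_of_real (hermite_const n * hermite_const m * (poly (hermite \<kappa> n * hermite \<kappa> m) x * exp (- x\<^sup>2 / \<kappa>))))"
    unfolding hermite_vec_def cinner_abs_L2[OF square_integrable_hermite_fun square_integrable_hermite_fun]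
    by (rule Bochner_Integration.integral_cong)
      (simp_all only: hermite_fun_def exp_half_sq[symmetric] poly_mult of_real_mult complex_cnj_complex_of_real
        complex_cnj_mult mult_ac)
  also have "\<dots> = of_real (hermite_const n * hermite_const m * gauss_int \<kappa> (hermite \<kappa> n * hermite \<kappa> m))"
    unfolding gauss_int_def by (simp only: integral_complex_of_real integral_mult_right_zero)
  also have "\<dots> = (if n = m then 1 else 0)"
    using gauss_int_hermite_orthogonal[of n m] gauss_int_hermite_pos[of m]
    by (auto simp: hermite_const_def simp flip: real_sqrt_mult)
  finally show "cinner (hermite_vec n) (hermite_vec m) = (if n = m then 1 else 0)" .
qed

text \<open>The nonzero leading coefficient lets \<open>hermite_total\<close> reach every polynomial
  by successively removing top-degree terms.\<close>

lemma degree_hermite: "degree (hermite \<kappa> n) = n \<and> coeff (hermite \<kappa> n) n = 2 ^ n"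
proof (induction n)
  case (Suc n)
  then have d: "degree (hermite \<kappa> n) = n" and c: "coeff (hermite \<kappa> n) n = 2 ^ n" by auto
  have c': "coeff (hermite \<kappa> (Suc n)) k = 2 * coeff (hermite \<kappa> n) (k - 1) * of_bool (k > 0) - \<kappa> * (real (Suc k) * coeff (hermite \<kappa> n) (Suc k))" for k
    by (cases k) (simp_all add: hermite.simps coeff_pderiv coeff_pCons)
  have "coeff (hermite \<kappa> (Suc n)) (Suc n) = 2 ^ Suc n"
    unfolding c' using c coeff_eq_0[of "hermite \<kappa> n" "Suc (Suc n)"] d by simp
  moreover have "degree (hermite \<kappa> (Suc n)) \<le> Suc n"
    by (rule degree_le) (auto simp: c' d coeff_eq_0)
  moreover have "Suc n \<le> degree (hermite \<kappa> (Suc n))"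
    by (rule le_degree) (use calculation in simp)
  ultimately show ?case by simp
qed simp

text \<open>Orthogonality to the Hermite functions annihilates every moment of \<open>G\<close>
  times \<open>f\<close>. Expanding \<open>iexp (t * x)\<close> in its power series then annihilates
  the Fourier transform of this product, so it vanishes almost everywhere, and \<open>G\<close> is
  positive.\<close>

lemma hermite_total:
  fixes f :: "real \<Rightarrow> complex"
  assumes f: "square_integrable f"
    and orth: "\<And>n. (LINT x|lborel. hermite_fun n x * f x) = 0"
  shows "AE x in lborel. f x = 0"
proof -
  note [measurable] = square_integrable_measurable[OF f]
  define G where "G x = exp (- x\<^sup>2 / (2 * \<kappa>))" for x :: real
  have [measurable]: "G \<in> borel_measurable borel" unfolding G_def[abs_def]
    by (intro borel_measurable_continuous_onI continuous_intros) (use \<kappa> in auto)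
  have int: "integrable lborel (\<lambda>x. complex_of_real (poly p x * G x) * f x)" for p
    using integrable_cnj_mult[OF square_integrable_poly_gauss f, of p] by (simp add: G_def)
  define \<Lambda> where "\<Lambda> p = (LINT x|lborel. complex_of_real (poly p x * G x) * f x)" for p
  have \<Lambda>_add: "\<Lambda> (p + q) = \<Lambda> p + \<Lambda> q" for p q
    using Bochner_Integration.integral_add[OF int[of p] int[of q]] by (simp add: \<Lambda>_def distrib_right)
  have \<Lambda>_smult: "\<Lambda> (smult c p) = of_real c * \<Lambda> p" for c p
    by (simp add: \<Lambda>_def mult.assoc)
  have \<Lambda>_hermite: "\<Lambda> (hermite \<kappa> n) = 0" for n
  proof -
    have "of_real (hermite_const n) * \<Lambda> (hermite \<kappa> n) = 0"
      using orth[of n] by (simp add: \<Lambda>_def hermite_fun_def G_def mult.assoc)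
    then show ?thesis using hermite_const_pos[of n] by simp
  qed
  have \<Lambda>_zero: "\<Lambda> p = 0" if "degree p < n" for n p
    using that
  proof (induction n arbitrary: p)
    case (Suc n)
    define c where "c = coeff p n / 2 ^ n"
    define r where "r = p - smult c (hermite \<kappa> n)"
    have "\<Lambda> r = 0"
    \<comment> \<open>The zero polynomial has degree 0, so the induction hypothesis, which asks for
      \<open>degree r < n\<close>, says nothing when \<open>n = 0\<close>; there \<open>p\<close> is
      constant and \<open>r\<close> is zero.\<close>
    proof (cases "n = 0")
      case True
      then have "p = [:coeff p 0:]" using Suc.prems degree_0_id[of p] by simp
      then have "r = 0" using True by (simp add: r_def c_def one_pCons)
      then show ?thesis by (simp add: \<Lambda>_def)
    next
      case False
      have "degree r < n"
      proof (rule degree_lessI)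
        show "\<forall>k\<ge>n. coeff r k = 0"
        proof (intro allI impI)
          fix k assume "n \<le> k"
          then show "coeff r k = 0"
            using degree_hermite[of n] Suc.prems coeff_eq_0[of p k] coeff_eq_0[of "hermite \<kappa> n" k]
            by (cases "k = n") (auto simp: r_def c_def)
        qed
      qed (use False in simp)
      then show ?thesis by (rule Suc.IH)
    qed
    then have "\<Lambda> (r + smult c (hermite \<kappa> n)) = 0" by (simp only: \<Lambda>_add \<Lambda>_smult \<Lambda>_hermite) simp
    then show ?case by (simp add: r_def)
  qed simp
  have mom: "(LINT x|lborel. of_real (x ^ k * G x) * f x) = 0" for k
    using \<Lambda>_zero[of "monom 1 k" "Suc (degree (monom (1::real) k))"] by (simp add: \<Lambda>_def poly_monom)
  \<comment> \<open>The integrable majorant that will allow the power series of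
    \<open>iexp (t * x)\<close> to be integrated term by term.\<close>
  have dom: "integrable lborel (\<lambda>x. complex_of_real (exp \<bar>t * x\<bar> * G x) * f x)" for t
  proof -
    have "square_integrable (\<lambda>x. complex_of_real (exp \<bar>t * x\<bar> * G x))"
      unfolding square_integrable_def
    proof
      have "integrable lborel (\<lambda>x. exp (2 * \<kappa> * t\<^sup>2) * (poly 1 x * exp (- (1 / (2 * \<kappa>)) * x\<^sup>2)))"
        using integrable_poly_gaussian[of "1 / (2 * \<kappa>)" 1] \<kappa> by (intro integrable_mult_right) auto
      then show "integrable lborel (\<lambda>x. (cmod (complex_of_real (exp \<bar>t * x\<bar> * G x)))\<^sup>2)"
      proof (rule Bochner_Integration.integrable_bound)
        have "(exp \<bar>t * x\<bar> * G x)\<^sup>2 \<le> exp (2 * \<kappa> * t\<^sup>2) * exp (- (1 / (2 * \<kappa>)) * x\<^sup>2)" for x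
        proof -
          \<comment> \<open>This square trades half of the exponent \<open>x^2 / \<kappa>\<close>
            for the growth of \<open>exp (2 * \<bar>t * x\<bar>)\<close>; the other half remains as
            an integrable Gaussian.\<close>
          have "0 \<le> (2 * \<kappa> * \<bar>t\<bar> - \<bar>x\<bar>)\<^sup>2" by simp
          then have "4 * \<kappa> * \<bar>t * x\<bar> / (2 * \<kappa>) \<le> (4 * \<kappa>\<^sup>2 * t\<^sup>2 + x\<^sup>2) / (2 * \<kappa>)"
            using \<kappa> by (intro divide_right_mono) (auto simp: power2_diff abs_mult power_mult_distrib)
          then have "2 * \<bar>t * x\<bar> \<le> 2 * \<kappa> * t\<^sup>2 + x\<^sup>2 / (2 * \<kappa>)"
            using \<kappa> by (simp add: add_divide_distrib power2_eq_square)
          then have "exp (2 * \<bar>t * x\<bar> - x\<^sup>2 / \<kappa>) \<le> exp (2 * \<kappa> * t\<^sup>2 + - (1 / (2 * \<kappa>)) * x\<^sup>2)"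
          proof -
            have "x\<^sup>2 / \<kappa> = x\<^sup>2 / (2 * \<kappa>) + x\<^sup>2 / (2 * \<kappa>)" using \<kappa> by (simp add: field_simps)
            then show ?thesis using \<open>2 * \<bar>t * x\<bar> \<le> 2 * \<kappa> * t\<^sup>2 + x\<^sup>2 / (2 * \<kappa>)\<close> by simp
          qed
          moreover have "(exp \<bar>t * x\<bar> * G x)\<^sup>2 = exp (2 * \<bar>t * x\<bar> - x\<^sup>2 / \<kappa>)"
          proof -
            have "(G x)\<^sup>2 = exp (- x\<^sup>2 / \<kappa>)"
              by (simp only: G_def power2_eq_square[of "exp _"] exp_half_sq)
            then have "(exp \<bar>t * x\<bar> * G x)\<^sup>2 = exp (2 * \<bar>t * x\<bar>) * exp (- x\<^sup>2 / \<kappa>)"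
              by (simp only: power_mult_distrib exp_double)
            then show ?thesis by (simp flip: exp_add)
          qed
          ultimately show ?thesis by (simp only: exp_add)
        qed
        then show "AE x in lborel. norm ((cmod (complex_of_real (exp \<bar>t * x\<bar> * G x)))\<^sup>2) \<le>
            norm (exp (2 * \<kappa> * t\<^sup>2) * (poly 1 x * exp (- (1 / (2 * \<kappa>)) * x\<^sup>2)))"
          by (simp add: G_def norm_mult)
      qed simp
    qed simp
    from integrable_cnj_mult[OF this f] show ?thesis by simp
  qed
  have "AE x in lborel. of_real (G x) * f x = 0"
  proof (rule fourier_injective)
    show "integrable lborel (\<lambda>x. of_real (G x) * f x)" using int[of 1] by simp
    fix t
    define s where "s N x = (\<Sum>k<N. (\<i> * of_real (t * x)) ^ k /\<^sub>R fact k) * (of_real (G x) * f x)" for N and x :: real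
    have [measurable]: "s N \<in> borel_measurable borel" for N unfolding s_def[abs_def] by measurable
    have s0: "(LINT x|lborel. s N x) = 0" for N
    proof -
      have eq: "s N x = (\<Sum>k<N. (\<i> * of_real t) ^ k /\<^sub>R fact k * (of_real (x ^ k * G x) * f x))" for x
        by (simp add: s_def sum_distrib_right sum_distrib_left scaleR_conv_of_real power_mult_distrib mult_ac)
      have "integrable lborel (\<lambda>x. of_real (x ^ k * G x) * f x)" for k
        using int[of "monom 1 k"] by (simp add: poly_monom)
      then show ?thesis unfolding eq by (simp only: Bochner_Integration.integral_sum integrable_mult_right integral_mult_right_zero mom) simp
    qed
    have "(\<lambda>N. LINT x|lborel. s N x) \<longlonglongrightarrow> (LINT x|lborel. iexp (t * x) * (of_real (G x) * f x))"
    proof (rule integral_dominated_convergence)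
      show "integrable lborel (\<lambda>x. cmod (complex_of_real (exp \<bar>t * x\<bar> * G x) * f x))" using dom by simp
      show "AE x in lborel. (\<lambda>N. s N x) \<longlonglongrightarrow> iexp (t * x) * (of_real (G x) * f x)"
      proof (rule AE_I2)
        fix x :: real
        have "(\<lambda>k. (\<i> * of_real (t * x)) ^ k /\<^sub>R fact k) sums exp (\<i> * of_real (t * x))" by (rule exp_converges)
        then show "(\<lambda>N. s N x) \<longlonglongrightarrow> iexp (t * x) * (of_real (G x) * f x)"
          unfolding s_def sums_def by (intro tendsto_intros) simp
      qed
      show "AE x in lborel. norm (s N x) \<le> cmod (complex_of_real (exp \<bar>t * x\<bar> * G x) * f x)" for N
      proof (rule AE_I2)
        fix x :: real
        have "cmod (\<Sum>k<N. (\<i> * of_real (t * x)) ^ k /\<^sub>R fact k) \<le> (\<Sum>k<N. \<bar>t * x\<bar> ^ k /\<^sub>R fact k)"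
          by (rule sum_norm_le) (simp add: norm_power norm_mult abs_mult)
        also have "\<dots> \<le> exp \<bar>t * x\<bar>"
          using exp_converges[of "\<bar>t * x\<bar>"] by (intro sum_le_suminf[THEN order_trans]) (auto simp: sums_iff)
        finally show "norm (s N x) \<le> cmod (complex_of_real (exp \<bar>t * x\<bar> * G x) * f x)"
          by (simp add: s_def norm_mult mult_right_mono mult.assoc)
      qed
    qed simp_all
    then show "(LINT x|lborel. iexp (t * x) * (of_real (G x) * f x)) = 0"
      unfolding s0 using LIMSEQ_unique tendsto_const by blast
  qed
  then show ?thesis by eventually_elim (simp add: G_def)
qed

lemma onb_hermite: "onb_on UNIV hermite_vec"
proof (rule onb_onI[OF orthonormal_hermite])
  fix g :: "real L2" assume g: "\<And>n. n \<in> UNIV \<Longrightarrow> cinner (hermite_vec n) g = 0"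
  obtain f where f: "square_integrable f" "g = abs_L2 f" by (rule rep_L2)
  have "cnj (hermite_fun n x) = hermite_fun n x" for n x by (simp add: hermite_fun_def)
  then have "(LINT x|lborel. hermite_fun n x * f x) = 0" for n
    using g[of n] by (simp add: f hermite_vec_def cinner_abs_L2 square_integrable_hermite_fun)
  from hermite_total[OF f(1) this] show "g = 0"
    using f by (simp add: abs_L2_zero abs_L2_eq_iff)
qed

end


section \<open>Bases of \<open>L\<^sup>2(\<real>\<^sup>2)\<close>\<close>

subsection \<open>Tensor products of bases\<close>

lemma tensor_abs_L2:
  "square_integrable f \<Longrightarrow> square_integrable g \<Longrightarrow> abs_L2 f \<otimes>\<^sub>v abs_L2 g = abs_L2 (\<lambda>(x, y). f x * g y)"
  by (rule tensor.abs_eq) (auto simp: L2_rel_def)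

lemma tensor_add_left: "(x + y) \<otimes>\<^sub>v z = x \<otimes>\<^sub>v z + y \<otimes>\<^sub>v z"
proof -
  obtain f g h where "square_integrable f" "square_integrable g" "square_integrable h"
    and "x = abs_L2 f" "y = abs_L2 g" "z = abs_L2 h" by (metis rep_L2)
  then show ?thesis
    by (simp add: tensor_abs_L2 abs_L2_add square_integrable_add square_integrable_tensor distrib_right case_prod_unfold
        square_integrable_tensor[unfolded case_prod_unfold])
qed

lemma tensor_add_right: "x \<otimes>\<^sub>v (y + z) = x \<otimes>\<^sub>v y + x \<otimes>\<^sub>v z"
proof -
  obtain f g h where "square_integrable f" "square_integrable g" "square_integrable h"
    and "x = abs_L2 f" "y = abs_L2 g" "z = abs_L2 h" by (metis rep_L2)
  then show ?thesis
    by (simp add: tensor_abs_L2 abs_L2_add square_integrable_add square_integrable_tensor distrib_left case_prod_unfold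
        square_integrable_tensor[unfolded case_prod_unfold])
qed

lemma tensor_scaleC_left: "(c *\<^sub>C x) \<otimes>\<^sub>v y = c *\<^sub>C (x \<otimes>\<^sub>v y)"
proof -
  obtain f g where "square_integrable f" "square_integrable g"
    and "x = abs_L2 f" "y = abs_L2 g" by (metis rep_L2)
  then show ?thesis
    by (simp add: tensor_abs_L2 abs_L2_scaleC square_integrable_scale case_prod_unfold mult.assoc
        square_integrable_tensor[unfolded case_prod_unfold])
qed

lemma tensor_scaleC_right: "x \<otimes>\<^sub>v (c *\<^sub>C y) = c *\<^sub>C (x \<otimes>\<^sub>v y)"
proof -
  obtain f g where "square_integrable f" "square_integrable g"
    and "x = abs_L2 f" "y = abs_L2 g" by (metis rep_L2)
  then show ?thesis
    by (simp add: tensor_abs_L2 abs_L2_scaleC square_integrable_scale case_prod_unfold mult.left_commute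
        square_integrable_tensor[unfolded case_prod_unfold])
qed

lemma cinner_tensor: "cinner (x \<otimes>\<^sub>v y) (x' \<otimes>\<^sub>v y') = cinner x x' * cinner y y'"
proof -
  obtain f g f' g' where s: "square_integrable f" "square_integrable g" "square_integrable f'" "square_integrable g'"
    and eq: "x = abs_L2 f" "y = abs_L2 g" "x' = abs_L2 f'" "y' = abs_L2 g'" by (metis rep_L2)
  have int: "integrable (lborel \<Otimes>\<^sub>M lborel) (\<lambda>(x, y). (cnj (f x) * f' x) * (cnj (g y) * g' y))"
    using integrable_cnj_mult[OF square_integrable_tensor[OF s(1,2)] square_integrable_tensor[OF s(3,4)]]
    by (simp add: lborel_prod case_prod_unfold mult_ac)
  have "cinner (x \<otimes>\<^sub>v y) (x' \<otimes>\<^sub>v y') = (LINT z|(lborel \<Otimes>\<^sub>M lborel). (case z of (x, y) \<Rightarrow> (cnj (f x) * f' x) * (cnj (g y) * g' y)))"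
    unfolding eq using s by (simp add: tensor_abs_L2 cinner_abs_L2 square_integrable_tensor[unfolded case_prod_unfold]
        lborel_prod case_prod_unfold mult_ac)
  also have "\<dots> = (LINT x|lborel. LINT y|lborel. (cnj (f x) * f' x) * (cnj (g y) * g' y))"
    using lborel_pair.integral_fst'[OF int] by simp
  also have "\<dots> = cinner x x' * cinner y y'"
    unfolding eq using s by (simp add: cinner_abs_L2)
  finally show ?thesis .
qed

lemma AE_lborel_prodI:
  fixes P :: "real \<times> real \<Rightarrow> bool"
  assumes "Measurable.pred borel P" "AE x in lborel. AE y in lborel. P (x, y)"
  shows "AE z in lborel. P z"
proof -
  have "{z. P z} \<in> sets (borel \<Otimes>\<^sub>M borel)"
    unfolding borel_prod using assms(1) by (simp add: pred_def)
  then have "AE z in lborel \<Otimes>\<^sub>M lborel. P z"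
    using assms(2) by (intro lborel_pair.AE_pair_measure) (simp_all add: space_pair_measure)
  then show ?thesis by (simp only: lborel_prod)
qed

text \<open>If \<open>F\<close> is orthogonal to all products, each partial inner product
  \<open>Fj j\<close>, taken in the second variable, is orthogonal to every \<open>e i\<close> and
  so vanishes almost everywhere. Almost every section of \<open>F\<close> is then orthogonal to
  every \<open>h j\<close>, hence zero.\<close>

lemma onb_tensor:
  fixes e h :: "nat \<Rightarrow> real L2"
  assumes e: "onb_on UNIV e" and h: "onb_on UNIV h"
  shows "onb_on (UNIV \<times> UNIV) (\<lambda>(i, j). e i \<otimes>\<^sub>v h j)"
proof (rule onb_onI)
  show "orthonormal_on (UNIV \<times> UNIV) (\<lambda>(i, j). e i \<otimes>\<^sub>v h j)"
    using e h by (auto simp: orthonormal_on_def onb_on_def cinner_tensor)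
  fix X :: "(real \<times> real) L2"
  assume X: "\<And>i. i \<in> UNIV \<times> UNIV \<Longrightarrow> cinner (case i of (i, j) \<Rightarrow> e i \<otimes>\<^sub>v h j) X = 0"
  obtain F where F: "square_integrable F" "X = abs_L2 F" by (rule rep_L2)
  have "\<forall>n. \<exists>f. square_integrable f \<and> e n = abs_L2 f" by (intro allI, rule rep_L2) blast
  then obtain ef where ef: "\<And>n. square_integrable (ef n)" "\<And>n. e n = abs_L2 (ef n)" by metis
  have "\<forall>n. \<exists>f. square_integrable f \<and> h n = abs_L2 f" by (intro allI, rule rep_L2) blast
  then obtain hf where hf: "\<And>n. square_integrable (hf n)" "\<And>n. h n = abs_L2 (hf n)" by metis
  note [measurable] = square_integrable_measurable[OF F(1)] square_integrable_measurable[OF ef(1)]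
    square_integrable_measurable[OF hf(1)]
  have intF: "integrable (lborel \<Otimes>\<^sub>M lborel) (\<lambda>(x, y). (cmod (F (x, y)))\<^sup>2)"
    using F(1) by (simp add: lborel_prod square_integrable_def case_prod_unfold)
  define N where "N x = (LINT y|lborel. (cmod (F (x, y)))\<^sup>2)" for x
  have N: "integrable lborel N"
    using lborel_pair.integrable_fst'[OF intF] by (simp add: N_def[abs_def])
  have sec: "AE x in lborel. square_integrable (\<lambda>y. F (x, y))"
    using lborel_pair.AE_integrable_fst'[OF intF] by (auto simp: square_integrable_def)
  define Fj where "Fj j x = (LINT y|lborel. cnj (hf j y) * F (x, y))" for j x
  have [measurable]: "Fj j \<in> borel_measurable borel" for j
    unfolding Fj_def[abs_def] by measurable
  \<comment> \<open>Cauchy-Schwarz on the section, where \<open>h j\<close> has norm 1; this puts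
    \<open>Fj j\<close> into \<open>L2\<close>.\<close>
  have "(cmod (Fj j x))\<^sup>2 \<le> N x" if "square_integrable (\<lambda>y. F (x, y))" for j x
  proof -
    have "Fj j x = cinner (h j) (abs_L2 (\<lambda>y. F (x, y)))"
      using that by (simp add: Fj_def hf cinner_abs_L2)
    moreover have "norm (h j) = 1"
      using h by (simp add: onb_on_def orthonormal_on_def norm_eq_1 inner_cinner)
    ultimately have "(cmod (Fj j x))\<^sup>2 \<le> (norm (abs_L2 (\<lambda>y. F (x, y))))\<^sup>2"
      using cmod_cinner_le[of "h j" "abs_L2 (\<lambda>y. F (x, y))"] by simp
    also have "ennreal ((norm (abs_L2 (\<lambda>y. F (x, y))))\<^sup>2) = ennreal (N x)"
      using that unfolding norm_abs_L2[OF that] N_def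
      by (intro nn_integral_eq_integral) (auto simp: square_integrable_def)
    then have "(norm (abs_L2 (\<lambda>y. F (x, y))))\<^sup>2 = N x"
      by (subst (asm) ennreal_inj) (auto simp: N_def)
    finally show ?thesis .
  qed
  then have "AE x in lborel. (cmod (Fj j x))\<^sup>2 \<le> N x" for j using sec by auto
  then have sFj: "square_integrable (Fj j)" for j
    unfolding square_integrable_def
    by (auto intro!: Bochner_Integration.integrable_bound[OF N]) (smt (verit) eventually_mono)
  have "AE x in lborel. Fj j x = 0" for j
  proof -
    have "abs_L2 (Fj j) = 0"
    proof (rule onb_on_eqI[OF e])
      fix i
      have int: "integrable (lborel \<Otimes>\<^sub>M lborel) (\<lambda>(x, y). cnj (ef i x) * (cnj (hf j y) * F (x, y)))"
        using integrable_cnj_mult[OF square_integrable_tensor[OF ef(1) hf(1)] F(1), of i j]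
        by (simp add: lborel_prod case_prod_unfold mult.assoc)
      have "0 = cinner (e i \<otimes>\<^sub>v h j) X" using X[of "(i, j)"] by simp
      also have "\<dots> = (LINT z|(lborel \<Otimes>\<^sub>M lborel). (case z of (x, y) \<Rightarrow> cnj (ef i x) * (cnj (hf j y) * F (x, y))))"
        by (simp add: ef hf F tensor_abs_L2 cinner_abs_L2 square_integrable_tensor[unfolded case_prod_unfold]
            lborel_prod case_prod_unfold mult.assoc)
      also have "\<dots> = (LINT x|lborel. cnj (ef i x) * Fj j x)"
        using lborel_pair.integral_fst'[OF int] by (simp add: Fj_def)
      finally show "cinner (e i) (abs_L2 (Fj j)) = cinner (e i) 0"
        by (simp add: ef cinner_abs_L2 sFj)
    qed
    then show ?thesis using sFj by (simp add: abs_L2_zero abs_L2_eq_iff)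
  qed
  \<comment> \<open>Countability of the index set merges the exceptional null sets into one.\<close>
  then have "AE x in lborel. \<forall>j. Fj j x = 0" by (simp add: AE_all_countable)
  with sec have "AE x in lborel. AE y in lborel. F (x, y) = 0"
  proof eventually_elim
    case (elim x)
    have "abs_L2 (\<lambda>y. F (x, y)) = 0"
      by (rule onb_on_eqI[OF h]) (use elim in \<open>simp add: hf cinner_abs_L2 Fj_def\<close>)
    then show ?case using elim by (simp add: abs_L2_zero abs_L2_eq_iff)
  qed
  then have "AE z in lborel. F z = 0" by (intro AE_lborel_prodI) auto
  then show "X = 0" using F by (simp add: abs_L2_zero abs_L2_eq_iff)
qed


subsection \<open>Relative and mean coordinates\<close>

text \<open>Taking the mean rather than the sum as second coordinate gives determinant 1, so bases
  are transported without normalizing factors.\<close>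

definition rel_mean :: "real \<times> real \<Rightarrow> real \<times> real" where
  "rel_mean = (\<lambda>(x, y). (x - y, (x + y) / 2))"

definition rel_mean_inv :: "real \<times> real \<Rightarrow> real \<times> real" where
  "rel_mean_inv = (\<lambda>(w, v). (v + w / 2, v - w / 2))"

lemma rel_mean_inv [simp]: "rel_mean (rel_mean_inv z) = z" "rel_mean_inv (rel_mean z) = z"
  by (auto simp: rel_mean_def rel_mean_inv_def case_prod_unfold prod_eq_iff field_simps)

lemma measurable_rel_mean [measurable]: "rel_mean \<in> borel_measurable borel" "rel_mean_inv \<in> borel_measurable borel"
  unfolding rel_mean_def rel_mean_inv_def case_prod_unfold
  by (intro borel_measurable_continuous_onI continuous_intros; simp)+

text \<open>The map is a product of two shears: with \<open>y\<close> fixed, \<open>x\<close>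
  becomes \<open>w = x - y\<close>; with \<open>w\<close> fixed, \<open>y\<close> becomes
  \<open>w / 2 + y\<close>. Each is a translation in one variable, and Tonelli exchanges the order
  between them.\<close>

lemma distr_rel_mean: "distr lborel borel rel_mean = lborel"
proof (rule measure_eqI)
  fix A assume "A \<in> sets (distr lborel borel rel_mean)"
  then have [measurable]: "A \<in> sets borel" by simp
  have meas: "(\<lambda>(x, y). indicator A (g (x, y)) :: ennreal) \<in> borel_measurable (lborel \<Otimes>\<^sub>M lborel)"
    if [measurable]: "g \<in> borel_measurable borel" for g :: "real \<times> real \<Rightarrow> real \<times> real"
    by (simp add: lborel_prod case_prod_unfold)
  have sl: "(\<lambda>(w :: real, y :: real). (w, w / 2 + y)) \<in> borel_measurable borel"
    unfolding case_prod_unfold by (intro borel_measurable_continuous_onI continuous_intros) auto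
  have s1: "(\<lambda>x. indicator A (g x) :: ennreal) \<in> borel_measurable borel"
    if "continuous_on UNIV g" for g :: "real \<Rightarrow> real \<times> real"
  proof -
    have [measurable]: "g \<in> borel_measurable borel" using that by (rule borel_measurable_continuous_onI)
    show ?thesis by measurable
  qed
  have "emeasure (distr lborel borel rel_mean) A = (\<integral>\<^sup>+ z. indicator A (rel_mean z) \<partial>lborel)"
  proof -
    have "(\<integral>\<^sup>+ z. indicator A z \<partial>distr lborel borel rel_mean) = (\<integral>\<^sup>+ z. indicator A (rel_mean z) \<partial>lborel)"
      by (rule nn_integral_distr) auto
    then show ?thesis by simp
  qed
  also have "\<dots> = (\<integral>\<^sup>+ z. (case z of (x, y) \<Rightarrow> indicator A (rel_mean (x, y))) \<partial>(lborel \<Otimes>\<^sub>M lborel))"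
    by (simp add: lborel_prod)
  also have "\<dots> = (\<integral>\<^sup>+ y. \<integral>\<^sup>+ x. indicator A (rel_mean (x, y)) \<partial>lborel \<partial>lborel)"
    using lborel_pair.nn_integral_snd[OF meas[of rel_mean]] by (simp add: case_prod_unfold)
  also have "\<dots> = (\<integral>\<^sup>+ y. \<integral>\<^sup>+ w. indicator A (w, w / 2 + y) \<partial>lborel \<partial>lborel)"
  proof (rule nn_integral_cong)
    fix y :: real
    have "(\<integral>\<^sup>+ x. indicator A (rel_mean (x, y)) \<partial>lborel) = (\<integral>\<^sup>+ w. indicator A (rel_mean (y + 1 * w, y)) \<partial>lborel)"
      by (subst nn_integral_real_affine[where c = 1 and t = y])
        (auto simp: rel_mean_def intro!: s1 continuous_intros)
    also have "\<dots> = (\<integral>\<^sup>+ w. indicator A (w, w / 2 + y) \<partial>lborel)"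
      by (rule nn_integral_cong) (simp add: rel_mean_def field_simps)
    finally show "(\<integral>\<^sup>+ x. indicator A (rel_mean (x, y)) \<partial>lborel) = (\<integral>\<^sup>+ w. indicator A (w, w / 2 + y) \<partial>lborel)" .
  qed
  also have "\<dots> = (\<integral>\<^sup>+ w. \<integral>\<^sup>+ y. indicator A (w, w / 2 + 1 * y) \<partial>lborel \<partial>lborel)"
    using lborel_pair.Fubini'[OF meas[OF sl]] by (simp add: case_prod_unfold)
  also have "\<dots> = (\<integral>\<^sup>+ w. \<integral>\<^sup>+ v. indicator A (w, v) \<partial>lborel \<partial>lborel)"
  proof (rule nn_integral_cong)
    fix w :: real
    show "(\<integral>\<^sup>+ y. indicator A (w, w / 2 + 1 * y) \<partial>lborel) = (\<integral>\<^sup>+ v. indicator A (w, v) \<partial>lborel)"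
      by (subst (2) nn_integral_real_affine[where c = 1 and t = "w / 2"])
        (auto intro!: s1 continuous_intros)
  qed
  also have "\<dots> = (\<integral>\<^sup>+ z. (case z of (x, y) \<Rightarrow> indicator A (x, y)) \<partial>(lborel \<Otimes>\<^sub>M lborel))"
    using lborel.nn_integral_fst[OF meas[of "\<lambda>z. z"]] by simp
  also have "\<dots> = emeasure lborel A" by (simp add: lborel_prod)
  finally show "emeasure (distr lborel borel rel_mean) A = emeasure lborel A" .
qed simp

lemma distr_rel_mean_inv: "distr lborel borel rel_mean_inv = lborel"
proof -
  have "distr (distr lborel borel rel_mean) borel rel_mean_inv = distr lborel borel (\<lambda>z. z)"
    by (subst distr_distr) (auto simp: o_def)
  then show ?thesis by (simp add: distr_rel_mean distr_id2)
qed

lemma square_integrable_rel_mean: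
  "square_integrable F \<Longrightarrow> square_integrable (\<lambda>z. F (rel_mean z))"
  "square_integrable F \<Longrightarrow> square_integrable (\<lambda>z. F (rel_mean_inv z))"
  using integrable_distr[of rel_mean lborel borel "\<lambda>z. (cmod (F z))\<^sup>2"]
    integrable_distr[of rel_mean_inv lborel borel "\<lambda>z. (cmod (F z))\<^sup>2"]
  by (auto simp: square_integrable_def distr_rel_mean distr_rel_mean_inv)

lemma cinner_rel_mean:
  assumes F: "square_integrable F" and G: "square_integrable G"
  shows "cinner (abs_L2 (\<lambda>z. F (rel_mean z))) (abs_L2 (\<lambda>z. G (rel_mean z))) = cinner (abs_L2 F) (abs_L2 G)"
proof -
  note [measurable] = square_integrable_measurable[OF F] square_integrable_measurable[OF G]
  have "(LINT z|distr lborel borel rel_mean. cnj (F z) * G z) = (LINT z|lborel. cnj (F (rel_mean z)) * G (rel_mean z))"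
    by (rule integral_distr) auto
  then show ?thesis using assms by (simp add: cinner_abs_L2 square_integrable_rel_mean distr_rel_mean)
qed

text \<open>Composition with \<open>rel_mean\<close> preserves inner products and is inverted by
  composition with \<open>rel_mean_inv\<close>, so it is unitary.\<close>

lemma onb_rel_mean:
  assumes onb: "onb_on I (\<lambda>i. abs_L2 (F i))" and F: "\<And>i. i \<in> I \<Longrightarrow> square_integrable (F i)"
  shows "onb_on I (\<lambda>i. abs_L2 (\<lambda>z. F i (rel_mean z)))"
proof (rule onb_onI)
  show "orthonormal_on I (\<lambda>i. abs_L2 (\<lambda>z. F i (rel_mean z)))"
    using onb F by (auto simp: onb_on_def orthonormal_on_def cinner_rel_mean)
  fix X assume X: "\<And>i. i \<in> I \<Longrightarrow> cinner (abs_L2 (\<lambda>z. F i (rel_mean z))) X = 0"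
  obtain G where G: "square_integrable G" "X = abs_L2 G" by (rule rep_L2)
  define H where "H z = G (rel_mean_inv z)" for z
  have H: "square_integrable H" unfolding H_def by (rule square_integrable_rel_mean(2)[OF G(1)])
  have GH: "G = (\<lambda>z. H (rel_mean z))" by (simp add: H_def)
  have "abs_L2 H = 0"
  proof (rule onb_on_eqI[OF onb])
    show "cinner (abs_L2 (F i)) (abs_L2 H) = cinner (abs_L2 (F i)) 0" if "i \<in> I" for i
      using X[OF that] cinner_rel_mean[OF F[OF that] H] by (simp add: G(2) GH)
  qed
  then have "cinner X X = 0" using cinner_rel_mean[OF H H] by (simp add: G(2) GH)
  then show "X = 0" by (simp add: cinner_self)
qed


section \<open>The transport cost as a diagonal operator\<close>

subsection \<open>Schwartz functions\<close>

lemma abs_fst_le_norm: "\<bar>fst z\<bar> \<le> norm (z :: real \<times> real)"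
  and abs_snd_le_norm: "\<bar>snd z\<bar> \<le> norm (z :: real \<times> real)"
  using norm_fst_le[of "fst z" "snd z"] norm_snd_le[of "snd z" "fst z"] by simp_all

lemma schwartzE:
  assumes "schwartz f"
  obtains f\<^sub>x f\<^sub>y where "\<And>n::nat. bounded (range (\<lambda>z. (1 + norm z) ^ n *\<^sub>R f z))"
    and "\<And>z. (f has_derivative (\<lambda>(h, k). h *\<^sub>R f\<^sub>x z + k *\<^sub>R f\<^sub>y z)) (at z)"
    and "schwartz f\<^sub>x" and "schwartz f\<^sub>y"
  using assms by (cases rule: schwartz.cases) blast

lemma partial_derivatives:
  fixes f :: "real \<times> real \<Rightarrow> complex"
  assumes D: "(f has_derivative (\<lambda>(h, k). h *\<^sub>R a + k *\<^sub>R b)) (at (x, y))"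
  shows "((\<lambda>s. f (s, y)) has_vector_derivative a) (at x)" "((\<lambda>s. f (x, s)) has_vector_derivative b) (at y)"
proof -
  have "((\<lambda>s. (s, y)) has_derivative (\<lambda>h. (h, 0))) (at x)"
    by (intro has_derivative_Pair has_derivative_ident has_derivative_const)
  from has_derivative_compose[OF this D] show "((\<lambda>s. f (s, y)) has_vector_derivative a) (at x)"
    by (simp add: has_vector_derivative_def)
  have "((\<lambda>s. (x, s)) has_derivative (\<lambda>h. (0, h))) (at y)"
    by (intro has_derivative_Pair has_derivative_ident has_derivative_const)
  from has_derivative_compose[OF this D] show "((\<lambda>s. f (x, s)) has_vector_derivative b) (at y)"
    by (simp add: has_vector_derivative_def)
qed

lemma diff_op_eq:
  assumes D: "\<And>z. (f has_derivative (\<lambda>(h, k). h *\<^sub>R f\<^sub>x z + k *\<^sub>R f\<^sub>y z)) (at z)"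
  shows "diff_op f = (\<lambda>z. f\<^sub>x z - f\<^sub>y z)"
  using vector_derivative_at[OF partial_derivatives(1)[OF D]] vector_derivative_at[OF partial_derivatives(2)[OF D]]
  by (auto simp: diff_op_def fun_eq_iff)

lemma schwartz_diff:
  assumes "schwartz f" "schwartz g"
  shows "schwartz (\<lambda>z. f z - g z)"
  using assms
proof (coinduction arbitrary: f g)
  case (schwartz f g)
  obtain f\<^sub>x f\<^sub>y where f: "\<And>n::nat. bounded (range (\<lambda>z. (1 + norm z) ^ n *\<^sub>R f z))"
    "\<And>z. (f has_derivative (\<lambda>(h, k). h *\<^sub>R f\<^sub>x z + k *\<^sub>R f\<^sub>y z)) (at z)" "schwartz f\<^sub>x" "schwartz f\<^sub>y"
    using schwartz(1) by (rule schwartzE) blast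
  obtain g\<^sub>x g\<^sub>y where g: "\<And>n::nat. bounded (range (\<lambda>z. (1 + norm z) ^ n *\<^sub>R g z))"
    "\<And>z. (g has_derivative (\<lambda>(h, k). h *\<^sub>R g\<^sub>x z + k *\<^sub>R g\<^sub>y z)) (at z)" "schwartz g\<^sub>x" "schwartz g\<^sub>y"
    using schwartz(2) by (rule schwartzE) blast
  have "bounded (range (\<lambda>z. (1 + norm z) ^ n *\<^sub>R (f z - g z)))" for n :: nat
    unfolding scaleR_diff_right by (rule bounded_minus_comp[OF f(1) g(1)])
  moreover have "((\<lambda>z. f z - g z) has_derivative (\<lambda>(h, k). h *\<^sub>R (f\<^sub>x z - g\<^sub>x z) + k *\<^sub>R (f\<^sub>y z - g\<^sub>y z))) (at z)" for z
    by (rule has_derivative_eq_rhs[OF has_derivative_diff[OF f(2) g(2)]]) (auto simp: algebra_simps)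
  ultimately show ?case
    using f(3,4) g(3,4)
    by (intro exI[of _ "\<lambda>z. f z - g z"] exI[of _ "\<lambda>z. f\<^sub>x z - g\<^sub>x z"] exI[of _ "\<lambda>z. f\<^sub>y z - g\<^sub>y z"] conjI allI)
      blast+
qed

lemma schwartz_diff_op: "schwartz f \<Longrightarrow> schwartz (diff_op f)"
  by (erule schwartzE) (subst diff_op_eq, assumption, rule schwartz_diff)

lemma schwartz_bound:
  assumes "schwartz f"
  obtains B where "\<And>z. (1 + norm z) ^ n * cmod (f z) \<le> B"
proof -
  obtain f\<^sub>x f\<^sub>y where "\<And>n::nat. bounded (range (\<lambda>z. (1 + norm z) ^ n *\<^sub>R f z))"
    using assms by (rule schwartzE) blast
  then obtain B where "\<And>z. norm ((1 + norm z) ^ n *\<^sub>R f z) \<le> B"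
    unfolding bounded_iff by blast
  then show ?thesis by (intro that[of B]) simp
qed

lemma schwartz_continuous: "schwartz f \<Longrightarrow> continuous_on UNIV f"
  by (erule schwartzE) (auto intro!: continuous_at_imp_continuous_on has_derivative_continuous)


subsection \<open>Integrable decay\<close>

text \<open>An integrable majorant in product form, so that its sections in either variable are
  integrable too.\<close>

definition decay :: "real \<times> real \<Rightarrow> real" where
  "decay z = inverse (1 + (fst z)\<^sup>2) * inverse (1 + (snd z)\<^sup>2)"

definition decaying :: "(real \<times> real \<Rightarrow> complex) \<Rightarrow> bool" where
  "decaying g \<longleftrightarrow> continuous_on UNIV g \<and> (\<exists>B. \<forall>z. cmod (g z) \<le> B * decay z)"

lemma integrable_inverse_1_plus_square_lborel: "integrable lborel (\<lambda>x::real. inverse (1 + x\<^sup>2))"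
  using integrable_inverse_1_plus_square by (simp add: set_integrable_def)

lemma integrable_decay: "integrable lborel decay"
proof -
  have "integrable (lborel \<Otimes>\<^sub>M lborel) decay"
    unfolding decay_def[abs_def] using integrable_inverse_1_plus_square_lborel
    by (intro lborel_pair.Fubini_integrable) (auto simp: abs_mult)
  then show ?thesis by (simp add: lborel_prod)
qed

lemma decay_pos: "0 < decay z" and decay_le_1: "decay z \<le> 1"
proof -
  have p: "0 < 1 + t\<^sup>2" for t :: real by (rule add_pos_nonneg) auto
  show "0 < decay z" unfolding decay_def using p by simp
  show "decay z \<le> 1" unfolding decay_def by (intro mult_le_one) (auto simp: inverse_le_1_iff)
qed

lemma decayingE:
  assumes "decaying g"
  obtains B where "0 \<le> B" "\<And>z. cmod (g z) \<le> B * decay z" "continuous_on UNIV g"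
proof -
  obtain B where B: "\<And>z. cmod (g z) \<le> B * decay z" "continuous_on UNIV g"
    using assms unfolding decaying_def by blast
  have "0 \<le> B * decay 0" using B(1)[of 0] norm_ge_zero order_trans by blast
  then have "0 \<le> B" using decay_pos[of 0] by (simp add: zero_le_mult_iff)
  then show ?thesis using that B by blast
qed

lemma decaying_measurable: "decaying g \<Longrightarrow> g \<in> borel_measurable borel"
  by (auto simp: decaying_def intro: borel_measurable_continuous_onI)

lemma decaying_integrable:
  assumes "decaying g"
  shows "integrable lborel g"
proof -
  obtain B where B: "0 \<le> B" "\<And>z. cmod (g z) \<le> B * decay z" using assms by (rule decayingE) blast
  show ?thesis
  proof (rule Bochner_Integration.integrable_bound)
    show "integrable lborel (\<lambda>z. B * decay z)" by (intro integrable_mult_right integrable_decay)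
    show "AE z in lborel. norm (g z) \<le> norm (B * decay z)"
      using B decay_pos by (intro AE_I2) (simp add: abs_mult less_imp_le)
  qed (use decaying_measurable[OF assms] in simp)
qed

lemma decaying_square_integrable:
  assumes "decaying g"
  shows "square_integrable g"
proof -
  obtain B where B: "0 \<le> B" "\<And>z. cmod (g z) \<le> B * decay z" using assms by (rule decayingE) blast
  note [measurable] = decaying_measurable[OF assms]
  have "integrable lborel (\<lambda>z. (cmod (g z))\<^sup>2)"
  proof (rule Bochner_Integration.integrable_bound)
    show "integrable lborel (\<lambda>z. B\<^sup>2 * decay z)" by (intro integrable_mult_right integrable_decay)
    show "AE z in lborel. norm ((cmod (g z))\<^sup>2) \<le> norm (B\<^sup>2 * decay z)"
    proof (rule AE_I2)
      fix z
      have "(cmod (g z))\<^sup>2 \<le> (B * decay z)\<^sup>2" using B by (intro power_mono) auto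
      also have "\<dots> = B\<^sup>2 * (decay z * decay z)" by (simp add: power_mult_distrib power2_eq_square)
      also have "\<dots> \<le> B\<^sup>2 * (1 * decay z)"
        using decay_pos[of z] decay_le_1[of z] by (intro mult_left_mono mult_right_mono) auto
      finally show "norm ((cmod (g z))\<^sup>2) \<le> norm (B\<^sup>2 * decay z)"
        using decay_pos[of z] by simp
    qed
  qed simp
  then show ?thesis by (simp add: square_integrable_def)
qed

lemma decaying_add: "decaying f \<Longrightarrow> decaying g \<Longrightarrow> decaying (\<lambda>z. f z + g z)"
proof -
  assume f: "decaying f" and g: "decaying g"
  obtain B where B: "0 \<le> B" "\<And>z. cmod (f z) \<le> B * decay z" "continuous_on UNIV f" using f by (rule decayingE) blast
  obtain C where C: "0 \<le> C" "\<And>z. cmod (g z) \<le> C * decay z" "continuous_on UNIV g" using g by (rule decayingE) blast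
  have "cmod (f z + g z) \<le> (B + C) * decay z" for z
    using norm_triangle_mono[OF B(2) C(2)] by (simp add: distrib_right)
  then show ?thesis using B(3) C(3) by (auto simp: decaying_def intro!: continuous_intros)
qed

lemma decaying_scale: "decaying f \<Longrightarrow> decaying (\<lambda>z. c * f z)"
proof -
  assume f: "decaying f"
  obtain B where B: "0 \<le> B" "\<And>z. cmod (f z) \<le> B * decay z" "continuous_on UNIV f" using f by (rule decayingE) blast
  have "cmod (c * f z) \<le> (cmod c * B) * decay z" for z
    using B(2)[of z] by (simp add: norm_mult mult.assoc mult_left_mono)
  then show ?thesis using B(3) by (auto simp: decaying_def intro!: continuous_intros)
qed

lemma decaying_diff: "decaying f \<Longrightarrow> decaying g \<Longrightarrow> decaying (\<lambda>z. f z - g z)"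
  using decaying_add[of f "\<lambda>z. (-1) * g z"] decaying_scale[of g "-1"] by simp

lemma decaying_cnj_mult: "decaying f \<Longrightarrow> decaying g \<Longrightarrow> decaying (\<lambda>z. cnj (f z) * g z)"
proof -
  assume f: "decaying f" and g: "decaying g"
  obtain B where B: "0 \<le> B" "\<And>z. cmod (f z) \<le> B * decay z" "continuous_on UNIV f" using f by (rule decayingE) blast
  obtain C where C: "0 \<le> C" "\<And>z. cmod (g z) \<le> C * decay z" "continuous_on UNIV g" using g by (rule decayingE) blast
  have "cmod (cnj (f z) * g z) \<le> (B * C) * decay z" for z
  proof -
    have "cmod (f z) \<le> B * 1"
      using B(2)[of z] mult_left_mono[OF decay_le_1[of z] B(1)] by linarith
    then have "cmod (f z) * cmod (g z) \<le> B * (C * decay z)"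
      using C(2)[of z] B(1) by (intro mult_mono) auto
    then show ?thesis by (simp add: norm_mult mult.assoc)
  qed
  then show ?thesis using B(3) C(3) by (auto simp: decaying_def intro!: continuous_intros)
qed

lemma schwartz_decaying_mult:
  assumes f: "schwartz f" and q: "continuous_on UNIV q" "\<And>z. cmod (q z) \<le> (1 + norm z) ^ n"
  shows "decaying (\<lambda>z. q z * f z)"
proof -
  \<comment> \<open>The four extra powers pay for \<open>decay\<close>: each of its two factors has
    an inverse bounded by \<open>(1 + norm z)^2\<close>.\<close>
  obtain B where B: "\<And>z. (1 + norm z) ^ (n + 4) * cmod (f z) \<le> B" using f schwartz_bound by blast
  have "cmod (q z * f z) \<le> B * decay z" for z
  proof -
    define u where "u = 1 + norm z"
    have sq: "1 + t\<^sup>2 \<le> u\<^sup>2" if "\<bar>t\<bar> \<le> norm z" for t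
    proof -
      have "t\<^sup>2 \<le> (norm z)\<^sup>2" using power_mono[OF that, of 2] by simp
      then show ?thesis by (simp add: u_def power2_sum add_increasing2)
    qed
    have "\<bar>fst z\<bar> \<le> norm z" "\<bar>snd z\<bar> \<le> norm z"
      using abs_fst_le_norm[of z] abs_snd_le_norm[of z] by auto
    then have "(1 + (fst z)\<^sup>2) * (1 + (snd z)\<^sup>2) \<le> u\<^sup>2 * u\<^sup>2"
      by (intro mult_mono sq) auto
    also have "\<dots> = u ^ 4" by (simp add: power2_eq_square power4_eq_xxxx)
    finally have 1: "inverse (decay z) \<le> u ^ 4" by (simp add: decay_def)
    have "cmod (q z * f z) * inverse (decay z) \<le> (u ^ n * cmod (f z)) * u ^ 4"
      using q(2)[of z] 1 decay_pos[of z] unfolding norm_mult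
      by (intro mult_mono) (auto simp: u_def)
    also have "\<dots> = u ^ (n + 4) * cmod (f z)" by (simp add: power_add mult_ac)
    also have "\<dots> \<le> B" using B[of z] by (simp add: u_def)
    finally show ?thesis using decay_pos[of z] by (simp add: field_simps)
  qed
  then show ?thesis using q(1) schwartz_continuous[OF f] by (auto simp: decaying_def intro!: continuous_intros)
qed

lemma schwartz_decaying: "schwartz f \<Longrightarrow> decaying f"
  using schwartz_decaying_mult[of f "\<lambda>_. 1" 0] by simp

text \<open>Integrating along the direction of differentiation gives 0 on every line, by
  \<open>integral_derivative_eq_0\<close>.\<close>

lemma integral_partial_derivatives_eq_0:
  assumes D: "\<And>z. (f has_derivative (\<lambda>(h, k). h *\<^sub>R f\<^sub>x z + k *\<^sub>R f\<^sub>y z)) (at z)"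
    and f: "decaying f" and fx: "decaying f\<^sub>x" and fy: "decaying f\<^sub>y"
  shows "(LINT z|lborel. f\<^sub>x z) = 0" and "(LINT z|lborel. f\<^sub>y z) = 0"
proof -
  have sec: "integrable lborel (\<lambda>x. g (x, y))" "integrable lborel (\<lambda>x. g (y, x))" if g: "decaying g" for g and y :: real
  proof -
    obtain B where B: "0 \<le> B" "\<And>z. cmod (g z) \<le> B * decay z" using g by (rule decayingE) blast
    note [measurable] = decaying_measurable[OF g]
    note i = integrable_mult_right[OF integrable_inverse_1_plus_square_lborel, of "B * inverse (1 + y\<^sup>2)"]
    have "cmod (g (x, y)) \<le> norm (B * inverse (1 + y\<^sup>2) * inverse (1 + x\<^sup>2))"
      "cmod (g (y, x)) \<le> norm (B * inverse (1 + y\<^sup>2) * inverse (1 + x\<^sup>2))" for x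
      using B(2)[of "(x, y)"] B(2)[of "(y, x)"] B(1) by (simp_all add: decay_def abs_mult mult_ac)
    then show "integrable lborel (\<lambda>x. g (x, y))" "integrable lborel (\<lambda>x. g (y, x))"
      by (auto intro!: Bochner_Integration.integrable_bound[OF i])
  qed
  have cont: "continuous_on UNIV (\<lambda>x. g (x, y))" "continuous_on UNIV (\<lambda>x. g (y, x))" if "decaying g" for g and y :: real
    using that by (auto simp: decaying_def intro!: continuous_intros elim!: continuous_on_compose2)
  have int: "integrable (lborel \<Otimes>\<^sub>M lborel) g" if "decaying g" for g
    using decaying_integrable[OF that] by (simp add: lborel_prod)
  have "(LINT x|lborel. f\<^sub>x (x, y)) = 0" for y
    by (rule integral_derivative_eq_0[OF partial_derivatives(1)[OF D] cont(1)[OF fx] sec(1)[OF f] sec(1)[OF fx]])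
  then have "(LINT z|(lborel \<Otimes>\<^sub>M lborel). f\<^sub>x z) = 0"
    using lborel_pair.integral_snd[of "\<lambda>x y. f\<^sub>x (x, y)"] int[OF fx] by (simp add: case_prod_eta)
  then show "(LINT z|lborel. f\<^sub>x z) = 0" by (simp add: lborel_prod)
  have "(LINT y|lborel. f\<^sub>y (x, y)) = 0" for x
    by (rule integral_derivative_eq_0[OF partial_derivatives(2)[OF D] cont(2)[OF fy] sec(2)[OF f] sec(2)[OF fy]])
  then have "(LINT z|(lborel \<Otimes>\<^sub>M lborel). f\<^sub>y z) = 0"
    using lborel_pair.integral_fst'[OF int[OF fy]] by simp
  then show "(LINT z|lborel. f\<^sub>y z) = 0" by (simp add: lborel_prod)
qed

lemma diff_op_integration_by_parts:
  assumes f: "schwartz f" and g: "schwartz g"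
  shows "(LINT z|lborel. cnj (f z) * diff_op g z) = - (LINT z|lborel. cnj (diff_op f z) * g z)"
proof -
  obtain f\<^sub>x f\<^sub>y where f': "\<And>z. (f has_derivative (\<lambda>(h, k). h *\<^sub>R f\<^sub>x z + k *\<^sub>R f\<^sub>y z)) (at z)" "schwartz f\<^sub>x" "schwartz f\<^sub>y"
    using f by (rule schwartzE) blast
  obtain g\<^sub>x g\<^sub>y where g': "\<And>z. (g has_derivative (\<lambda>(h, k). h *\<^sub>R g\<^sub>x z + k *\<^sub>R g\<^sub>y z)) (at z)" "schwartz g\<^sub>x" "schwartz g\<^sub>y"
    using g by (rule schwartzE) blast
  have D: "((\<lambda>z. cnj (f z) * g z) has_derivative
      (\<lambda>(h, k). h *\<^sub>R (cnj (f z) * g\<^sub>x z + cnj (f\<^sub>x z) * g z) + k *\<^sub>R (cnj (f z) * g\<^sub>y z + cnj (f\<^sub>y z) * g z))) (at z)" for z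
    by (rule has_derivative_eq_rhs[OF has_derivative_mult[OF bounded_linear.has_derivative[OF bounded_linear_cnj f'(1)] g'(1)]])
      (auto simp: fun_eq_iff scaleR_conv_of_real algebra_simps)
  note dec = schwartz_decaying[OF f] schwartz_decaying[OF g] schwartz_decaying[OF f'(2)] schwartz_decaying[OF f'(3)]
    schwartz_decaying[OF g'(2)] schwartz_decaying[OF g'(3)]
  note int = decaying_integrable[OF decaying_cnj_mult]
  note zero = integral_partial_derivatives_eq_0[OF D, OF decaying_cnj_mult decaying_add[OF decaying_cnj_mult decaying_cnj_mult]
      decaying_add[OF decaying_cnj_mult decaying_cnj_mult], OF dec(1,2) dec(1,5) dec(3,2) dec(1,6) dec(4,2)]
  have "(LINT z|lborel. cnj (f z) * g\<^sub>x z) = - (LINT z|lborel. cnj (f\<^sub>x z) * g z)"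
    "(LINT z|lborel. cnj (f z) * g\<^sub>y z) = - (LINT z|lborel. cnj (f\<^sub>y z) * g z)"
    using zero int[OF dec(1,5)] int[OF dec(3,2)] int[OF dec(1,6)] int[OF dec(4,2)]
    by (simp_all add: eq_neg_iff_add_eq_0)
  then show ?thesis
    using int[OF dec(1,5)] int[OF dec(3,2)] int[OF dec(1,6)] int[OF dec(4,2)]
    by (simp add: diff_op_eq[OF f'(1)] diff_op_eq[OF g'(1)] left_diff_distrib right_diff_distrib)
qed

lemma cost_expr_altdef:
  "cost_expr hbar f z = of_real ((fst z - snd z)\<^sup>2) * f z - of_real (hbar\<^sup>2) * diff_op (diff_op f) z - of_real (2 * hbar) * f z"
  by (simp add: cost_expr_def case_prod_unfold)

lemma square_integrable_cost_expr:
  assumes f: "schwartz f"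
  shows "square_integrable (cost_expr hbar f)"
proof -
  \<comment> \<open>The quarter absorbs the constant in
    \<open>(x - y)^2 <= 4 * (1 + norm z)^2\<close>, since \<open>schwartz_decaying_mult\<close>
    expects a bound by a pure power.\<close>
  have "decaying (\<lambda>z. of_real ((fst z - snd z)\<^sup>2) / 4 * f z)"
  proof (rule schwartz_decaying_mult[OF f])
    show "continuous_on UNIV (\<lambda>z :: real \<times> real. complex_of_real ((fst z - snd z)\<^sup>2) / 4)"
      by (intro continuous_intros) auto
    fix z :: "real \<times> real"
    have "\<bar>fst z - snd z\<bar> \<le> 2 * (1 + norm z)"
      using abs_fst_le_norm[of z] abs_snd_le_norm[of z] abs_triangle_ineq4[of "fst z" "snd z"] by simp
    then have "\<bar>fst z - snd z\<bar>\<^sup>2 \<le> (2 * (1 + norm z))\<^sup>2" by (intro power_mono) auto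
    then have "(fst z - snd z)\<^sup>2 \<le> 2\<^sup>2 * (1 + norm z)\<^sup>2" by (simp only: power_mult_distrib power2_abs)
    moreover have "complex_of_real ((fst z - snd z)\<^sup>2) / 4 = of_real ((fst z - snd z)\<^sup>2 / 4)" by simp
    ultimately show "cmod (complex_of_real ((fst z - snd z)\<^sup>2) / 4) \<le> (1 + norm z) ^ 2"
      by (simp only: norm_of_real) simp
  qed
  from decaying_scale[OF this, of 4] have M: "decaying (\<lambda>z. of_real ((fst z - snd z)\<^sup>2) * f z)" by simp
  have "decaying (cost_expr hbar f)"
    unfolding cost_expr_altdef[abs_def]
    by (intro decaying_diff decaying_scale M schwartz_decaying[OF f]
        schwartz_decaying[OF schwartz_diff_op[OF schwartz_diff_op[OF f]]])
  then show ?thesis by (rule decaying_square_integrable)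
qed

lemma cost_expr_symmetric:
  assumes f: "schwartz f" and g: "schwartz g"
  shows "cinner (abs_L2 (cost_expr hbar f)) (abs_L2 g) = cinner (abs_L2 f) (abs_L2 (cost_expr hbar g))"
proof -
  note sq = decaying_square_integrable[OF schwartz_decaying]
  have int: "integrable lborel (\<lambda>z. cnj (u z) * v z)" if "schwartz u" "schwartz v" for u v
    using that by (intro integrable_cnj_mult sq)
  have DD: "(LINT z|lborel. cnj (f z) * diff_op (diff_op g) z) = (LINT z|lborel. cnj (diff_op (diff_op f) z) * g z)"
    using diff_op_integration_by_parts[OF f schwartz_diff_op[OF g]] diff_op_integration_by_parts[OF schwartz_diff_op[OF f] g]
    by simp
  have "(LINT z|lborel. cnj (cost_expr hbar f z) * g z) - (LINT z|lborel. cnj (f z) * cost_expr hbar g z) =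
      (LINT z|lborel. cnj (cost_expr hbar f z) * g z - cnj (f z) * cost_expr hbar g z)"
    using f g by (intro Bochner_Integration.integral_diff[symmetric] integrable_cnj_mult square_integrable_cost_expr sq)
  also have "\<dots> = (LINT z|lborel. of_real (hbar\<^sup>2) * (cnj (f z) * diff_op (diff_op g) z - cnj (diff_op (diff_op f) z) * g z))"
    by (intro Bochner_Integration.integral_cong refl) (simp add: cost_expr_altdef algebra_simps)
  also have "\<dots> = 0"
    using int[OF f schwartz_diff_op[OF schwartz_diff_op[OF g]]] int[OF schwartz_diff_op[OF schwartz_diff_op[OF f]] g] DD
    by simp
  finally show ?thesis using f g by (simp add: cinner_abs_L2 sq square_integrable_cost_expr)
qed


subsection \<open>Polynomials times Gaussians\<close>

text \<open>Polynomial combinations of Gaussians of one fixed width. Arbitrary centres cover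
  products of coherent states; closure under partial derivatives makes the class an invariant for
  the coinductive \<open>schwartz\<close>.\<close>

inductive poly_gauss :: "real \<Rightarrow> (real \<times> real \<Rightarrow> complex) \<Rightarrow> bool" for hbar :: real where
  gauss: "poly_gauss hbar (\<lambda>z. of_real (exp (- ((fst z - c)\<^sup>2 + (snd z - d)\<^sup>2) / (2 * hbar))))"
| mult_fst: "poly_gauss hbar f \<Longrightarrow> poly_gauss hbar (\<lambda>z. of_real (fst z) * f z)"
| mult_snd: "poly_gauss hbar f \<Longrightarrow> poly_gauss hbar (\<lambda>z. of_real (snd z) * f z)"
| add: "poly_gauss hbar f \<Longrightarrow> poly_gauss hbar g \<Longrightarrow> poly_gauss hbar (\<lambda>z. f z + g z)"
| scale: "poly_gauss hbar f \<Longrightarrow> poly_gauss hbar (\<lambda>z. c * f z)"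

lemma poly_gauss_bound:
  assumes hbar: "0 < hbar" and f: "poly_gauss hbar f"
  shows "\<exists>B. \<forall>z. (1 + norm z) ^ n * cmod (f z) \<le> B"
  using f
proof (induction arbitrary: n)
  case (gauss c d)
  define A where "A = 1 + norm (c, d)"
  have "(1 + norm z) ^ n * cmod (of_real (exp (- ((fst z - c)\<^sup>2 + (snd z - d)\<^sup>2) / (2 * hbar)))) \<le> fact n * exp (A + hbar / 2)" for z
  proof -
    define t where "t = norm (z - (c, d))"
    have t: "t\<^sup>2 = (fst z - c)\<^sup>2 + (snd z - d)\<^sup>2" by (simp add: t_def norm_prod_def)
    have "1 + norm z \<le> A + t"
      using norm_triangle_sub[of z "(c, d)"] by (simp add: A_def t_def)
    then have "(1 + norm z) ^ n \<le> (A + t) ^ n" by (intro power_mono) auto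
    \<comment> \<open>A single term of the exponential series is bounded by the whole
      series.\<close>
    also have "\<dots> \<le> fact n * exp (A + t)"
    proof -
      have nn: "0 \<le> A + t" by (simp add: A_def t_def)
      have "(A + t) ^ n /\<^sub>R fact n \<le> exp (A + t)"
        using exp_converges[of "A + t"] nn sum_le_suminf[of "\<lambda>k. (A + t) ^ k /\<^sub>R fact k" "{n}"]
        by (auto simp: sums_iff)
      then show ?thesis by (simp add: field_simps)
    qed
    finally have "(1 + norm z) ^ n * exp (- t\<^sup>2 / (2 * hbar)) \<le> fact n * exp (A + t) * exp (- t\<^sup>2 / (2 * hbar))"
      by (intro mult_right_mono) auto
    also have "\<dots> = fact n * exp (A + t - t\<^sup>2 / (2 * hbar))" by (simp add: exp_diff exp_minus field_simps)
    also have "\<dots> \<le> fact n * exp (A + hbar / 2)"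
    proof -
      \<comment> \<open>Completing the square bounds \<open>t - t^2 / (2 * hbar)\<close> by
        \<open>hbar / 2\<close>.\<close>
      have "0 \<le> (t - hbar)\<^sup>2 / (2 * hbar)" using hbar by simp
      also have "\<dots> = t\<^sup>2 / (2 * hbar) - t + hbar / 2" using hbar by (simp add: power2_diff field_simps power2_eq_square)
      finally show ?thesis by simp
    qed
    finally show ?thesis by (simp add: t)
  qed
  then show ?case by blast
next
  case (mult_fst f)
  then obtain B where B: "\<And>z. (1 + norm z) ^ Suc n * cmod (f z) \<le> B" by blast
  have "(1 + norm z) ^ n * cmod (of_real (fst z) * f z) \<le> B" for z
  proof -
    have "\<bar>fst z\<bar> \<le> 1 + norm z" using abs_fst_le_norm[of z] by simp
    then have "(1 + norm z) ^ n * cmod (f z) * \<bar>fst z\<bar> \<le> (1 + norm z) ^ n * cmod (f z) * (1 + norm z)"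
      by (intro mult_left_mono) auto
    then show ?thesis using B[of z] by (simp add: norm_mult mult_ac)
  qed
  then show ?case by blast
next
  case (mult_snd f)
  then obtain B where B: "\<And>z. (1 + norm z) ^ Suc n * cmod (f z) \<le> B" by blast
  have "(1 + norm z) ^ n * cmod (of_real (snd z) * f z) \<le> B" for z
  proof -
    have "\<bar>snd z\<bar> \<le> 1 + norm z" using abs_snd_le_norm[of z] by simp
    then have "(1 + norm z) ^ n * cmod (f z) * \<bar>snd z\<bar> \<le> (1 + norm z) ^ n * cmod (f z) * (1 + norm z)"
      by (intro mult_left_mono) auto
    then show ?thesis using B[of z] by (simp add: norm_mult mult_ac)
  qed
  then show ?case by blast
next
  case (add f g)
  then obtain B C where B: "\<And>z. (1 + norm z) ^ n * cmod (f z) \<le> B" "\<And>z. (1 + norm z) ^ n * cmod (g z) \<le> C" by blast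
  have "(1 + norm z) ^ n * cmod (f z + g z) \<le> B + C" for z
    using mult_left_mono[OF norm_triangle_ineq[of "f z" "g z"], of "(1 + norm z) ^ n"] B[of z]
    by (simp add: distrib_left)
  then show ?case by blast
next
  case (scale f c)
  then obtain B where B: "\<And>z. (1 + norm z) ^ n * cmod (f z) \<le> B" by blast
  have "(1 + norm z) ^ n * cmod (c * f z) \<le> cmod c * B" for z
    using mult_left_mono[OF B[of z], of "cmod c"] by (simp add: norm_mult mult_ac)
  then show ?case by blast
qed

lemma poly_gauss_derivative:
  assumes hbar: "0 < hbar" and f: "poly_gauss hbar f"
  shows "\<exists>f\<^sub>x f\<^sub>y. poly_gauss hbar f\<^sub>x \<and> poly_gauss hbar f\<^sub>y \<and>
    (\<forall>z. (f has_derivative (\<lambda>(h, k). h *\<^sub>R f\<^sub>x z + k *\<^sub>R f\<^sub>y z)) (at z))"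
  using f
proof induction
  case (gauss c d)
  define g where "g z = complex_of_real (exp (- ((fst z - c)\<^sup>2 + (snd z - d)\<^sup>2) / (2 * hbar)))" for z :: "real \<times> real"
  have g: "poly_gauss hbar g" unfolding g_def by (rule poly_gauss.gauss)
  have "(g has_derivative (\<lambda>(h, k). h *\<^sub>R ((- 1 / hbar) * (of_real (fst z) * g z) + (c / hbar) * g z)
      + k *\<^sub>R ((- 1 / hbar) * (of_real (snd z) * g z) + (d / hbar) * g z))) (at z)" for z
  proof -
    define E where "E z = exp (- ((fst z - c)\<^sup>2 + (snd z - d)\<^sup>2) / (2 * hbar))" for z :: "real \<times> real"
    have "(E has_derivative (\<lambda>(h, k). h * (- (fst z - c) / hbar * E z) + k * (- (snd z - d) / hbar * E z))) (at z)"
      unfolding E_def using hbar by (auto intro!: derivative_eq_intros simp: fun_eq_iff field_simps)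
    then have D: "((\<lambda>z. of_real (E z)) has_derivative (\<lambda>(h, k). complex_of_real (h * (- (fst z - c) / hbar * E z)
        + k * (- (snd z - d) / hbar * E z)))) (at z)"
      by (rule has_derivative_eq_rhs[OF has_derivative_of_real]) auto
    have gE: "g = (\<lambda>z. of_real (E z))" by (simp add: g_def E_def fun_eq_iff)
    show ?thesis
      unfolding gE by (rule has_derivative_eq_rhs[OF D])
        (auto simp: fun_eq_iff scaleR_conv_of_real diff_divide_distrib algebra_simps)
  qed
  moreover have "poly_gauss hbar (\<lambda>z. (- 1 / hbar) * (of_real (fst z) * g z) + (c / hbar) * g z)"
    "poly_gauss hbar (\<lambda>z. (- 1 / hbar) * (of_real (snd z) * g z) + (d / hbar) * g z)"
    by (intro poly_gauss.intros(2-) g)+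
  ultimately show ?case unfolding g_def[abs_def, symmetric]
    by (intro exI[of _ "\<lambda>z. (- 1 / hbar) * (of_real (fst z) * g z) + (c / hbar) * g z"]
        exI[of _ "\<lambda>z. (- 1 / hbar) * (of_real (snd z) * g z) + (d / hbar) * g z"] conjI allI)
next
  case (mult_fst f)
  then obtain f\<^sub>x f\<^sub>y where f': "poly_gauss hbar f\<^sub>x" "poly_gauss hbar f\<^sub>y"
    "\<And>z. (f has_derivative (\<lambda>(h, k). h *\<^sub>R f\<^sub>x z + k *\<^sub>R f\<^sub>y z)) (at z)" by blast
  have "((\<lambda>z. of_real (fst z) * f z) has_derivative
      (\<lambda>(h, k). h *\<^sub>R (f z + of_real (fst z) * f\<^sub>x z) + k *\<^sub>R (of_real (fst z) * f\<^sub>y z))) (at z)" for z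
    by (rule has_derivative_eq_rhs[OF has_derivative_mult[OF has_derivative_of_real[OF has_derivative_fst[OF has_derivative_ident]] f'(3)]])
      (auto simp: fun_eq_iff scaleR_conv_of_real algebra_simps)
  then show ?case using mult_fst.hyps f'(1,2)
    by (intro exI[of _ "\<lambda>z. f z + of_real (fst z) * f\<^sub>x z"] exI[of _ "\<lambda>z. of_real (fst z) * f\<^sub>y z"]
        conjI allI poly_gauss.intros(2-))
next
  case (mult_snd f)
  then obtain f\<^sub>x f\<^sub>y where f': "poly_gauss hbar f\<^sub>x" "poly_gauss hbar f\<^sub>y"
    "\<And>z. (f has_derivative (\<lambda>(h, k). h *\<^sub>R f\<^sub>x z + k *\<^sub>R f\<^sub>y z)) (at z)" by blast
  have "((\<lambda>z. of_real (snd z) * f z) has_derivative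
      (\<lambda>(h, k). h *\<^sub>R (of_real (snd z) * f\<^sub>x z) + k *\<^sub>R (f z + of_real (snd z) * f\<^sub>y z))) (at z)" for z
    by (rule has_derivative_eq_rhs[OF has_derivative_mult[OF has_derivative_of_real[OF has_derivative_snd[OF has_derivative_ident]] f'(3)]])
      (auto simp: fun_eq_iff scaleR_conv_of_real algebra_simps)
  then show ?case using mult_snd.hyps f'(1,2)
    by (intro exI[of _ "\<lambda>z. of_real (snd z) * f\<^sub>x z"] exI[of _ "\<lambda>z. f z + of_real (snd z) * f\<^sub>y z"]
        conjI allI poly_gauss.intros(2-))
next
  case (add f g)
  then obtain f\<^sub>x f\<^sub>y g\<^sub>x g\<^sub>y where f': "poly_gauss hbar f\<^sub>x" "poly_gauss hbar f\<^sub>y" "poly_gauss hbar g\<^sub>x" "poly_gauss hbar g\<^sub>y"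
    and D: "\<And>z. (f has_derivative (\<lambda>(h, k). h *\<^sub>R f\<^sub>x z + k *\<^sub>R f\<^sub>y z)) (at z)"
      "\<And>z. (g has_derivative (\<lambda>(h, k). h *\<^sub>R g\<^sub>x z + k *\<^sub>R g\<^sub>y z)) (at z)" by blast
  have "((\<lambda>z. f z + g z) has_derivative (\<lambda>(h, k). h *\<^sub>R (f\<^sub>x z + g\<^sub>x z) + k *\<^sub>R (f\<^sub>y z + g\<^sub>y z))) (at z)" for z
    by (rule has_derivative_eq_rhs[OF has_derivative_add[OF D]]) (auto simp: algebra_simps)
  then show ?case using f'
    by (intro exI[of _ "\<lambda>z. f\<^sub>x z + g\<^sub>x z"] exI[of _ "\<lambda>z. f\<^sub>y z + g\<^sub>y z"] conjI allI poly_gauss.add)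
next
  case (scale f c)
  then obtain f\<^sub>x f\<^sub>y where f': "poly_gauss hbar f\<^sub>x" "poly_gauss hbar f\<^sub>y"
    "\<And>z. (f has_derivative (\<lambda>(h, k). h *\<^sub>R f\<^sub>x z + k *\<^sub>R f\<^sub>y z)) (at z)" by blast
  have "((\<lambda>z. c * f z) has_derivative (\<lambda>(h, k). h *\<^sub>R (c * f\<^sub>x z) + k *\<^sub>R (c * f\<^sub>y z))) (at z)" for z
    by (rule has_derivative_eq_rhs[OF has_derivative_mult_right[OF f'(3)]])
      (auto simp: fun_eq_iff algebra_simps)
  then show ?case using f'(1,2)
    by (intro exI[of _ "\<lambda>z. c * f\<^sub>x z"] exI[of _ "\<lambda>z. c * f\<^sub>y z"] conjI allI poly_gauss.scale)
qed

text \<open>Coinduction with \<open>poly_gauss\<close> as invariant: its members decay rapidly and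
  have partial derivatives in the same class.\<close>

lemma poly_gauss_schwartz:
  assumes hbar: "0 < hbar" and f: "poly_gauss hbar f"
  shows "schwartz f"
  using f
proof (coinduction arbitrary: f)
  case (schwartz f)
  have "bounded (range (\<lambda>z. (1 + norm z) ^ n *\<^sub>R f z))" for n :: nat
    using poly_gauss_bound[OF hbar schwartz, of n] by (auto simp: bounded_iff)
  then show ?case using poly_gauss_derivative[OF hbar schwartz] by blast
qed

lemma poly_gauss_poly:
  assumes f: "poly_gauss hbar f"
  shows "poly_gauss hbar (\<lambda>z. of_real (poly p (s * fst z + t * snd z)) * f z)"
proof (induction p)
  case 0
  show ?case using poly_gauss.scale[OF f, of 0] by simp
next
  case (pCons u p)
  define g where "g z = of_real (poly p (s * fst z + t * snd z)) * f z" for z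
  have g: "poly_gauss hbar g" using pCons by (simp add: g_def[abs_def])
  have "poly_gauss hbar (\<lambda>z. of_real u * f z + (of_real s * (of_real (fst z) * g z) + of_real t * (of_real (snd z) * g z)))"
    by (intro poly_gauss.intros(2-) f g)
  then show ?case by (simp add: g_def algebra_simps)
qed


subsection \<open>Eigenfunctions of the cost\<close>

definition gauss_fun :: "real \<Rightarrow> real poly \<Rightarrow> real \<Rightarrow> complex" where
  "gauss_fun \<kappa> p u = of_real (poly p u * exp (- u\<^sup>2 / (2 * \<kappa>)))"

text \<open>The derivative conjugated by the Gaussian: the polynomial factor of the derivative of
  \<open>gauss_fun\<close>.\<close>

definition gauss_deriv :: "real \<Rightarrow> real poly \<Rightarrow> real poly" where
  "gauss_deriv \<kappa> p = pderiv p - smult (1 / \<kappa>) ([:0, 1:] * p)"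

lemma hermite_fun_eq: "0 < \<kappa> \<Longrightarrow> hermite_fun \<kappa> n = gauss_fun \<kappa> (smult (hermite_const \<kappa> n) (hermite \<kappa> n))"
  by (simp add: fun_eq_iff hermite_fun_def gauss_fun_def)

lemma gauss_fun_derivative:
  assumes "0 < \<kappa>"
  shows "(gauss_fun \<kappa> p has_vector_derivative gauss_fun \<kappa> (gauss_deriv \<kappa> p) u) (at u)"
proof -
  have "((\<lambda>u. poly p u * exp (- u\<^sup>2 / (2 * \<kappa>))) has_real_derivative
      (poly (gauss_deriv \<kappa> p) u * exp (- u\<^sup>2 / (2 * \<kappa>)))) (at u)"
    using assms by (auto intro!: derivative_eq_intros poly_DERIV simp: gauss_deriv_def field_simps)
  then show ?thesis
    unfolding gauss_fun_def[abs_def]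
    by (intro has_vector_derivative_of_real) (simp add: has_real_derivative_iff_has_vector_derivative)
qed

text \<open>In relative and mean coordinates the difference of the partial derivatives is twice the
  derivative in the relative coordinate; the two contributions through the mean cancel.\<close>

lemma diff_op_gauss_fun:
  assumes \<kappa>: "0 < \<kappa>" and \<nu>: "0 < \<nu>"
  shows "diff_op (\<lambda>z. c * (gauss_fun \<kappa> p (fst (rel_mean z)) * gauss_fun \<nu> q (snd (rel_mean z)))) =
    (\<lambda>z. (2 * c) * (gauss_fun \<kappa> (gauss_deriv \<kappa> p) (fst (rel_mean z)) * gauss_fun \<nu> q (snd (rel_mean z))))"
proof
  fix z :: "real \<times> real"
  obtain x y where z: "z = (x, y)" by (cases z)
  have chain: "((\<lambda>s. gauss_fun \<kappa> p (l s)) has_vector_derivative l' *\<^sub>R gauss_fun \<kappa> (gauss_deriv \<kappa> p) (l s)) (at s)"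
    if "(l has_real_derivative l') (at s)" "0 < \<kappa>" for l l' s \<kappa> p
    using vector_diff_chain_at[OF _ gauss_fun_derivative[OF that(2)], of l l' s p] that(1)
    by (simp add: o_def has_real_derivative_iff_has_vector_derivative)
  have d: "((\<lambda>s. s - y) has_real_derivative 1) (at x)" "((\<lambda>s. (s + y) / 2) has_real_derivative 1 / 2) (at x)"
    "((\<lambda>s. x - s) has_real_derivative - 1) (at y)" "((\<lambda>s. (x + s) / 2) has_real_derivative 1 / 2) (at y)"
    by (auto intro!: derivative_eq_intros)
  note dx = has_vector_derivative_mult[OF has_vector_derivative_const[of c]
      has_vector_derivative_mult[OF chain[OF d(1) \<kappa>, of p] chain[OF d(2) \<nu>, of q]]]
  note dy = has_vector_derivative_mult[OF has_vector_derivative_const[of c]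
      has_vector_derivative_mult[OF chain[OF d(3) \<kappa>, of p] chain[OF d(4) \<nu>, of q]]]
  show "diff_op (\<lambda>z. c * (gauss_fun \<kappa> p (fst (rel_mean z)) * gauss_fun \<nu> q (snd (rel_mean z)))) z =
      (2 * c) * (gauss_fun \<kappa> (gauss_deriv \<kappa> p) (fst (rel_mean z)) * gauss_fun \<nu> q (snd (rel_mean z)))"
    using vector_derivative_at[OF dx] vector_derivative_at[OF dy]
    by (simp add: z diff_op_def rel_mean_def algebra_simps)
qed

text \<open>The width \<open>2 * hbar\<close> is that of the oscillator in \<open>x - y\<close>. The
  cost does not act on the mean; the width \<open>hbar / 2\<close> there makes the product Gaussian
  isotropic of width \<open>hbar\<close>, so that the function is a
  \<open>poly_gauss\<close>.\<close>

definition osc_fun :: "real \<Rightarrow> nat \<times> nat \<Rightarrow> real \<times> real \<Rightarrow> complex" where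
  "osc_fun hbar = (\<lambda>(n, m) z. hermite_fun (2 * hbar) n (fst (rel_mean z)) * hermite_fun (hbar / 2) m (snd (rel_mean z)))"

text \<open>With \<kappa> = 2 hbar and w the relative coordinate, the cost reads w^2 - \<kappa>^2
  (d/dw)^2 - \<kappa>. On the polynomial factor the eigenvalue equation is \<kappa> times the
  Hermite equation, with eigenvalue 2 \<kappa> n = 4 hbar n.\<close>

lemma cost_expr_osc_fun:
  assumes hbar: "0 < hbar"
  shows "cost_expr hbar (osc_fun hbar (n, m)) = (\<lambda>z. of_real (4 * hbar * real n) * osc_fun hbar (n, m) z)"
proof
  fix z
  define \<kappa> where "\<kappa> = 2 * hbar"
  have \<kappa>: "0 < \<kappa>" "0 < hbar / 2" using hbar by (auto simp: \<kappa>_def)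
  define p where "p = smult (hermite_const \<kappa> n) (hermite \<kappa> n)"
  define q where "q = smult (hermite_const (hbar / 2) m) (hermite (hbar / 2) m)"
  define w v where "w = fst (rel_mean z)" and "v = snd (rel_mean z)"
  have osc: "osc_fun hbar (n, m) = (\<lambda>z. 1 * (gauss_fun \<kappa> p (fst (rel_mean z)) * gauss_fun (hbar / 2) q (snd (rel_mean z))))"
    using hbar by (simp add: osc_fun_def hermite_fun_eq p_def q_def \<kappa>_def)
  have ode: "[:0, 2:] * pderiv p - smult \<kappa> (pderiv (pderiv p)) = smult (2 * real n) p"
    using arg_cong[OF hermite_ode[OF \<kappa>(1), of n], of "smult (hermite_const \<kappa> n)"]
    by (simp add: p_def pderiv_smult smult_diff_right mult.commute)
  have poly_id: "w\<^sup>2 * poly p w - \<kappa>\<^sup>2 * poly (gauss_deriv \<kappa> (gauss_deriv \<kappa> p)) w - \<kappa> * poly p w = 2 * \<kappa> * real n * poly p w"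
  proof -
    have "\<kappa> * (2 * w * poly (pderiv p) w - \<kappa> * poly (pderiv (pderiv p)) w) = \<kappa> * (2 * real n * poly p w)"
      using arg_cong[OF ode, of "\<lambda>r. poly r w"] by simp
    then show ?thesis
      using \<kappa> by (simp add: gauss_deriv_def pderiv_diff pderiv_smult pderiv_pCons pderiv_mult field_simps power2_eq_square)
  qed
  have "cost_expr hbar (osc_fun hbar (n, m)) z =
      of_real ((w\<^sup>2 * poly p w - \<kappa>\<^sup>2 * poly (gauss_deriv \<kappa> (gauss_deriv \<kappa> p)) w - \<kappa> * poly p w) * exp (- w\<^sup>2 / (2 * \<kappa>)))
        * gauss_fun (hbar / 2) q v"
    unfolding cost_expr_altdef osc diff_op_gauss_fun[OF \<kappa>]
    by (simp add: w_def v_def rel_mean_def case_prod_unfold gauss_fun_def \<kappa>_def power_mult_distrib algebra_simps)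
  also have "\<dots> = of_real (4 * hbar * real n) * osc_fun hbar (n, m) z"
    unfolding poly_id osc by (simp add: w_def v_def gauss_fun_def \<kappa>_def)
  finally show "cost_expr hbar (osc_fun hbar (n, m)) z = of_real (4 * hbar * real n) * osc_fun hbar (n, m) z" .
qed

lemma schwartz_osc_fun:
  assumes hbar: "0 < hbar"
  shows "schwartz (osc_fun hbar i)"
proof -
  obtain n m where i: "i = (n, m)" by (cases i)
  define p where "p = smult (hermite_const (2 * hbar) n) (hermite (2 * hbar) n)"
  define q where "q = smult (hermite_const (hbar / 2) m) (hermite (hbar / 2) m)"
  define g where "g z = complex_of_real (exp (- ((fst z - 0)\<^sup>2 + (snd z - 0)\<^sup>2) / (2 * hbar)))" for z :: "real \<times> real"
  have "poly_gauss hbar (\<lambda>z. of_real (poly p (1 * fst z + (-1) * snd z)) * (of_real (poly q (1/2 * fst z + 1/2 * snd z)) * g z))"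
    unfolding g_def by (intro poly_gauss_poly poly_gauss.gauss)
  also have "(\<lambda>z. of_real (poly p (1 * fst z + (-1) * snd z)) * (of_real (poly q (1/2 * fst z + 1/2 * snd z)) * g z)) = osc_fun hbar i"
  proof
    fix z :: "real \<times> real"
    obtain x y where z: "z = (x, y)" by (cases z)
    have "exp (- (x - y)\<^sup>2 / (2 * (2 * hbar))) * exp (- ((x + y) / 2)\<^sup>2 / (2 * (hbar / 2))) = exp (- (x\<^sup>2 + y\<^sup>2) / (2 * hbar))"
      unfolding exp_add[symmetric] using hbar by (simp add: field_simps power2_eq_square)
    moreover have "osc_fun hbar i z = of_real (poly p (x - y)) * of_real (poly q ((x + y) / 2)) *
        of_real (exp (- (x - y)\<^sup>2 / (2 * (2 * hbar))) * exp (- ((x + y) / 2)\<^sup>2 / (2 * (hbar / 2))))"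
      using hbar by (simp add: osc_fun_def i hermite_fun_eq p_def q_def gauss_fun_def z rel_mean_def)
    ultimately show "of_real (poly p (1 * fst z + (-1) * snd z)) * (of_real (poly q (1/2 * fst z + 1/2 * snd z)) * g z) = osc_fun hbar i z"
      by (simp add: g_def z add_divide_distrib)
  qed
  finally show ?thesis by (rule poly_gauss_schwartz[OF hbar])
qed

lemma onb_hermite_tensor:
  assumes hbar: "0 < hbar"
  shows "onb_on (UNIV \<times> UNIV) (\<lambda>(i, j). hermite_vec hbar i \<otimes>\<^sub>v hermite_vec hbar j)"
  by (intro onb_tensor onb_hermite hbar)

lemma onb_osc_fun:
  assumes hbar: "0 < hbar"
  shows "onb_on UNIV (\<lambda>i. abs_L2 (osc_fun hbar i))"
proof -
  have h: "0 < 2 * hbar" "0 < hbar / 2" using hbar by auto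
  define F where "F = (\<lambda>(n, m) (x, y). hermite_fun (2 * hbar) n x * hermite_fun (hbar / 2) m y)"
  have "onb_on (UNIV \<times> UNIV) (\<lambda>(i, j). hermite_vec (2 * hbar) i \<otimes>\<^sub>v hermite_vec (hbar / 2) j)"
    by (intro onb_tensor onb_hermite h)
  moreover have "(\<lambda>(i, j). hermite_vec (2 * hbar) i \<otimes>\<^sub>v hermite_vec (hbar / 2) j) = (\<lambda>i. abs_L2 (F i))"
    using h by (auto simp: fun_eq_iff F_def hermite_vec_def tensor_abs_L2 square_integrable_hermite_fun)
  moreover have "square_integrable (F i)" for i
    using h by (cases i) (auto simp: F_def intro!: square_integrable_tensor square_integrable_hermite_fun)
  ultimately have "onb_on (UNIV \<times> UNIV) (\<lambda>i. abs_L2 (\<lambda>z. F i (rel_mean z)))"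
    by (intro onb_rel_mean) auto
  moreover have "(\<lambda>i. abs_L2 (\<lambda>z. F i (rel_mean z))) = (\<lambda>i. abs_L2 (osc_fun hbar i))"
    by (simp add: F_def osc_fun_def case_prod_unfold)
  ultimately show ?thesis by simp
qed

lemma square_integrable_schwartz: "schwartz f \<Longrightarrow> square_integrable f"
  by (intro decaying_square_integrable schwartz_decaying)

text \<open>Symmetry of the expression moves it from \<open>f\<close> to the eigenfunction, which is
  itself Schwartz.\<close>

lemma schwartz_in_diag_graph:
  assumes hbar: "0 < hbar" and f: "schwartz f"
  shows "(abs_L2 f, abs_L2 (cost_expr hbar f)) \<in> diag_graph UNIV (\<lambda>i. abs_L2 (osc_fun hbar i)) (\<lambda>i. 4 * hbar * real (fst i))"
  unfolding diag_graph_def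
proof safe
  fix n m
  have "cinner (abs_L2 (osc_fun hbar (n, m))) (abs_L2 (cost_expr hbar f)) =
      cinner (of_real (4 * hbar * real n) *\<^sub>C abs_L2 (osc_fun hbar (n, m))) (abs_L2 f)"
    unfolding cost_expr_symmetric[OF schwartz_osc_fun[OF hbar] f, symmetric] cost_expr_osc_fun[OF hbar]
    by (simp only: abs_L2_scaleC square_integrable_schwartz[OF schwartz_osc_fun[OF hbar]])
  then show "cinner (abs_L2 (osc_fun hbar (n, m))) (abs_L2 (cost_expr hbar f)) =
      of_real (4 * hbar * real (fst (n, m))) * cinner (abs_L2 (osc_fun hbar (n, m))) (abs_L2 f)"
    by (simp add: cinner_scaleC_left)
qed

text \<open>The expression on Schwartz functions lies inside the diagonal graph, which is
  self-adjoint, so passing to adjoints gives one inclusion. Conversely, the eigenfunctions are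
  admissible test functions, and testing against them yields the coefficient equations.\<close>

lemma cost_graph_eq_diag_graph:
  assumes hbar: "0 < hbar"
  shows "cost_graph hbar = diag_graph UNIV (\<lambda>i. abs_L2 (osc_fun hbar i)) (\<lambda>i. 4 * hbar * real (fst i))"
    (is "_ = ?D")
proof
  have "{(abs_L2 f, abs_L2 (cost_expr hbar f)) | f. schwartz f} \<subseteq> ?D"
    using schwartz_in_diag_graph[OF hbar] by auto
  from adjoint_graph_mono[OF this] show "?D \<subseteq> cost_graph hbar"
    by (simp add: cost_graph_def adjoint_diag_graph[OF onb_osc_fun[OF hbar]])
  show "cost_graph hbar \<subseteq> ?D"
  proof safe
    fix \<psi> \<xi> assume *: "(\<psi>, \<xi>) \<in> cost_graph hbar"
    show "(\<psi>, \<xi>) \<in> ?D" unfolding diag_graph_def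
    proof safe
      fix n m
      have "cinner (abs_L2 (cost_expr hbar (osc_fun hbar (n, m)))) \<psi> = cinner (abs_L2 (osc_fun hbar (n, m))) \<xi>"
        using * schwartz_osc_fun[OF hbar, of "(n, m)"] unfolding cost_graph_def adjoint_graph_def by blast
      moreover have "abs_L2 (cost_expr hbar (osc_fun hbar (n, m))) = of_real (4 * hbar * real n) *\<^sub>C abs_L2 (osc_fun hbar (n, m))"
        unfolding cost_expr_osc_fun[OF hbar]
        by (simp only: abs_L2_scaleC square_integrable_schwartz[OF schwartz_osc_fun[OF hbar]])
      ultimately show "cinner (abs_L2 (osc_fun hbar (n, m))) \<xi> =
          of_real (4 * hbar * real (fst (n, m))) * cinner (abs_L2 (osc_fun hbar (n, m))) \<psi>"
        by (simp add: cinner_scaleC_left)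
    qed
  qed
qed

subsection \<open>Traces and operators in \<open>L\<^sup>2(\<real>\<^sup>2)\<close>\<close>

text \<open>The choice \<open>some_onb\<close> is meaningful once some basis is known;
  orthonormality makes the indexing injective, so an indexed basis passes to its range.\<close>

lemma is_onb_some_onb: "onb_on I (E :: 'i \<Rightarrow> 'a::complex_inner) \<Longrightarrow> is_onb (some_onb :: 'a set)"
proof -
  assume onb: "onb_on I E"
  then have E: "orthonormal_on I E" by (simp add: onb_on_def)
  have inj: "inj_on E I"
  proof (rule inj_onI)
    fix i j assume "i \<in> I" "j \<in> I" "E i = E j"
    then show "i = j" using orthonormal_onD[OF E, of i j] orthonormal_onD[OF E, of i i] by (auto split: if_splits)
  qed
  have "is_onb (E ` I)" unfolding is_onb_def
  proof
    show "\<forall>x\<in>E ` I. \<forall>y\<in>E ` I. cinner x y = (if x = y then 1 else 0)"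
      using inj by (auto simp: orthonormal_onD[OF E] inj_on_eq_iff)
    have "{c *\<^sub>C x | c x. x \<in> E ` I} = {c *\<^sub>C E i | c i. i \<in> I}" by auto
    then show "closure (span {c *\<^sub>C x | c x. x \<in> E ` I}) = UNIV" using onb by (simp add: onb_on_def)
  qed
  then show ?thesis unfolding some_onb_def by (rule someI)
qed

lemma is_onb_some_onb_L2: "is_onb (some_onb :: real L2 set)" "is_onb (some_onb :: (real \<times> real) L2 set)"
  using is_onb_some_onb[OF onb_hermite[OF zero_less_one]] is_onb_some_onb[OF onb_hermite_tensor[OF zero_less_one]]
  by blast+

text \<open>Because the squared norm of the root applied to \<psi> is the expectation of the cost in
  \<psi>, the value can be read off from the cost graph. A vector in the domain of the cost also
  lies in that of the root, with \<open>\<zeta> k\<close> as the intermediate vector.\<close>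

lemma sandwich_trace_cost_dyads:
  assumes hbar: "0 < hbar" and f: "\<And>k. k \<in> K \<Longrightarrow> (\<psi> k, \<xi> k) \<in> cost_graph hbar"
    and c: "\<And>k. k \<in> K \<Longrightarrow> 0 \<le> c k"
  shows "sandwich_trace (sqrt_graph (cost_graph hbar)) (\<lambda>\<phi>. \<Sum>k\<in>K. c k *\<^sub>R dyad (\<psi> k) \<phi>) =
      ennreal (\<Sum>k\<in>K. c k * Re (cinner (\<psi> k) (\<xi> k)))"
proof -
  let ?E = "\<lambda>i. abs_L2 (osc_fun hbar i)"
  define D where "D = diag_graph UNIV ?E (\<lambda>i. sqrt (4 * hbar * real (fst i)))"
  note onb = onb_osc_fun[OF hbar]
  have nn: "0 \<le> 4 * hbar * real (fst i)" for i :: "nat \<times> nat" using hbar by simp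
  have C: "cost_graph hbar = D O D"
    unfolding cost_graph_eq_diag_graph[OF hbar] D_def by (rule diag_graph_sqrt_relcomp[OF onb nn, symmetric])
  have "\<exists>\<zeta>. (\<psi> k, \<zeta>) \<in> D \<and> (\<zeta>, \<xi> k) \<in> D" if "k \<in> K" for k
    using f[OF that] unfolding C by blast
  then obtain \<zeta> where \<zeta>: "\<And>k. k \<in> K \<Longrightarrow> (\<psi> k, \<zeta> k) \<in> D" "\<And>k. k \<in> K \<Longrightarrow> (\<zeta> k, \<xi> k) \<in> D" by metis
  have "(norm (\<zeta> k))\<^sup>2 = Re (cinner (\<psi> k) (\<xi> k))" if "k \<in> K" for k
  proof -
    have "cinner (\<zeta> k) (\<zeta> k) = cinner (\<psi> k) (\<xi> k)"
      by (rule diag_graph_symmetric[OF onb \<zeta>(1)[OF that, unfolded D_def] \<zeta>(2)[OF that, unfolded D_def]])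
    then show ?thesis by (simp add: cinner_self flip: of_real_power) (metis Re_complex_of_real)
  qed
  moreover have "sqrt_graph (cost_graph hbar) = D"
    unfolding cost_graph_eq_diag_graph[OF hbar] D_def by (rule sqrt_diag_graph[OF onb nn])
  moreover have "sandwich_trace D (\<lambda>\<phi>. \<Sum>k\<in>K. c k *\<^sub>R dyad (\<psi> k) \<phi>) = ennreal (\<Sum>k\<in>K. c k * (norm (\<zeta> k))\<^sup>2)"
    unfolding D_def by (intro sandwich_trace_dyads[OF onb is_onb_some_onb_L2(2)] c \<zeta>(1)[unfolded D_def])
  ultimately show ?thesis by simp
qed

text \<open>The definite description in \<open>op_tensor\<close> is resolved by
  \<open>tensor_operator_ex1\<close>, applied to \<open>tensor\<close> and to its flip.\<close>

lemma op_tensor_id_apply: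
  assumes A: "bounded_op A"
  shows "(A \<otimes>\<^sub>o id) (f \<otimes>\<^sub>v g) = A f \<otimes>\<^sub>v g" "(id \<otimes>\<^sub>o A) (f \<otimes>\<^sub>v g) = f \<otimes>\<^sub>v A g"
    and bounded_op_tensor_id: "bounded_op (A \<otimes>\<^sub>o id)" "bounded_op (id \<otimes>\<^sub>o A)"
proof -
  note h = onb_hermite[OF zero_less_one] and hh = onb_hermite_tensor[OF zero_less_one]
  have "\<exists>!T. bounded_op T \<and> (\<forall>f g. T (f \<otimes>\<^sub>v g) = A f \<otimes>\<^sub>v id g)"
    using tensor_operator_ex1[where t = tensor, OF tensor_add_left tensor_add_right tensor_scaleC_left
        tensor_scaleC_right cinner_tensor h h hh A] by simp
  from theI'[OF this] show "(A \<otimes>\<^sub>o id) (f \<otimes>\<^sub>v g) = A f \<otimes>\<^sub>v g" "bounded_op (A \<otimes>\<^sub>o id)"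
    unfolding op_tensor_def by auto
  \<comment> \<open>The flipped product map needs the product basis indexed with the two labels
    exchanged.\<close>
  have hh': "onb_on (UNIV \<times> UNIV) (\<lambda>(j, i). hermite_vec 1 i \<otimes>\<^sub>v hermite_vec 1 j)"
  proof (rule onb_onI)
    show "orthonormal_on (UNIV \<times> UNIV) (\<lambda>(j, i). hermite_vec 1 i \<otimes>\<^sub>v hermite_vec 1 j)"
      using hh by (auto simp: onb_on_def orthonormal_on_def)
    show "x = 0" if "\<And>i. i \<in> UNIV \<times> UNIV \<Longrightarrow> cinner (case i of (j, i) \<Rightarrow> hermite_vec 1 i \<otimes>\<^sub>v hermite_vec 1 j) x = 0" for x
      using that by (intro onb_on_eqI[OF hh]) auto
  qed
  have "\<exists>!T. bounded_op T \<and> (\<forall>g f. T (f \<otimes>\<^sub>v g) = f \<otimes>\<^sub>v A g)"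
    by (rule tensor_operator_ex1[where t = "\<lambda>g f. f \<otimes>\<^sub>v g", OF tensor_add_right tensor_add_left tensor_scaleC_right
        tensor_scaleC_left _ h h hh' A]) (simp add: cinner_tensor mult.commute)
  moreover have "(\<lambda>T. bounded_op T \<and> (\<forall>g f. T (f \<otimes>\<^sub>v g) = f \<otimes>\<^sub>v A g)) =
      (\<lambda>T. bounded_op T \<and> (\<forall>f g. T (f \<otimes>\<^sub>v g) = id f \<otimes>\<^sub>v A g))"
    by (auto simp: fun_eq_iff)
  ultimately have "\<exists>!T. bounded_op T \<and> (\<forall>f g. T (f \<otimes>\<^sub>v g) = id f \<otimes>\<^sub>v A g)"
    by simp
  from theI'[OF this] show "(id \<otimes>\<^sub>o A) (f \<otimes>\<^sub>v g) = f \<otimes>\<^sub>v A g" "bounded_op (id \<otimes>\<^sub>o A)"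
    unfolding op_tensor_def by auto
qed


section \<open>Coherent states\<close>

definition coherent_fun :: "real \<Rightarrow> real \<Rightarrow> real \<Rightarrow> complex" where
  "coherent_fun hbar c x = of_real ((pi * hbar) powr (- 1 / 4) * exp (- (x - c)\<^sup>2 / (2 * hbar)))"

lemma coherent_eq: "coherent hbar c = abs_L2 (coherent_fun hbar c)"
  by (simp add: coherent_def coherent_fun_def[abs_def])

text \<open>Completing the square: the product of two coherent states is a normal density of
  variance hbar/2 centred at the midpoint, times the overlap of the states.\<close>

lemma coherent_fun_mult:
  assumes hbar: "0 < hbar"
  shows "cnj (coherent_fun hbar c x) * coherent_fun hbar d x =
    of_real (exp (- (c - d)\<^sup>2 / (4 * hbar)) * normal_density ((c + d) / 2) (sqrt (hbar / 2)) x)"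
proof -
  have "(pi * hbar) powr (- 1 / 4) * (pi * hbar) powr (- 1 / 4) = (pi * hbar) powr (- (1 / 2))"
    by (simp add: powr_add[symmetric])
  also have "\<dots> = 1 / sqrt (pi * hbar)"
    using hbar by (simp add: powr_minus powr_half_sqrt inverse_eq_divide)
  finally have 1: "(pi * hbar) powr (- 1 / 4) * (pi * hbar) powr (- 1 / 4) = 1 / sqrt (pi * hbar)" .
  have 2: "exp (- (x - c)\<^sup>2 / (2 * hbar)) * exp (- (x - d)\<^sup>2 / (2 * hbar)) =
      exp (- (c - d)\<^sup>2 / (4 * hbar)) * exp (- (x - (c + d) / 2)\<^sup>2 / hbar)"
    unfolding exp_add[symmetric] using hbar by (simp add: field_simps power2_eq_square)
  have "normal_density ((c + d) / 2) (sqrt (hbar / 2)) x = 1 / sqrt (pi * hbar) * exp (- (x - (c + d) / 2)\<^sup>2 / hbar)"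
    using hbar by (simp add: normal_density_def)
  moreover have interchange: "(P * A) * (P * B) = (P * P) * (A * B)" for P A B :: real by (simp add: mult_ac)
  ultimately have "((pi * hbar) powr (- 1 / 4) * exp (- (x - c)\<^sup>2 / (2 * hbar))) * ((pi * hbar) powr (- 1 / 4) * exp (- (x - d)\<^sup>2 / (2 * hbar))) =
      exp (- (c - d)\<^sup>2 / (4 * hbar)) * normal_density ((c + d) / 2) (sqrt (hbar / 2)) x"
    using 1 2 interchange by (simp only:) (simp only: mult_ac)
  then show ?thesis
    unfolding coherent_fun_def complex_cnj_complex_of_real of_real_mult[symmetric] by (simp only:)
qed

lemma coherent_fun_sq:
  assumes hbar: "0 < hbar"
  shows "(cmod (coherent_fun hbar c x))\<^sup>2 = normal_density c (sqrt (hbar / 2)) x"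
proof -
  have "complex_of_real ((cmod (coherent_fun hbar c x))\<^sup>2) = cnj (coherent_fun hbar c x) * coherent_fun hbar c x"
    by (simp add: complex_norm_square mult.commute del: of_real_power)
  also have "\<dots> = of_real (normal_density c (sqrt (hbar / 2)) x)"
    unfolding coherent_fun_mult[OF hbar] by simp
  finally show ?thesis by (simp only: of_real_eq_iff)
qed

lemma measurable_coherent_fun [measurable]: "coherent_fun hbar c \<in> borel_measurable borel"
  unfolding coherent_fun_def[abs_def] by measurable

lemma square_integrable_coherent: "0 < hbar \<Longrightarrow> square_integrable (coherent_fun hbar c)"
  by (simp add: square_integrable_def coherent_fun_sq)

lemma cinner_coherent:
  assumes hbar: "0 < hbar"
  shows "cinner (coherent hbar c) (coherent hbar d) = of_real (exp (- (c - d)\<^sup>2 / (4 * hbar)))"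
proof -
  have "cinner (coherent hbar c) (coherent hbar d) =
      (LINT x|lborel. complex_of_real (exp (- (c - d)\<^sup>2 / (4 * hbar)) * normal_density ((c + d) / 2) (sqrt (hbar / 2)) x))"
    unfolding coherent_eq cinner_abs_L2[OF square_integrable_coherent[OF hbar] square_integrable_coherent[OF hbar]]
      coherent_fun_mult[OF hbar] ..
  also have "\<dots> = of_real (exp (- (c - d)\<^sup>2 / (4 * hbar)))"
    unfolding integral_complex_of_real using hbar by simp
  finally show ?thesis .
qed

lemma position_coherent:
  assumes hbar: "0 < hbar"
  shows "square_integrable (\<lambda>x. of_real x * coherent_fun hbar c x)"
    and "cinner (coherent hbar c) (abs_L2 (\<lambda>x. of_real x * coherent_fun hbar c x)) = of_real c"
proof -
  define \<sigma> where "\<sigma> = sqrt (hbar / 2)"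
  have \<sigma>: "0 < \<sigma>" using hbar by (simp add: \<sigma>_def)
  \<comment> \<open>The integrand is \<open>x^2\<close> times the density, with \<open>x^2\<close>
    expanded about \<open>c\<close> so that only centred moments occur.\<close>
  have "integrable lborel (\<lambda>x. normal_density c \<sigma> x * (x - c) ^ 2 + 2 * c * (normal_density c \<sigma> x * (x - c) ^ 1)
      + c\<^sup>2 * normal_density c \<sigma> x)"
    using integrable_normal_moment[OF \<sigma>, of c 2] integrable_normal_moment[OF \<sigma>, of c 1] \<sigma> by auto
  moreover have "normal_density c \<sigma> x * (x - c) ^ 2 + 2 * c * (normal_density c \<sigma> x * (x - c) ^ 1) + c\<^sup>2 * normal_density c \<sigma> x =
      (cmod (of_real x * coherent_fun hbar c x))\<^sup>2" for x
    using coherent_fun_sq[OF hbar, of c x]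
    by (simp add: norm_mult power_mult_distrib \<sigma>_def power2_eq_square algebra_simps)
  ultimately show s: "square_integrable (\<lambda>x. of_real x * coherent_fun hbar c x)"
    by (simp add: square_integrable_def)
  have "cinner (coherent hbar c) (abs_L2 (\<lambda>x. of_real x * coherent_fun hbar c x)) =
      (LINT x|lborel. complex_of_real (normal_density c \<sigma> x * x))"
    unfolding coherent_eq cinner_abs_L2[OF square_integrable_coherent[OF hbar] s]
  proof (intro Bochner_Integration.integral_cong refl)
    fix x
    have "cnj (coherent_fun hbar c x) * (of_real x * coherent_fun hbar c x) =
        of_real x * (cnj (coherent_fun hbar c x) * coherent_fun hbar c x)" by simp
    also have "\<dots> = of_real (normal_density c \<sigma> x * x)"
      unfolding coherent_fun_mult[OF hbar] by (simp add: \<sigma>_def)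
    finally show "cnj (coherent_fun hbar c x) * (of_real x * coherent_fun hbar c x) = of_real (normal_density c \<sigma> x * x)" .
  qed
  also have "\<dots> = of_real c" unfolding integral_complex_of_real using integral_normal_moment_nz_1[OF \<sigma>, of c] by simp
  finally show "cinner (coherent hbar c) (abs_L2 (\<lambda>x. of_real x * coherent_fun hbar c x)) = of_real c" .
qed

text \<open>
  The second member of the pair is \<open>2 (c - d) (x - y) - (c - d)\<^sup>2\<close> times the product of the two states.
\<close>

lemma cost_coherent:
  fixes hbar c d :: real
  assumes hbar: "0 < hbar"
  defines "X \<equiv> \<lambda>c. abs_L2 (\<lambda>x. of_real x * coherent_fun hbar c x)"
  shows "(coherent hbar c \<otimes>\<^sub>v coherent hbar d,
      of_real (2 * (c - d)) *\<^sub>C (X c \<otimes>\<^sub>v coherent hbar d - coherent hbar c \<otimes>\<^sub>v X d)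
        - of_real ((c - d)\<^sup>2) *\<^sub>C (coherent hbar c \<otimes>\<^sub>v coherent hbar d)) \<in> cost_graph hbar"
proof -
  define F where "F = (\<lambda>(x, y). coherent_fun hbar c x * coherent_fun hbar d y)"
  define K where "K = complex_of_real ((pi * hbar) powr (- 1 / 4) * (pi * hbar) powr (- 1 / 4))"
  define E where "E z = complex_of_real (exp (- ((fst z - c)\<^sup>2 + (snd z - d)\<^sup>2) / (2 * hbar)))" for z :: "real \<times> real"
  have FE: "F = (\<lambda>z. K * E z)"
  proof
    fix z :: "real \<times> real"
    have "exp (- ((fst z - c)\<^sup>2 + (snd z - d)\<^sup>2) / (2 * hbar)) = exp (- (fst z - c)\<^sup>2 / (2 * hbar)) * exp (- (snd z - d)\<^sup>2 / (2 * hbar))"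
      unfolding exp_add[symmetric] by (simp add: add_divide_distrib diff_divide_distrib)
    then show "F z = K * E z"
      by (simp add: F_def K_def E_def coherent_fun_def case_prod_unfold)
  qed
  have F: "schwartz F"
    unfolding FE E_def by (intro poly_gauss_schwartz[OF hbar] poly_gauss.scale poly_gauss.gauss)
  \<comment> \<open>The difference of the logarithmic derivatives of the Gaussian in its two
    variables, a function of \<open>x - y\<close> only.\<close>
  define q where "q u = - (u - (c - d)) / hbar" for u
  have D: "((\<lambda>s. complex_of_real (exp (- ((s - b)\<^sup>2 + k) / (2 * hbar)))) has_vector_derivative
        of_real (- ((s - b) / hbar)) * of_real (exp (- ((s - b)\<^sup>2 + k) / (2 * hbar)))) (at s)" for s b k :: real
  proof -
    have "((\<lambda>s. exp (- ((s - b)\<^sup>2 + k) / (2 * hbar))) has_real_derivative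
        - ((s - b) / hbar) * exp (- ((s - b)\<^sup>2 + k) / (2 * hbar))) (at s)"
      using hbar by (auto intro!: derivative_eq_intros simp: field_simps)
    then have "((\<lambda>s. complex_of_real (exp (- ((s - b)\<^sup>2 + k) / (2 * hbar)))) has_vector_derivative
        of_real (- ((s - b) / hbar) * exp (- ((s - b)\<^sup>2 + k) / (2 * hbar)))) (at s)"
      by (intro has_vector_derivative_of_real) (simp only: has_real_derivative_iff_has_vector_derivative)
    then show ?thesis by (simp only: of_real_mult)
  qed
  have E1: "((\<lambda>s. E (s, y)) has_vector_derivative of_real (- ((x - c) / hbar)) * E (x, y)) (at x)" for x y
    using D[of c "(y - d)\<^sup>2" x] by (simp only: E_def fst_conv snd_conv)
  have E2: "((\<lambda>s. E (x, s)) has_vector_derivative of_real (- ((y - d) / hbar)) * E (x, y)) (at y)" for x y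
    using D[of d "(x - c)\<^sup>2" y] by (simp only: E_def fst_conv snd_conv add.commute)
  have q_eq: "complex_of_real (- ((x - c) / hbar)) - of_real (- ((y - d) / hbar)) = of_real (q (x - y))" for x y
    unfolding of_real_diff[symmetric] q_def using hbar by (intro arg_cong[where f = of_real]) (simp add: field_simps)
  have d1: "diff_op F = (\<lambda>z. K * (of_real (q (fst z - snd z)) * E z))"
  proof
    fix z :: "real \<times> real"
    obtain x y where z: "z = (x, y)" by (cases z)
    note dx = vector_derivative_at[OF has_vector_derivative_mult[OF has_vector_derivative_const[of K] E1[of y x]]]
    note dy = vector_derivative_at[OF has_vector_derivative_mult[OF has_vector_derivative_const[of K] E2[of x y]]]
    show "diff_op F z = K * (of_real (q (fst z - snd z)) * E z)"
      by (simp only: FE diff_op_def z prod.case fst_conv snd_conv dx dy q_eq[symmetric] left_diff_distrib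
          right_diff_distrib mult_zero_left add_0_right)
  qed
  have d2: "diff_op (diff_op F) = (\<lambda>z. K * (of_real ((q (fst z - snd z))\<^sup>2 - 2 / hbar) * E z))"
  proof
    fix z :: "real \<times> real"
    obtain x y where z: "z = (x, y)" by (cases z)
    have "((\<lambda>s. q (s - y)) has_real_derivative - 1 / hbar) (at x)" "((\<lambda>s. q (x - s)) has_real_derivative 1 / hbar) (at y)"
      unfolding q_def using hbar by (auto intro!: derivative_eq_intros)
    then have q': "((\<lambda>s. complex_of_real (q (s - y))) has_vector_derivative of_real (- 1 / hbar)) (at x)"
      "((\<lambda>s. complex_of_real (q (x - s))) has_vector_derivative of_real (1 / hbar)) (at y)"
      by (simp_all only: has_vector_derivative_of_real has_real_derivative_iff_has_vector_derivative)
    note dx = vector_derivative_at[OF has_vector_derivative_mult[OF has_vector_derivative_const[of K]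
          has_vector_derivative_mult[OF q'(1) E1[of y x]]]]
    note dy = vector_derivative_at[OF has_vector_derivative_mult[OF has_vector_derivative_const[of K]
          has_vector_derivative_mult[OF q'(2) E2[of x y]]]]
    have "diff_op (diff_op F) z =
        K * (of_real (q (x - y)) * (of_real (- ((x - c) / hbar)) * E (x, y)) + of_real (- 1 / hbar) * E (x, y)) -
        K * (of_real (q (x - y)) * (of_real (- ((y - d) / hbar)) * E (x, y)) + of_real (1 / hbar) * E (x, y))"
      unfolding d1 by (simp only: diff_op_def z prod.case fst_conv snd_conv dx dy mult_zero_left add_0_right)
    also have "\<dots> = K * ((of_real (q (x - y)) * (of_real (- ((x - c) / hbar)) - of_real (- ((y - d) / hbar))) - of_real (2 / hbar)) * E (x, y))"
    proof -
      have "complex_of_real (2 / hbar) = of_real (1 / hbar) + of_real (1 / hbar)" "complex_of_real (- 1 / hbar) = - of_real (1 / hbar)"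
        by (simp_all only: of_real_add[symmetric] add_divide_distrib[symmetric] of_real_minus[symmetric] minus_divide_left) simp
      moreover have "K * (v * (r * e) + - h * e) - K * (v * (r' * e) + h * e) = K * ((v * (r - r') - (h + h)) * e)"
        for v r r' h e :: complex by (simp add: algebra_simps)
      ultimately show ?thesis by (simp only:)
    qed
    finally show "diff_op (diff_op F) z = K * (of_real ((q (fst z - snd z))\<^sup>2 - 2 / hbar) * E z)"
      by (simp only: q_eq z fst_conv snd_conv power2_eq_square of_real_diff of_real_mult)
  qed
  have cost: "cost_expr hbar F = (\<lambda>z. of_real (2 * (c - d)) * (of_real (fst z) * F z - of_real (snd z) * F z) - of_real ((c - d)\<^sup>2) * F z)"
  proof
    fix z :: "real \<times> real"
    \<comment> \<open>The quadratic terms in \<open>x - y\<close> cancel, and the derivative of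
      \<open>q\<close> contributes \<open>+ 2 * hbar\<close>, which the shift in the cost removes.
      An affine function of \<open>x - y\<close> remains.\<close>
    have "(fst z - snd z)\<^sup>2 - hbar\<^sup>2 * ((q (fst z - snd z))\<^sup>2 - 2 / hbar) - 2 * hbar =
        2 * (c - d) * (fst z - snd z) - (c - d)\<^sup>2"
      using hbar by (simp add: q_def power_divide power2_eq_square field_simps)
    then have "complex_of_real ((fst z - snd z)\<^sup>2 - hbar\<^sup>2 * ((q (fst z - snd z))\<^sup>2 - 2 / hbar) - 2 * hbar) * (K * E z) =
        of_real (2 * (c - d) * (fst z - snd z) - (c - d)\<^sup>2) * (K * E z)" by (simp only:)
    then show "cost_expr hbar F z = of_real (2 * (c - d)) * (of_real (fst z) * F z - of_real (snd z) * F z) - of_real ((c - d)\<^sup>2) * F z"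
      unfolding cost_expr_altdef d2 unfolding FE by (simp add: algebra_simps)
  qed
  note sq = square_integrable_coherent[OF hbar] position_coherent(1)[OF hbar]
  note st = square_integrable_tensor[OF sq(2)[of c] sq(1)[of d]] square_integrable_tensor[OF sq(1)[of c] sq(2)[of d]]
    square_integrable_tensor[OF sq(1)[of c] sq(1)[of d]]
  have "of_real (2 * (c - d)) *\<^sub>C (X c \<otimes>\<^sub>v coherent hbar d - coherent hbar c \<otimes>\<^sub>v X d)
        - of_real ((c - d)\<^sup>2) *\<^sub>C (coherent hbar c \<otimes>\<^sub>v coherent hbar d) = abs_L2 (cost_expr hbar F)"
    unfolding X_def coherent_eq tensor_abs_L2[OF sq(2) sq(1)] tensor_abs_L2[OF sq(1) sq(2)] tensor_abs_L2[OF sq(1) sq(1)]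
      abs_L2_diff[OF st(1) st(2)] abs_L2_scaleC[OF square_integrable_diff[OF st(1) st(2)]] abs_L2_scaleC[OF st(3)]
      abs_L2_diff[OF square_integrable_scale[OF square_integrable_diff[OF st(1) st(2)]] square_integrable_scale[OF st(3)]]
      cost
    unfolding F_def by (simp add: case_prod_unfold mult_ac)
  moreover have "coherent hbar c \<otimes>\<^sub>v coherent hbar d = abs_L2 F"
    unfolding coherent_eq F_def by (rule tensor_abs_L2[OF sq(1) sq(1)])
  ultimately show ?thesis
    using schwartz_in_diag_graph[OF hbar F] by (simp add: cost_graph_eq_diag_graph[OF hbar])
qed

text \<open>Equal centres make the affine multiplier vanish, so the state is in the kernel of the
  cost.\<close>

lemma cost_coherent_diagonal:
  assumes hbar: "0 < hbar"
  shows "(coherent hbar c \<otimes>\<^sub>v coherent hbar c, 0) \<in> cost_graph hbar"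
  using cost_coherent[OF hbar, of c c] by simp

text \<open>With \<delta> = c - d, the expectation of 2 \<delta> (x - y) - \<delta>^2 is 2
  \<delta>^2 - \<delta>^2, since the mean positions are \<open>c\<close> and \<open>d\<close>. This
  equals the classical cost of moving \<open>c\<close> to \<open>d\<close>.\<close>

lemma cost_coherent_off_diagonal:
  assumes hbar: "0 < hbar"
  obtains \<xi> where "(coherent hbar c \<otimes>\<^sub>v coherent hbar d, \<xi>) \<in> cost_graph hbar"
    and "cinner (coherent hbar c \<otimes>\<^sub>v coherent hbar d) \<xi> = of_real ((c - d)\<^sup>2)"
proof -
  have "complex_of_real (2 * (c - d)) * (of_real c - of_real d) - of_real ((c - d)\<^sup>2) = of_real ((c - d)\<^sup>2)"
    by (simp add: power2_eq_square algebra_simps)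
  then show ?thesis
    using that[OF cost_coherent[OF hbar, of c d]] position_coherent(2)[OF hbar] cinner_coherent[OF hbar, of c c] cinner_coherent[OF hbar, of d d]
    by (simp add: cinner_diff_right cinner_scaleC_right cinner_tensor)
qed


section \<open>The two distances\<close>

text \<open>It resolves the descriptions in \<open>MK2\<close> and \<open>W2\<close>, infinite
  values included.\<close>

lemma ennreal_sqrt_ex1: "\<exists>!m :: ennreal. m\<^sup>2 = x"
proof (rule ex_ex1I)
  show "\<exists>m :: ennreal. m\<^sup>2 = x"
  proof (cases x)
    case (real r)
    then have "(ennreal (sqrt r))\<^sup>2 = x" by (simp add: ennreal_power)
    then show ?thesis by blast
  next
    case top
    then have "top\<^sup>2 = x" by (simp add: power2_eq_square)
    then show ?thesis by blast
  qed
  show "m = n" if "m\<^sup>2 = x" "n\<^sup>2 = x" for m n :: ennreal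
  proof -
    have "m\<^sup>2 = n\<^sup>2" using that by simp
    then show ?thesis
      by (cases m; cases n) (auto simp: ennreal_power power2_eq_square[of top] ennreal_mult_eq_top_iff power2_eq_iff_nonneg)
  qed
qed

lemma MK2_squared: "(MK2 hbar R S)\<^sup>2 = (INF Q\<in>{Q. is_coupling R S Q}. sandwich_trace (sqrt_graph (cost_graph hbar)) Q)"
  unfolding MK2_def by (rule theI'[OF ennreal_sqrt_ex1])

lemma W2_squared: "(W2 \<mu> \<nu>)\<^sup>2 =
     (INF P\<in>{P :: (real \<times> real) measure. prob_space P \<and> sets P = sets borel \<and>
               distr P borel fst = \<mu> \<and> distr P borel snd = \<nu>}.
        \<integral>\<^sup>+ (x, y). ennreal (\<bar>x - y\<bar>\<^sup>2) \<partial>P)"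
  unfolding W2_def by (rule theI'[OF ennreal_sqrt_ex1])

section \<open>Classical transport between the two-point measures\<close>

lemma emeasure_two_point:
  assumes "0 \<le> p" "0 \<le> q" "A \<in> sets borel"
  shows "emeasure (mixture p (dirac a) q (dirac b)) A = ennreal (p * indicator A a + q * indicator A b)"
  using assms by (cases "a \<in> A"; cases "b \<in> A") (simp_all add: emeasure_mixture dirac_def)

lemma sets_mixture [simp]: "sets (mixture p \<mu> q \<nu>) = sets borel"
  by (simp add: mixture_def) (metis sets.sigma_sets_eq space_borel)

text \<open>The marginals force mass at least \<eta>/2 to travel from \<open>a\<close> to
  \<open>- a\<close>, at squared distance 4 a^2. The three-atom plan moving exactly this mass
  attains the bound.\<close>

lemma W2_two_point:
  fixes a \<eta> :: real
  assumes a: "0 < a" and \<eta>: "0 < \<eta>" "\<eta> < 1"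
  shows "(W2 (mixture ((1 + \<eta>) / 2) (dirac a) ((1 - \<eta>) / 2) (dirac (- a)))
      (mixture (1 / 2) (dirac a) (1 / 2) (dirac (- a))))\<^sup>2 = ennreal (2 * \<eta> * a\<^sup>2)"
    (is "(W2 ?\<mu> ?\<nu>)\<^sup>2 = _")
  unfolding W2_squared
proof (rule antisym)
  show "ennreal (2 * \<eta> * a\<^sup>2) \<le> (INF P\<in>{P :: (real \<times> real) measure. prob_space P \<and> sets P = sets borel \<and>
      distr P borel fst = ?\<mu> \<and> distr P borel snd = ?\<nu>}. \<integral>\<^sup>+ (x, y). ennreal (\<bar>x - y\<bar>\<^sup>2) \<partial>P)"
  proof (rule INF_greatest, clarify)
    fix P :: "(real \<times> real) measure"
    assume P: "prob_space P" "sets P = sets borel" "distr P borel fst = ?\<mu>" "distr P borel snd = ?\<nu>"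
    interpret prob_space P by fact
      have sp: "space P = UNIV" using sets_eq_imp_space_eq[OF P(2)] by simp
    have m: "fst \<in> borel_measurable P" "snd \<in> borel_measurable P"
      unfolding measurable_cong_sets[OF P(2) refl] by (auto intro!: borel_measurable_continuous_onI continuous_intros)
    have pre: "emeasure P (fst -` A) = emeasure ?\<mu> A" "emeasure P (snd -` A) = emeasure ?\<nu> A"
      "fst -` A \<in> sets P" "snd -` A \<in> sets P" if A: "A \<in> sets borel" for A
      using emeasure_distr[OF m(1) A] emeasure_distr[OF m(2) A] measurable_sets[OF m(1) A] measurable_sets[OF m(2) A]
      by (simp_all add: P(3,4) sp)
    \<comment> \<open>The set of points with first coordinate \<open>a\<close> and second
      \<open>- a\<close>, written as a set difference so that subadditivity applies
      directly.\<close>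
    define B where "B = fst -` {a} - snd -` (- {- a})"
    have "ennreal ((1 + \<eta>) / 2) = emeasure P (fst -` {a})"
      using a \<eta> by (simp add: pre emeasure_two_point)
    also have "\<dots> \<le> emeasure P (B \<union> snd -` (- {- a}))"
      by (intro emeasure_mono) (auto simp: B_def intro!: sets.Un sets.Diff pre)
    also have "\<dots> \<le> emeasure P B + emeasure P (snd -` (- {- a}))"
      by (intro emeasure_subadditive) (auto simp: B_def intro!: sets.Diff pre)
    also have "emeasure P (snd -` (- {- a})) = ennreal (1 / 2)"
      using a \<eta> by (simp add: pre emeasure_two_point)
    also have "emeasure P B + ennreal (1 / 2) = ennreal (measure P B + 1 / 2)"
      unfolding emeasure_eq_measure by (rule ennreal_plus[symmetric]) auto
    finally have "(1 + \<eta>) / 2 \<le> measure P B + 1 / 2"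
      by (subst (asm) ennreal_le_iff) (auto intro: add_nonneg_nonneg)
    then have "2 * \<eta> * a\<^sup>2 \<le> 4 * a\<^sup>2 * measure P B"
      using mult_left_mono[of "\<eta> / 2" "measure P B" "4 * a\<^sup>2"] by (simp add: field_simps)
    then have "ennreal (2 * \<eta> * a\<^sup>2) \<le> ennreal (4 * a\<^sup>2) * emeasure P B"
      by (simp add: emeasure_eq_measure ennreal_mult[symmetric])
    also have "\<dots> = (\<integral>\<^sup>+ z. ennreal (4 * a\<^sup>2) * indicator B z \<partial>P)"
      by (rule nn_integral_cmult_indicator[symmetric]) (auto simp: B_def intro!: sets.Diff pre)
    also have "\<dots> \<le> (\<integral>\<^sup>+ (x, y). ennreal (\<bar>x - y\<bar>\<^sup>2) \<partial>P)"
      by (rule nn_integral_mono) (auto simp: B_def power_mult_distrib split: split_indicator)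
    finally show "ennreal (2 * \<eta> * a\<^sup>2) \<le> (\<integral>\<^sup>+ (x, y). ennreal (\<bar>x - y\<bar>\<^sup>2) \<partial>P)" .
  qed
next
  \<comment> \<open>The optimal plan is the image under \<open>g\<close> of a discrete distribution
    on the labels 0, 1, 2 with weights 1/2, \<eta>/2, (1 - \<eta>)/2, so integrals reduce to three
    terms.\<close>
  define N :: "nat pmf" where "N = bind_pmf (bernoulli_pmf (1/2))
      (\<lambda>b. if b then return_pmf 0 else map_pmf (\<lambda>c. if c then 1 else 2) (bernoulli_pmf \<eta>))"
  define g :: "nat \<Rightarrow> real \<times> real" where "g n = (if n = 0 then (a, a) else if n = 1 then (a, - a) else (- a, - a))" for n
  have g012: "g 0 = (a, a)" "g 1 = (a, - a)" "g 2 = (- a, - a)" by (simp_all add: g_def)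
  define P where "P = distr (measure_pmf N) borel g"
  have intN: "(\<integral>\<^sup>+ n. f n \<partial>measure_pmf N) = ennreal (1/2) * f 0 + ennreal (\<eta> / 2) * f 1 + ennreal ((1 - \<eta>) / 2) * f 2" for f :: "nat \<Rightarrow> ennreal"
  proof -
    have "(\<integral>\<^sup>+ n. f n \<partial>measure_pmf N) = ennreal (1/2) * f 0 + ennreal (1/2) * (ennreal \<eta> * f 1 + ennreal (1 - \<eta>) * f 2)"
      using \<eta> by (simp add: N_def nn_integral_bind_pmf nn_integral_bernoulli_pmf mult.commute)
    also have "\<dots> = ennreal (1/2) * f 0 + (ennreal (1/2) * ennreal \<eta>) * f 1 + (ennreal (1/2) * ennreal (1 - \<eta>)) * f 2"
      by (simp only: distrib_left mult.assoc add.assoc)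
    also have "ennreal (1/2) * ennreal \<eta> = ennreal (\<eta> / 2)" using \<eta> by (subst ennreal_mult[symmetric]) auto
    also have "ennreal (1/2) * ennreal (1 - \<eta>) = ennreal ((1 - \<eta>) / 2)" using \<eta> by (subst ennreal_mult[symmetric]) auto
    finally show ?thesis .
  qed
  have eP: "emeasure (distr P borel h) A = ennreal (1/2 * indicator A (h (a, a)) + \<eta> / 2 * indicator A (h (a, - a)) + (1 - \<eta>) / 2 * indicator A (h (- a, - a)))"
    if [measurable]: "h \<in> borel_measurable borel" "A \<in> sets borel" for h :: "real \<times> real \<Rightarrow> real" and A
  proof -
    have "emeasure (distr P borel h) A = (\<integral>\<^sup>+ n. indicator A (h (g n)) \<partial>measure_pmf N)"
    proof -
      have "distr P borel h = distr (measure_pmf N) borel (h \<circ> g)"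
        unfolding P_def by (rule distr_distr) auto
      moreover have "(\<integral>\<^sup>+ x. indicator A x \<partial>distr (measure_pmf N) borel (h \<circ> g)) = (\<integral>\<^sup>+ n. indicator A ((h \<circ> g) n) \<partial>measure_pmf N)"
        by (rule nn_integral_distr) auto
      ultimately show ?thesis by simp
    qed
    also have "\<dots> = ennreal (1/2) * indicator A (h (a, a)) + ennreal (\<eta> / 2) * indicator A (h (a, - a)) +
        ennreal ((1 - \<eta>) / 2) * indicator A (h (- a, - a))"
      unfolding intN g012 ..
    also have "\<dots> = ennreal (1/2 * indicator A (h (a, a)) + \<eta> / 2 * indicator A (h (a, - a)) + (1 - \<eta>) / 2 * indicator A (h (- a, - a)))"
    proof -
      have ind: "ennreal x * indicator A w = ennreal (x * indicator A w)" for x w by (simp add: indicator_def)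
      have plus: "ennreal x + ennreal y + ennreal z = ennreal (x + y + z)" if "0 \<le> x" "0 \<le> y" "0 \<le> z" for x y z
        using that by simp
      show ?thesis unfolding ind by (rule plus) (use \<eta> in auto)
    qed
    finally show ?thesis .
  qed
  have P: "prob_space P" unfolding P_def by (intro prob_space.prob_space_distr) (auto simp: prob_space_measure_pmf)
  have m: "fst \<in> borel_measurable (borel :: (real \<times> real) measure)" "snd \<in> borel_measurable (borel :: (real \<times> real) measure)"
    by (auto intro!: borel_measurable_continuous_onI continuous_intros)
  have "distr P borel fst = ?\<mu>"
  proof (rule measure_eqI)
    fix A assume "A \<in> sets (distr P borel fst)"
    then have A: "A \<in> sets borel" by simp
    show "emeasure (distr P borel fst) A = emeasure ?\<mu> A"
      using \<eta> unfolding eP[OF m(1) A] by (subst emeasure_two_point[OF _ _ A])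
        (auto intro!: arg_cong[where f = ennreal] simp: field_simps)
  qed simp
  moreover have "distr P borel snd = ?\<nu>"
  proof (rule measure_eqI)
    fix A assume "A \<in> sets (distr P borel snd)"
    then have A: "A \<in> sets borel" by simp
    show "emeasure (distr P borel snd) A = emeasure ?\<nu> A"
      using \<eta> unfolding eP[OF m(2) A] by (subst emeasure_two_point[OF _ _ A])
        (auto intro!: arg_cong[where f = ennreal] simp: field_simps)
  qed simp
  moreover have "(\<integral>\<^sup>+ (x, y). ennreal (\<bar>x - y\<bar>\<^sup>2) \<partial>P) = ennreal (2 * \<eta> * a\<^sup>2)"
  proof -
    have "(\<integral>\<^sup>+ (x, y). ennreal (\<bar>x - y\<bar>\<^sup>2) \<partial>P) = (\<integral>\<^sup>+ n. (case g n of (x, y) \<Rightarrow> ennreal (\<bar>x - y\<bar>\<^sup>2)) \<partial>measure_pmf N)"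
      unfolding P_def case_prod_unfold
      by (rule nn_integral_distr) (auto intro!: borel_measurable_continuous_onI continuous_intros)
    also have "\<dots> = ennreal (\<eta> / 2) * ennreal ((2 * a)\<^sup>2)" unfolding intN by (simp add: g_def)
    also have "\<dots> = ennreal (2 * \<eta> * a\<^sup>2)" using \<eta> by (simp add: ennreal_mult[symmetric] power_mult_distrib)
    finally show ?thesis .
  qed
  ultimately show "(INF P\<in>{P :: (real \<times> real) measure. prob_space P \<and> sets P = sets borel \<and>
      distr P borel fst = ?\<mu> \<and> distr P borel snd = ?\<nu>}. \<integral>\<^sup>+ (x, y). ennreal (\<bar>x - y\<bar>\<^sup>2) \<partial>P) \<le> ennreal (2 * \<eta> * a\<^sup>2)"
    using P by (intro INF_lower2[of P]) (auto simp: P_def)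
qed


section \<open>A cheaper coupling\<close>

lemma op_trace_comp_dyads:
  assumes onb: "is_onb (some_onb :: 'a::complex_inner set)" and T: "bounded_op T"
  shows "op_trace (T \<circ> (\<lambda>\<phi>. \<Sum>k\<in>K. c k *\<^sub>R dyad (\<psi> k) \<phi>)) = (\<Sum>k\<in>K. of_real (c k) * cinner (\<psi> k) (T (\<psi> k :: 'a)))"
proof -
  have "T \<circ> (\<lambda>\<phi>. \<Sum>k\<in>K. c k *\<^sub>R dyad (\<psi> k) \<phi>) = (\<lambda>\<phi>. \<Sum>k\<in>K. cinner (\<psi> k) \<phi> *\<^sub>C (c k *\<^sub>R T (\<psi> k)))"
    by (simp add: fun_eq_iff bounded_op_sum[OF T] bounded_op_scaleR[OF T] bounded_op_scaleC[OF T] dyad_def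
        scaleR_scaleC scaleC_scaleC mult.commute)
  then show ?thesis
    by (simp add: op_trace_finite_rank[OF onb] cinner_scaleR_right)
qed

text \<open>
  In terms of the product states \<open>|ij\<rangle>\<close>, \<open>i, j \<in> {p, m}\<close>, and \<open>s = \<langle>p|m\<rangle>\<close>, the coupling below has the matrix entries
  \<open>1/2\<close>, \<open>(1 - \<eta>)/2\<close>, \<open>\<eta>/2 - 2 s\<^sup>2 t\<close> at \<open>pp\<close>, \<open>mm\<close>, \<open>pm\<close> on the diagonal, \<open>-t\<close> between \<open>pp\<close> and \<open>mm\<close>, and
  \<open>s t\<close> between \<open>pm\<close> and each of \<open>pp\<close>, \<open>mm\<close>. For \<open>t = 0\<close> it is the optimal classical coupling; the
  off-diagonal terms cancel in both marginals because \<open>p\<close> and \<open>m\<close> are not orthogonal, and they allow the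
  weight of \<open>pm\<close>, the only state with nonzero cost, to be smaller.
\<close>

lemma cheap_coupling:
  fixes hbar a \<eta> :: real
  assumes hbar: "0 < hbar" and a: "0 < a" and \<eta>: "0 < \<eta>" "\<eta> < 1"
    and R: "R = (\<lambda>\<phi>. ((1 + \<eta>) / 2) *\<^sub>R dyad (coherent hbar a) \<phi>
                 + ((1 - \<eta>) / 2) *\<^sub>R dyad (coherent hbar (- a)) \<phi>)"
    and S: "S = (\<lambda>\<phi>. (1 / 2) *\<^sub>R dyad (coherent hbar a) \<phi>
                 + (1 / 2) *\<^sub>R dyad (coherent hbar (- a)) \<phi>)"
  obtains Q where "is_coupling R S Q"
    and "sandwich_trace (sqrt_graph (cost_graph hbar)) Q < ennreal (2 * \<eta> * a\<^sup>2)"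
proof -
  define p m where "p = coherent hbar a" and "m = coherent hbar (- a)"
  define s where "s = exp (- a\<^sup>2 / hbar)"
  have s: "0 < s" "s \<le> 1" using hbar by (auto simp: s_def)
  have [simp]: "cinner p p = 1" "cinner m m = 1" by (simp_all add: p_def m_def cinner_coherent[OF hbar])
  have [simp]: "cinner p m = of_real s" "cinner m p = of_real s"
    using hbar by (simp_all add: p_def m_def s_def cinner_coherent power2_eq_square)
  \<comment> \<open>A sufficiently small positive value: it is at most \<eta>/8 and at most (1 -
    \<eta>)/8, which is what the nonnegativity of the weights uses.\<close>
  define t where "t = \<eta> * (1 - \<eta>) / 8"
  have t: "0 < t" "t \<le> \<eta> / 8" "t \<le> (1 - \<eta>) / 8"
    using \<eta> mult_left_mono[of "1 - \<eta>" 1 \<eta>] mult_right_mono[of \<eta> 1 "1 - \<eta>"] by (auto simp: t_def)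
  have st: "0 < s * t" "s * t \<le> t" "s\<^sup>2 * t \<le> t"
    using s t mult_right_mono[of s 1 t] mult_right_mono[of "s\<^sup>2" 1 t] power_le_one[of s 2] by auto
  define u where "u = s * t"
  define pp mm pm where "pp = p \<otimes>\<^sub>v p" and "mm = m \<otimes>\<^sub>v m" and "pm = p \<otimes>\<^sub>v m"
  \<comment> \<open>Positivity is made visible by dyads. The dyad of \<open>pp - mm\<close> with
    weight \<open>t\<close> produces the entry \<open>- t\<close>, those of \<open>pp + pm\<close>
    and \<open>pm + mm\<close> with weight \<open>u\<close> produce the entries
    \<open>s * t\<close>, and the diagonal parts they add are subtracted from the first three
    weights.\<close>
  define c where "c k = [1/2 - t - u, (1 - \<eta>)/2 - t - u, \<eta>/2 - 2 * s\<^sup>2 * t - 2 * u, t, u, u] ! k" for k :: nat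
  define \<psi> where "\<psi> k = [pp, mm, pm, pp - mm, pp + pm, pm + mm] ! k" for k :: nat
  define Q where "Q = (\<lambda>\<phi>. \<Sum>k<6. c k *\<^sub>R dyad (\<psi> k) \<phi>)"
  have c: "0 \<le> c k" if "k \<in> {..<6}" for k
  proof -
    \<comment> \<open>The critical weight is the one at \<open>pm\<close>: both
      \<open>s^2 * t\<close> and \<open>u\<close> are at most \<open>t\<close>, so at most
      \<open>4 * t\<close>, hence at most \<eta>/2, is subtracted.\<close>
    have "0 \<le> 1/2 - t - u" "0 \<le> (1 - \<eta>)/2 - t - u" "0 \<le> \<eta>/2 - 2 * s\<^sup>2 * t - 2 * u" "0 \<le> t" "0 \<le> u"
      using st t \<eta> unfolding u_def[symmetric] by linarith+
    moreover have "k \<in> {0, 1, 2, 3, 4, 5}" using that by auto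
    ultimately show ?thesis by (auto simp: c_def)
  qed
  have sum6: "(\<Sum>k<6. f k) = f 0 + f 1 + f 2 + f 3 + f 4 + f 5" for f :: "nat \<Rightarrow> 'b::comm_monoid_add"
    by (simp add: eval_nat_numeral add.assoc)
  have trQ: "op_trace (T \<circ> Q) = of_real (1/2 - t - u) * cinner pp (T pp) + of_real ((1 - \<eta>)/2 - t - u) * cinner mm (T mm)
      + of_real (\<eta>/2 - 2 * s\<^sup>2 * t - 2 * u) * cinner pm (T pm)
      + of_real t * (cinner pp (T pp) - cinner pp (T mm) - cinner mm (T pp) + cinner mm (T mm))
      + of_real u * (cinner pp (T pp) + cinner pp (T pm) + cinner pm (T pp) + cinner pm (T pm))
      + of_real u * (cinner pm (T pm) + cinner pm (T mm) + cinner mm (T pm) + cinner mm (T mm))"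
    if T: "bounded_op T" for T
  proof -
    have [simp]: "T (x + y) = T x + T y" "T (x - y) = T x - T y" for x y
      using T by (simp_all add: bounded_op_def linear_simps)
    have "op_trace (T \<circ> Q) = (\<Sum>k<6. of_real (c k) * cinner (\<psi> k) (T (\<psi> k)))"
      unfolding Q_def by (rule op_trace_comp_dyads[OF is_onb_some_onb_L2(2) T])
    then show ?thesis
      unfolding sum6
      by (simp add: c_def \<psi>_def cinner_add_left cinner_add_right cinner_diff_left cinner_diff_right algebra_simps)
  qed
  have tr2: "op_trace (T \<circ> (\<lambda>\<phi>. x *\<^sub>R dyad p \<phi> + y *\<^sub>R dyad m \<phi>)) = of_real x * cinner p (T p) + of_real y * cinner m (T m)"
    if T: "bounded_op T" for T x y
    using op_trace_comp_dyads[OF is_onb_some_onb_L2(1) T, where K = "{..<2::nat}" and c = "\<lambda>k. [x, y] ! k" and \<psi> = "\<lambda>k. [p, m] ! k"]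
    by (simp add: eval_nat_numeral)
  have "is_coupling R S Q"
    unfolding is_coupling_def
  proof (intro conjI allI impI)
    \<comment> \<open>The overlaps contribute - 2 s^2 t from the pair \<open>pp\<close>,
      \<open>mm\<close> and + 4 s^2 t from the pairs with \<open>pm\<close>; the lowered weight of
      \<open>pm\<close> supplies the remaining - 2 s^2 t.\<close>
    have "op_trace (id \<circ> Q) = 1"
      unfolding trQ[OF bounded_op_id] using s
      by (simp add: pp_def mm_def pm_def cinner_tensor u_def power2_eq_square field_simps)
    then show "density_matrix Q"
      using positive_op_dyads[where K = "{..<6}" and c = c and \<zeta> = \<psi>] c
      by (simp add: density_matrix_def Q_def)
  next
    fix A :: "real L2 \<Rightarrow> real L2" assume A: "bounded_op A"
    \<comment> \<open>Tracing out the second factor turns the \<open>pp\<close>, \<open>mm\<close>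
      entry into - s t times the cross terms between \<open>p\<close> and \<open>m\<close>,
      cancelled by the \<open>pm\<close>, \<open>mm\<close> entry. The \<open>pp\<close>,
      \<open>pm\<close> entry gives + 2 s^2 t at \<open>p\<close>, cancelled by the lowered weight
      of \<open>pm\<close>.\<close>
    show "op_trace ((A \<otimes>\<^sub>o id) \<circ> Q) = op_trace (A \<circ> R)"
      unfolding trQ[OF bounded_op_tensor_id(1)[OF A]] R p_def[symmetric] m_def[symmetric] tr2[OF A]
      by (simp add: pp_def mm_def pm_def op_tensor_id_apply(1)[OF A] cinner_tensor u_def power2_eq_square field_simps)
  next
    fix A :: "real L2 \<Rightarrow> real L2" assume A: "bounded_op A"
    \<comment> \<open>The mirror image: now the \<open>pp\<close>, \<open>pm\<close> entry cancels
      the cross terms, and the \<open>pm\<close>, \<open>mm\<close> entry compensates the lowered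
      weight at \<open>m\<close>.\<close>
    show "op_trace ((id \<otimes>\<^sub>o A) \<circ> Q) = op_trace (A \<circ> S)"
      unfolding trQ[OF bounded_op_tensor_id(2)[OF A]] S p_def[symmetric] m_def[symmetric] tr2[OF A]
      by (simp add: pp_def mm_def pm_def op_tensor_id_apply(2)[OF A] cinner_tensor u_def power2_eq_square field_simps)
  qed
  moreover have "sandwich_trace (sqrt_graph (cost_graph hbar)) Q < ennreal (2 * \<eta> * a\<^sup>2)"
  proof -
    obtain \<xi> where \<xi>: "(pm, \<xi>) \<in> cost_graph hbar" "cinner pm \<xi> = of_real ((a - - a)\<^sup>2)"
      using cost_coherent_off_diagonal[OF hbar, of a "- a"] unfolding pm_def p_def m_def by blast
    have z: "(pp, 0) \<in> cost_graph hbar" "(mm, 0) \<in> cost_graph hbar"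
      unfolding pp_def mm_def p_def m_def by (rule cost_coherent_diagonal[OF hbar])+
    have sym: "cinner \<omega> x = cinner \<phi> y" if "(\<phi>, \<omega>) \<in> cost_graph hbar" "(x, y) \<in> cost_graph hbar" for \<phi> \<omega> x y
      using diag_graph_symmetric[OF onb_osc_fun[OF hbar]] that unfolding cost_graph_eq_diag_graph[OF hbar] by blast
    have lin: "(x + x', y + y') \<in> cost_graph hbar" "(x - x', y - y') \<in> cost_graph hbar"
      if "(x, y) \<in> cost_graph hbar" "(x', y') \<in> cost_graph hbar" for x x' y y'
      using diag_graph_add diag_graph_add[OF _ diag_graph_scaleR[where r = "-1"]] that
      unfolding cost_graph_eq_diag_graph[OF hbar] by (auto, fastforce)
    \<comment> \<open>Vectors in the kernel of a symmetric operator are orthogonal to its range, so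
      the cross terms with \<open>pm\<close> have no cost.\<close>
    have zero: "cinner pp \<xi> = 0" "cinner mm \<xi> = 0"
      using sym[OF z(1) \<xi>(1)] sym[OF z(2) \<xi>(1)] by simp_all
    define \<Xi> where "\<Xi> k = [0, 0, \<xi>, 0, \<xi>, \<xi>] ! k" for k :: nat
    have "(\<psi> k, \<Xi> k) \<in> cost_graph hbar" if "k \<in> {..<6}" for k
    proof -
      have "k \<in> {0, 1, 2, 3, 4, 5}" using that by auto
      then show ?thesis
        using \<xi>(1) z lin(2)[OF z] lin(1)[OF z(1) \<xi>(1)] lin(1)[OF \<xi>(1) z(2)] by (auto simp: \<psi>_def \<Xi>_def)
    qed
    then have "sandwich_trace (sqrt_graph (cost_graph hbar)) Q = ennreal (\<Sum>k<6. c k * Re (cinner (\<psi> k) (\<Xi> k)))"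
      unfolding Q_def by (intro sandwich_trace_cost_dyads[OF hbar] c)
    \<comment> \<open>The weights of the three dyads containing \<open>pm\<close> add up to its
      diagonal entry, and each such dyad costs \<open>(2 * a)^2\<close> per unit weight.\<close>
    also have "(\<Sum>k<6. c k * Re (cinner (\<psi> k) (\<Xi> k))) = 4 * a\<^sup>2 * (\<eta> / 2 - 2 * s\<^sup>2 * t)"
      unfolding sum6 by (simp add: c_def \<psi>_def \<Xi>_def cinner_add_left \<xi>(2) zero power_mult_distrib algebra_simps)
    also have "ennreal \<dots> < ennreal (2 * \<eta> * a\<^sup>2)"
    proof (rule ennreal_lessI)
      show "0 < 2 * \<eta> * a\<^sup>2" using \<eta> a by simp
      have "0 < 8 * a\<^sup>2 * (s\<^sup>2 * t)" using a s t by simp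
      then show "4 * a\<^sup>2 * (\<eta> / 2 - 2 * s\<^sup>2 * t) < 2 * \<eta> * a\<^sup>2" by (simp add: algebra_simps)
    qed
    finally show ?thesis .
  qed
  ultimately show ?thesis by (rule that)
qed

theorem mainTheorem2:
  fixes hbar a \<eta> :: real
    and R S :: "real L2 \<Rightarrow> real L2"
  assumes "0 < hbar" and "0 < a" and "0 < \<eta>" and "\<eta> < 1"
    and "R = (\<lambda>\<phi>. ((1 + \<eta>) / 2) *\<^sub>R dyad (coherent hbar a) \<phi>
                 + ((1 - \<eta>) / 2) *\<^sub>R dyad (coherent hbar (- a)) \<phi>)"
    and "S = (\<lambda>\<phi>. (1 / 2) *\<^sub>R dyad (coherent hbar a) \<phi>
                 + (1 / 2) *\<^sub>R dyad (coherent hbar (- a)) \<phi>)"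
  shows "(MK2 hbar R S)\<^sup>2 <
           (W2 (mixture ((1 + \<eta>) / 2) (dirac a) ((1 - \<eta>) / 2) (dirac (- a)))
               (mixture (1 / 2) (dirac a) (1 / 2) (dirac (- a))))\<^sup>2
       \<and> (W2 (mixture ((1 + \<eta>) / 2) (dirac a) ((1 - \<eta>) / 2) (dirac (- a)))
               (mixture (1 / 2) (dirac a) (1 / 2) (dirac (- a))))\<^sup>2 = ennreal (2 * \<eta> * a\<^sup>2)"
proof -
  obtain Q where Q: "is_coupling R S Q"
    "sandwich_trace (sqrt_graph (cost_graph hbar)) Q < ennreal (2 * \<eta> * a\<^sup>2)"
    using cheap_coupling[OF assms] by blast
  have "(MK2 hbar R S)\<^sup>2 \<le> sandwich_trace (sqrt_graph (cost_graph hbar)) Q"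
    unfolding MK2_squared using Q(1) by (intro INF_lower) simp
  with Q(2) show ?thesis
    using W2_two_point[OF assms(2-4)] by simp
qed

end
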